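(* Let $p>3$ be a prime with $p\equiv 3 \pmod 4$, and let $b\ge 2$ be an integer that is a quadratic nonresidue modulo $p$. Let $d$ be the order of $b$ in $(\mathbb{Z}/p\mathbb{Z})^{\times}$ (so $d$ is even), let $g$ be a primitive root modulo $p$, and for $j=0,\ldots,(p-1)/d-1$ let $b_j=(g^{2j})_p$. Let $$\frac{b_j}{p}=\sum_{k=1}^{\infty}a_k^{(j)}b^{-k},\qquad a_k^{(j)}\in\{0,1,\ldots,b-1\},$$ be the digit expansion of $b_j/p$ with respect to the basis $b$, which is periodic with period $(a_1^{(j)},a_2^{(j)},\ldots,a_d^{(j)})$, and let $$S_j=a_1^{(j)}+a_3^{(j)}+\cdots+a_{d-1}^{(j)},\qquad j=0,\ldots,(p-1)/d-1,$$ be the sum of the digits with odd indices in this period. Then $$S_0+S_1+\cdots+S_{(p-1)/d-1}=\frac{(b-1)(p-1)}{4}-\frac{(b+1)h_2^-}{2}.$$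
   Context: For an integer $k$, $(k)_p$ denotes the number $j\in\{0,1,\ldots,p-1\}$ with $j\equiv k\pmod p$. $h_2^-$ denotes the relative class number of the imaginary quadratic field $\mathbb{Q}(\sqrt{-p})$, which equals its class number. The digits of the expansion of $b_j/p$ are given by $a_k^{(j)}=\theta_b(b_jb^{k-1})$, where $\theta_b(k)=\bigl(b(k)_p-(bk)_p\bigr)/p$ for $k\in\mathbb{Z}$. *)

theory Defs
  imports
    "HOL-Analysis.Analysis"
    "HOL-Number_Theory.Number_Theory"
    "HOL-Algebra.Ideal"
begin

text \<open>
  Number fields are represented by their underlying subsets of the complex numbers.
\<close>

definition quadratic_field :: "int \<Rightarrow> complex set" where
  "quadratic_field D = {of_rat x + of_rat y * csqrt (of_int D) | x y. True}"

definition ring_of_integers :: "complex set \<Rightarrow> complex ring" where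
  "ring_of_integers K =
     \<lparr>carrier = {x \<in> K. algebraic_int x}, mult = (*), one = 1, zero = 0, add = (+)\<rparr>"

definition nonzero_ideals :: "('a, 'm) ring_scheme \<Rightarrow> 'a set set" where
  "nonzero_ideals R = {I. ideal I R \<and> I \<noteq> {\<zero>\<^bsub>R\<^esub>}}"

text \<open>
  Two nonzero (integral) ideals $I$, $J$ lie in the same ideal class iff $(\alpha) I = (\beta) J$
  for some nonzero ring elements $\alpha$, $\beta$. Over the ring of integers of a number field the
  classes are the elements of the ideal class group, since every fractional ideal becomes integral
  after multiplication by a nonzero element of the ring.
\<close>

definition ideal_class_rel :: "('a, 'm) ring_scheme \<Rightarrow> ('a set \<times> 'a set) set" where
  "ideal_class_rel R =
     {(I, J). I \<in> nonzero_ideals R \<and> J \<in> nonzero_ideals R \<and>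
       (\<exists>\<alpha>\<in>carrier R - {\<zero>\<^bsub>R\<^esub>}. \<exists>\<beta>\<in>carrier R - {\<zero>\<^bsub>R\<^esub>}.
         (\<lambda>x. \<alpha> \<otimes>\<^bsub>R\<^esub> x) ` I = (\<lambda>x. \<beta> \<otimes>\<^bsub>R\<^esub> x) ` J)}"

definition class_number :: "complex set \<Rightarrow> nat" where
  "class_number K =
     card (nonzero_ideals (ring_of_integers K) // ideal_class_rel (ring_of_integers K))"

text \<open>
  The relative class number $h^- = h / h^+$, where $h^+$ is the class number of the maximal real
  subfield. For an imaginary quadratic field that subfield is $\mathbb{Q}$, so $h^+ = 1$ and
  $h^- = h$.
\<close>

definition relative_class_number :: "complex set \<Rightarrow> real" where
  "relative_class_number K = real (class_number K) / real (class_number (K \<inter> \<real>))"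

end

theory Submission
  imports Defs "HOL-Complex_Analysis.Complex_Analysis" "HOL-Real_Asymp.Real_Asymp"
begin

text \<open>
  The digits of $c_j/p$ are $(b (c_j b^{k-1})_p - (c_j b^k)_p)/p$. Since \<open>b\<close> is a nonresidue, the
  numbers $c_j b^{2i}$ run once through the quadratic residues modulo \<open>p\<close>, so the sum of the $S_j$
  is an expression in $\sum_{n<p} n \chi(n)$, and everything rests on Dirichlet's formula
  $p h = - \sum_{n<p} n \chi(n)$.

  The formula is obtained by comparing constant terms as $t \to 0$, which needs neither Gauss sums
  nor the value $L(1,\chi)$. Let $F(t) = \sum_I e^{-t N(I)}$, the sum over all nonzero ideals.
  An ideal class contributes half of a theta series of a binary quadratic form without its term at
  the origin. Such a theta series is $C/t + o(1)$, so that \<open>4 F(4 t) - F(t)\<close>, in which the polar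
  part cancels, tends to $-\frac{3}{2} h$. On the other hand, the number of ideals of norm \<open>n\<close> is
  $\sum_{d \mid n} \chi(d)$, so $F(t) = \sum_d \chi(d) / (e^{td} - 1)$, and then
  \<open>4 F(4 t) - F(t)\<close> is a combination of the sums $\sum_d \chi(d) / (e^{td} + 1)$, whose limits are found
  by summation by parts.
\<close>

section \<open>Gaussian sums\<close>

text \<open>The constants C are never computed. The factor 4 is chosen because an unknown C/t
  satisfies 4 C/(4t) = C/t, while the constant -h/2 is multiplied by 4 - 1 = 3. With t = e^2 it
  remains to compare a theta series at e and at 2 e, and for this it is enough to know that the sum
  of exp(-e^2 (x + m)^2) over the integers m depends on the shift x only up to O(e^2): separating
  even and odd m then relates the two scales. Poisson summation would give this at once; in its
  place the shift is made complex and Cauchy's estimate is applied to an entire function of period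
  1. On the other side the poles at 0 of the terms chi(d)/(e^{td} - 1) would add up to L(1,chi)/t.
  The same combination cancels them term by term and leaves a decreasing convex weight, to which
  summation by parts applies twice. The half in front of the theta series comes from the units 1 and
  -1, which are all the units as p > 3. Finally h^- is h divided by the class number of the real
  subfield, here the rationals, whose class number has to be computed as well.\<close>

lemma has_sum_int_split:
  fixes f :: "int \<Rightarrow> 'a :: topological_comm_monoid_add"
  assumes "((\<lambda>n. f (int n)) has_sum a) UNIV" "((\<lambda>n. f (- int n)) has_sum b) {1..}"
  shows "(f has_sum (a + b)) UNIV"
proof -
  have 1: "(f has_sum a) (range int)"
    using assms(1) by (subst has_sum_reindex) (auto simp: inj_on_def o_def)
  have 2: "(f has_sum b) ((\<lambda>n. - int n) ` {1..})"
    using assms(2) by (subst has_sum_reindex) (auto simp: inj_on_def o_def)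
  have "(f has_sum (a + b)) (range int \<union> (\<lambda>n. - int n) ` {1..})"
    by (rule has_sum_Un_disjoint[OF 1 2]) auto
  also have "range int \<union> (\<lambda>n. - int n) ` {1..} = UNIV"
  proof -
    have "x \<in> range int \<union> (\<lambda>n. - int n) ` {1..}" for x
      by (cases x rule: int_cases) (auto intro!: image_eqI[where x = "Suc _"])
    thus ?thesis by blast
  qed
  finally show ?thesis .
qed

lemma has_sum_geometric_abs_int:
  fixes q :: real
  assumes "0 \<le> q" "q < 1"
  shows "((\<lambda>m::int. q ^ nat \<bar>m\<bar>) has_sum ((1 + q) / (1 - q))) UNIV"
proof -
  have 1: "((\<lambda>n. q ^ nat \<bar>int n\<bar>) has_sum (1 / (1 - q))) UNIV"
    using assms by (auto intro!: sums_nonneg_imp_has_sum geometric_sums)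
  have 2: "((\<lambda>n. q ^ nat \<bar>- int n\<bar>) has_sum (q / (1 - q))) {1..}"
    using has_sum_geometric_from_1[of q] assms by simp
  have "1 / (1 - q) + q / (1 - q) = (1 + q) / (1 - q)"
    using assms by (simp add: field_simps)
  thus ?thesis using has_sum_int_split[OF 1 2] by simp
qed

text \<open>The shift \<open>z\<close> is complex only to make Cauchy's estimate available; in the
  end it is real, and \<open>theta\<close> is the restriction to real shifts.\<close>

definition gauss_sum :: "real \<Rightarrow> complex \<Rightarrow> complex" where
  "gauss_sum e z = (\<Sum>\<^sub>\<infinity>m::int. exp (- ((of_real e * (z + of_int m))\<^sup>2)))"

text \<open>Gaussian decay is traded for geometric decay through 2 u \<le> 1 + u^2 with u = e |Re z
  + m|. The majorant has an explicit sum, and moving off the real axis costs only the factor exp(e^2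
  (Im z)^2).\<close>

lemma gauss_term_bound:
  assumes "e > 0"
  shows "norm (exp (- ((of_real e * (z + of_int m))\<^sup>2)) :: complex)
    \<le> exp (1 + 2 * e * \<bar>Re z\<bar> + e\<^sup>2 * (Im z)\<^sup>2) * exp (- 2 * e) ^ nat \<bar>m\<bar>"
proof -
  have "e * (\<bar>real_of_int m\<bar> - \<bar>Re z\<bar>) \<le> e * \<bar>Re z + m\<bar>"
    using assms by (intro mult_left_mono) auto
  moreover have "2 * (e * \<bar>Re z + m\<bar>) \<le> 1 + (e * (Re z + m))\<^sup>2"
    using sum_squares_ge_zero[of "e * \<bar>Re z + m\<bar> - 1" 0]
    by (auto simp: power2_eq_square algebra_simps abs_if)
  ultimately have "(e * Im z)\<^sup>2 - (e * (Re z + m))\<^sup>2 \<le>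
      1 + 2 * e * \<bar>Re z\<bar> + e\<^sup>2 * (Im z)\<^sup>2 + real (nat \<bar>m\<bar>) * (- 2 * e)"
    by (simp add: algebra_simps power_mult_distrib)
  hence "exp ((e * Im z)\<^sup>2 - (e * (Re z + m))\<^sup>2) \<le>
     exp (1 + 2 * e * \<bar>Re z\<bar> + e\<^sup>2 * (Im z)\<^sup>2 + real (nat \<bar>m\<bar>) * (- 2 * e))" by simp
  also have "\<dots> = exp (1 + 2 * e * \<bar>Re z\<bar> + e\<^sup>2 * (Im z)\<^sup>2) * exp (- 2 * e) ^ nat \<bar>m\<bar>"
    by (simp only: exp_add exp_of_nat_mult)
  also have "(e * Im z)\<^sup>2 - (e * (Re z + m))\<^sup>2 = Re (- ((of_real e * (z + of_int m))\<^sup>2))"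
    by (simp add: power2_eq_square)
  finally show ?thesis by simp
qed

lemma summable_gauss_bound:
  assumes "e > (0::real)"
  shows "((\<lambda>m::int. c * exp (- 2 * e) ^ nat \<bar>m\<bar>) has_sum
     c * ((1 + exp (- 2 * e)) / (1 - exp (- 2 * e)))) UNIV"
  by (intro has_sum_cmult_right has_sum_geometric_abs_int) (use assms in auto)

lemma gauss_has_sum:
  assumes "e > 0"
  shows "((\<lambda>m::int. exp (- ((of_real e * (z + of_int m))\<^sup>2))) has_sum gauss_sum e z) UNIV"
proof -
  let ?f = "\<lambda>m::int. exp (- ((of_real e * (z + of_int m))\<^sup>2))"
  let ?g = "\<lambda>m::int. exp (1 + 2 * e * \<bar>Re z\<bar> + e\<^sup>2 * (Im z)\<^sup>2) * exp (- 2 * e) ^ nat \<bar>m\<bar>"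
  have "?g summable_on UNIV"
    using summable_gauss_bound[OF assms] by (rule has_sum_imp_summable)
  moreover have "norm (?f m) \<le> ?g m" for m
    using gauss_term_bound[OF assms] .
  ultimately have "(\<lambda>m. norm (?f m)) summable_on UNIV"
    by (intro Infinite_Sum.abs_summable_on_comparison_test'[of ?g UNIV ?f])
  thus ?thesis unfolding gauss_sum_def by (intro has_sum_infsum) (rule abs_summable_summable)
qed

lemma gauss_sum_periodic_int: "gauss_sum e (z + of_int k) = gauss_sum e z"
  unfolding gauss_sum_def
  by (rule infsum_reindex_bij_witness[of _ "\<lambda>m. m - k" "\<lambda>m. m + k"]) (auto simp: algebra_simps)

lemma gauss_sum_periodic: "gauss_sum e (z + 1) = gauss_sum e z"
  using gauss_sum_periodic_int[of e z 1] by simp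

lemma gauss_sum_holomorphic:
  assumes "e > 0"
  shows "gauss_sum e holomorphic_on UNIV"
proof -
  have "gauss_sum e holomorphic_on ball 0 r" for r
  proof -
    let ?c = "exp (1 + 2 * e * r + e\<^sup>2 * r\<^sup>2)"
    have "norm (exp (- ((of_real e * (z + of_int m))\<^sup>2)) :: complex) \<le> ?c * exp (- 2 * e) ^ nat \<bar>m\<bar>"
      if "z \<in> cball 0 r" for z :: complex and m
    proof -
      have "\<bar>Re z\<bar> \<le> r" "\<bar>Im z\<bar> \<le> r"
        using that abs_Re_le_cmod[of z] abs_Im_le_cmod[of z] by auto
      hence "exp (1 + 2 * e * \<bar>Re z\<bar> + e\<^sup>2 * (Im z)\<^sup>2) \<le> ?c"
        using assms by (auto intro!: add_mono mult_left_mono simp: abs_le_square_iff[symmetric])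
      thus ?thesis
        by (intro order.trans[OF gauss_term_bound[OF assms]] mult_right_mono) auto
    qed
    hence "uniform_limit (cball 0 r) (\<lambda>X z. \<Sum>m\<in>X. exp (- ((of_real e * (z + of_int m))\<^sup>2)))
             (gauss_sum e) (finite_subsets_at_top (UNIV::int set))"
      by (intro Weierstrass_m_test_general'[where M = "\<lambda>m. ?c * exp (- 2 * e) ^ nat \<bar>m\<bar>"]
            gauss_has_sum assms has_sum_imp_summable[OF summable_gauss_bound])
    thus ?thesis
      by (rule holomorphic_uniform_limit[rotated])
         (auto intro!: always_eventually continuous_intros holomorphic_intros)
  qed
  hence "gauss_sum e holomorphic_on (\<Union>r. ball 0 r)"
    by (intro holomorphic_on_UN_open) auto
  also have "(\<Union>r. ball 0 r) = (UNIV :: complex set)"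
    by (auto intro: gt_ex)
  finally show ?thesis .
qed

text \<open>By periodicity \<open>Re z\<close> can be taken in [0, 1), which is why the bound
  involves \<open>Im z\<close> alone. The order 1/e comes from the sum of the geometric majorant
  with ratio exp(-2e).\<close>

lemma gauss_sum_bound:
  assumes "0 < e" "e \<le> 1"
  shows "norm (gauss_sum e z) \<le> 3 * exp (3 + e\<^sup>2 * (Im z)\<^sup>2) / e"
proof -
  define w where "w = z + of_int (- \<lfloor>Re z\<rfloor>)"
  have w: "\<bar>Re w\<bar> \<le> 1" "Im w = Im z" "gauss_sum e z = gauss_sum e w"
    unfolding w_def gauss_sum_periodic_int by (auto simp: abs_if) linarith+
  have "norm (gauss_sum e w) \<le> exp (1 + 2 * e * \<bar>Re w\<bar> + e\<^sup>2 * (Im w)\<^sup>2) *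
           ((1 + exp (- 2 * e)) / (1 - exp (- 2 * e)))"
    by (rule norm_infsum_le[OF gauss_has_sum summable_gauss_bound gauss_term_bound]) (use assms in auto)
  also have "\<dots> \<le> exp (3 + e\<^sup>2 * (Im z)\<^sup>2) * (3 / e)"
  proof (rule mult_mono)
    have "2 * e * \<bar>Re w\<bar> \<le> 2 * 1 * 1" using assms w by (intro mult_mono) auto
    thus "exp (1 + 2 * e * \<bar>Re w\<bar> + e\<^sup>2 * (Im w)\<^sup>2) \<le> exp (3 + e\<^sup>2 * (Im z)\<^sup>2)"
      using w by simp
    \<comment> \<open>From exp(2e) \<ge> 1 + 2e; the hypothesis e \<le> 1 then replaces 1 + 2e by
      3.\<close>
    have "exp (- 2 * e) \<le> 1 / (1 + 2 * e)"
      using assms exp_ge_add_one_self[of "2 * e"] by (simp add: exp_minus field_simps)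
    hence "1 - exp (- 2 * e) \<ge> 2 * e / (1 + 2 * e)" using assms by (simp add: field_simps)
    moreover have "2 * e / (1 + 2 * e) \<ge> 2 * e / 3" using assms by (intro divide_left_mono) auto
    ultimately have *: "1 - exp (- 2 * e) \<ge> 2 * e / 3" by linarith
    have "(1 + exp (- 2 * e)) / (1 - exp (- 2 * e)) \<le> 2 / (2 * e / 3)"
      using * assms by (intro frac_le) auto
    thus "(1 + exp (- 2 * e)) / (1 - exp (- 2 * e)) \<le> 3 / e" by simp
  qed (use assms in auto)
  finally show ?thesis using w by (simp add: mult_ac)
qed

section \<open>Derivatives of periodic entire functions\<close>

lemma convex_Reals: "convex (\<real> :: complex set)"
  by (auto simp: convex_def scaleR_conv_of_real)

text \<open>The derivative of a periodic function has mean zero over a period, so it cannot exceed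
  its own variation. A complex-valued derivative need not vanish anywhere, hence the auxiliary
  \<open>g\<close>: its increment over one period is exactly \<open>- deriv f x\<close>, while its
  derivative \<open>deriv f z - deriv f x\<close> stays below \<open>M\<close> there.\<close>

lemma periodic_deriv_bound:
  fixes f :: "complex \<Rightarrow> complex"
  assumes hol: "f holomorphic_on UNIV" and per: "\<And>z. f (z + 1) = f z"
    and bd: "\<And>x. x \<in> \<real> \<Longrightarrow> norm (deriv (deriv f) x) \<le> M" and x: "x \<in> \<real>"
  shows "norm (deriv f x) \<le> M"
proof -
  have hol': "deriv f holomorphic_on UNIV" using hol by (intro holomorphic_deriv) auto
  have lip: "norm (deriv f a - deriv f b) \<le> M * norm (a - b)" if "a \<in> \<real>" "b \<in> \<real>" for a b
    by (rule field_differentiable_bound[of \<real> _ "deriv (deriv f)"])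
       (use that bd hol' in \<open>auto intro!: holomorphic_derivI[THEN has_field_derivative_at_within]
          intro: convex_Reals\<close>)
  define g where "g z = f z - z * deriv f x" for z
  have "(g has_field_derivative (deriv f z - deriv f x)) (at z within closed_segment x (x+1))" for z
    unfolding g_def
    by (rule derivative_eq_intros holomorphic_derivI[OF hol, THEN has_field_derivative_at_within] | simp)+
  moreover have "norm (deriv f z - deriv f x) \<le> M" if "z \<in> closed_segment x (x + 1)" for z
  proof -
    from that obtain u where u: "0 \<le> u" "u \<le> 1" "z = (1 - u) *\<^sub>R x + u *\<^sub>R (x + 1)"
      by (auto simp: in_segment)
    hence z: "z = x + of_real u" by (simp add: scaleR_conv_of_real algebra_simps)
    have "norm (deriv f z - deriv f x) \<le> M * norm (z - x)"
      by (rule lip) (use x z in auto)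
    also have "\<dots> \<le> M * 1"
      using u(1,2) order.trans[OF norm_ge_zero bd[OF x]] unfolding z by (intro mult_left_mono) auto
    finally show ?thesis by simp
  qed
  ultimately have "norm (g (x+1) - g x) \<le> M * norm ((x+1) - x)"
    by (intro field_differentiable_bound[of "closed_segment x (x+1)"]) auto
  moreover have "g (x + 1) - g x = - deriv f x" by (simp add: g_def per) (simp add: algebra_simps)
  ultimately show ?thesis by simp
qed

lemma deriv_periodic:
  fixes f :: "complex \<Rightarrow> complex"
  assumes hol: "f holomorphic_on UNIV" and per: "\<And>z. f (z + 1) = f z"
  shows "deriv f (z + 1) = deriv f z"
proof -
  have "(f has_field_derivative deriv f (z+1)) (at (z + 1))"
    by (rule holomorphic_derivI[OF hol]) auto
  hence "((\<lambda>z. f (z + 1)) has_field_derivative deriv f (z+1)) (at z)"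
    by (simp add: DERIV_shift)
  hence "(f has_field_derivative deriv f (z+1)) (at z)" by (simp add: per)
  thus ?thesis by (simp add: DERIV_imp_deriv)
qed

text \<open>
  On the strip of height \<open>1 / e\<close> around the real axis the sum is still $O(1/e)$, so Cauchy's
  inequality makes its third derivative $O(e^2)$ on the real axis; periodicity passes this bound down
  to the first derivative.
\<close>

lemma gauss_sum_almost_const:
  assumes "0 < e" "e \<le> 1" "x \<in> \<real>"
  shows "norm (gauss_sum e x - gauss_sum e 0) \<le> 24 * exp 4 * e\<^sup>2"
proof -
  let ?f = "gauss_sum e" and ?M = "24 * exp 4 * e\<^sup>2"
  note hol = gauss_sum_holomorphic[OF assms(1)]
  note hol' = holomorphic_deriv[OF hol open_UNIV]
  have b3: "norm (deriv (deriv (deriv ?f)) x) \<le> ?M" if "x \<in> \<real>" for x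
  proof -
    have "norm ((deriv ^^ 3) ?f x) \<le> fact 3 * (4 * exp 4 / e) / (1 / e) ^ 3"
    proof (rule Cauchy_higher_deriv_bound[where y = 0])
      fix w assume w: "w \<in> ball x (1 / e)"
      have "\<bar>Im w\<bar> \<le> norm (w - x)"
        using abs_Im_le_cmod[of "w - x"] that by (auto simp: complex_is_Real_iff)
      also have "\<dots> < 1 / e" using w by (simp add: dist_norm norm_minus_commute)
      finally have "e * \<bar>Im w\<bar> \<le> 1" using assms by (simp add: field_simps)
      hence "(e * \<bar>Im w\<bar>)\<^sup>2 \<le> 1\<^sup>2" using assms by (intro power_mono) auto
      hence "3 * exp (3 + e\<^sup>2 * (Im w)\<^sup>2) / e \<le> 3 * exp 4 / e"
        using assms by (intro divide_right_mono) (auto simp: power_mult_distrib)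
      \<comment> \<open>Membership in an open ball needs a strict inequality, hence 4 in place of 3;
        multiplied by 3! it gives the constant 24.\<close>
      also have "\<dots> < 4 * exp 4 / e" using assms by (intro divide_strict_right_mono) auto
      finally show "?f w \<in> ball 0 (4 * exp 4 / e)"
        using gauss_sum_bound[OF assms(1,2), of w] by simp
    qed (use assms hol in \<open>auto intro: holomorphic_on_subset holomorphic_on_imp_continuous_on\<close>)
    also have "fact 3 * (4 * exp 4 / e) / (1 / e) ^ 3 = ?M"
      using assms by (simp add: fact_numeral field_simps power3_eq_cube power2_eq_square)
    finally show ?thesis by (simp add: numeral_3_eq_3)
  qed
  have b2: "norm (deriv (deriv ?f) x) \<le> ?M" if "x \<in> \<real>" for x
    using periodic_deriv_bound[OF hol' deriv_periodic[OF hol gauss_sum_periodic] b3 that] by blast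
  have b1: "norm (deriv ?f x) \<le> ?M" if "x \<in> \<real>" for x
    using periodic_deriv_bound[OF hol gauss_sum_periodic b2 that] by blast
  define y where "y = x + of_int (- \<lfloor>Re x\<rfloor>)"
  have y: "y \<in> \<real>" "norm y \<le> 1" "?f x = ?f y"
  proof -
    obtain r where r: "x = of_real r" using assms(3) by (auto elim: Reals_cases)
    have "y = of_real (frac r)" by (simp add: y_def r frac_def)
    moreover have "0 \<le> frac r" "frac r \<le> 1" by (simp_all add: frac_lt_1 less_imp_le)
    ultimately show "y \<in> \<real>" "norm y \<le> 1" by auto
    show "?f x = ?f y" by (simp only: y_def gauss_sum_periodic_int)
  qed
  have "norm (?f y - ?f 0) \<le> ?M * norm (y - 0)"
    by (rule field_differentiable_bound[of \<real> _ "deriv ?f"])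
       (use y b1 hol in \<open>auto intro!: holomorphic_derivI[THEN has_field_derivative_at_within] convex_Reals\<close>)
  also have "\<dots> \<le> ?M * 1" using y assms by (intro mult_left_mono) auto
  finally show ?thesis unfolding y(3) by (simp only: mult_1_right)
qed

section \<open>Theta values for real shifts\<close>

definition theta :: "real \<Rightarrow> real \<Rightarrow> real" where
  "theta e x = (\<Sum>\<^sub>\<infinity>m::int. exp (- ((e * (x + of_int m))\<^sup>2)))"

lemma theta_has_sum:
  assumes "e > 0"
  shows "((\<lambda>m::int. exp (- ((e * (x + of_int m))\<^sup>2))) has_sum theta e x) UNIV"
    and "gauss_sum e (of_real x) = of_real (theta e x)"
proof -
  have "((\<lambda>m::int. Re (exp (- ((of_real e * (of_real x + of_int m))\<^sup>2)))) has_sum Re (gauss_sum e (of_real x))) UNIV"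
    by (intro has_sum_Re gauss_has_sum assms)
  moreover have eq: "exp (- ((of_real e * (of_real x + of_int m))\<^sup>2)) =
      (of_real (exp (- ((e * (x + of_int m))\<^sup>2))) :: complex)" for m
    by (simp flip: exp_of_real)
  ultimately have "((\<lambda>m::int. exp (- ((e * (x + of_int m))\<^sup>2))) has_sum Re (gauss_sum e (of_real x))) UNIV"
    by (simp only: Re_complex_of_real)
  thus 1: "((\<lambda>m::int. exp (- ((e * (x + of_int m))\<^sup>2))) has_sum theta e x) UNIV"
    unfolding theta_def by (auto intro!: has_sum_infsum has_sum_imp_summable)
  have "((\<lambda>m::int. of_real (exp (- ((e * (x + of_int m))\<^sup>2))) :: complex) has_sum of_real (theta e x)) UNIV"
    using 1 by (rule has_sum_of_real)
  thus "gauss_sum e (of_real x) = of_real (theta e x)"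
    using gauss_has_sum[OF assms, of "of_real x"] unfolding eq by (rule has_sum_unique[rotated])
qed

lemma theta_nonneg: "theta e x \<ge> 0"
  unfolding theta_def by (rule infsum_nonneg) auto

lemma theta_bound:
  assumes "0 < e" "e \<le> 1"
  shows "theta e x \<le> 3 * exp 3 / e"
  using gauss_sum_bound[OF assms, of "of_real x"] theta_nonneg[of e x]
  by (simp add: theta_has_sum[OF assms(1)])

lemma theta_almost_const:
  assumes "0 < e" "e \<le> 1"
  shows "\<bar>theta e x - theta e 0\<bar> \<le> 24 * exp 4 * e\<^sup>2"
proof -
  have "gauss_sum e 0 = of_real (theta e 0)" using theta_has_sum(2)[OF assms(1), of 0] by simp
  thus ?thesis
    using gauss_sum_almost_const[OF assms, of "of_real x"]
    by (simp add: theta_has_sum[OF assms(1)] flip: of_real_diff)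
qed

text \<open>Even and odd integers: e (2k + 1) = 2e (k + 1/2). This relation between two scales does
  the work usually done by the functional equation.\<close>

lemma theta_half:
  assumes "e > 0"
  shows "theta e 0 = theta (2 * e) 0 + theta (2 * e) (1 / 2)"
proof -
  let ?f = "\<lambda>m::int. exp (- ((e * (0 + of_int m))\<^sup>2))"
  have "(?f has_sum theta (2 * e) 0) {m. even m}"
    by (subst has_sum_reindex_bij_witness[of _ "\<lambda>m. 2 * m" "\<lambda>m. m div 2"
          UNIV "\<lambda>m. exp (- ((2 * e * (0 + of_int m))\<^sup>2))", OF _ _ _ _ _ refl])
       (use theta_has_sum(1)[of "2 * e" 0] assms in \<open>auto elim!: evenE simp: mult_ac\<close>)
  moreover have "(?f has_sum theta (2 * e) (1 / 2)) {m. odd m}"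
    by (subst has_sum_reindex_bij_witness[of _ "\<lambda>m. 2 * m + 1" "\<lambda>m. m div 2"
          UNIV "\<lambda>m. exp (- ((2 * e * (1 / 2 + of_int m))\<^sup>2))", OF _ _ _ _ _ refl])
       (use theta_has_sum(1)[of "2 * e" "1 / 2"] assms in \<open>auto elim!: oddE simp: algebra_simps power2_eq_square\<close>)
  ultimately have "(?f has_sum (theta (2 * e) 0 + theta (2 * e) (1 / 2))) ({m. even m} \<union> {m. odd m})"
    by (rule has_sum_Un_disjoint) auto
  moreover have "{m::int. even m} \<union> {m. odd m} = UNIV" by auto
  ultimately show ?thesis using theta_has_sum(1)[OF assms, of 0] has_sum_unique by metis
qed

text \<open>The two shifts 0 and 1/2 give nearly the same value. So \<open>e * theta e 0\<close>
  hardly changes when \<open>e\<close> is doubled, and its limit need not be identified.\<close>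

lemma theta_double:
  assumes "0 < e" "2 * e \<le> 1"
  shows "\<bar>theta e 0 - 2 * theta (2 * e) 0\<bar> \<le> 96 * exp 4 * e\<^sup>2"
  using theta_almost_const[of "2 * e" "1 / 2"] theta_half[of e] assms
  by (simp add: power_mult_distrib)

text \<open>
  With $t$ the square of \<open>e\<close>, this is the theta series of the form
  $a^2 (m + n x)^2 + c^2 n^2$.
\<close>

definition theta2 :: "real \<Rightarrow> real \<Rightarrow> real \<Rightarrow> real \<Rightarrow> real" where
  "theta2 a c x e = (\<Sum>\<^sub>\<infinity>n::int. exp (- ((e * c * of_int n)\<^sup>2)) * theta (e * a) (of_int n * x))"

lemma theta2_has_sum:
  assumes "0 < a" "0 < c" "0 < e"
  shows "((\<lambda>(n::int, m::int). exp (- ((e * a * (of_int m + of_int n * x))\<^sup>2 + (e * c * of_int n)\<^sup>2)))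
           has_sum theta2 a c x e) UNIV"
    and "(\<lambda>n::int. exp (- ((e * c * of_int n)\<^sup>2)) * theta (e * a) (of_int n * x)) summable_on UNIV"
proof -
  let ?f = "\<lambda>(n::int, m::int). exp (- ((e * a * (of_int m + of_int n * x))\<^sup>2 + (e * c * of_int n)\<^sup>2))"
  let ?g = "\<lambda>n::int. exp (- ((e * c * of_int n)\<^sup>2)) * theta (e * a) (of_int n * x)"
  have 1: "((\<lambda>m. ?f (n, m)) has_sum ?g n) UNIV" for n
  proof -
    have "((\<lambda>m::int. exp (- ((e * c * of_int n)\<^sup>2)) * exp (- ((e * a * (of_int n * x + of_int m))\<^sup>2))) has_sum ?g n) UNIV"
      using assms by (intro has_sum_cmult_right theta_has_sum) auto
    thus ?thesis by (simp add: algebra_simps flip: exp_add)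
  qed
  \<comment> \<open>Here \<open>e * a\<close> may exceed 1, outside the range of
    \<open>theta_bound\<close>; a bound uniform in the shift is obtained from the geometric majorant
    after passing to the fractional part of the shift.\<close>
  have "\<exists>C. \<forall>y. theta (e * a) y \<le> C"
  proof -
    let ?C = "exp (1 + 2 * (e * a)) * ((1 + exp (- 2 * (e * a))) / (1 - exp (- 2 * (e * a))))"
    have "theta (e * a) y \<le> ?C" for y
    proof -
      define w where "w = y - of_int \<lfloor>y\<rfloor>"
      have "gauss_sum (e * a) (of_real y) = gauss_sum (e * a) (of_real y + of_int (- \<lfloor>y\<rfloor>))"
        by (rule gauss_sum_periodic_int[symmetric])
      hence "of_real (theta (e * a) y) = (of_real (theta (e * a) w) :: complex)"
        using assms by (simp add: w_def flip: theta_has_sum(2))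
      hence eq: "theta (e * a) y = theta (e * a) w" by (simp only: of_real_eq_iff)
      have "norm (gauss_sum (e * a) (of_real w)) \<le> ?C"
      proof (rule norm_infsum_le[OF gauss_has_sum summable_gauss_bound])
        fix m :: int
        have "\<bar>w\<bar> \<le> 1" unfolding w_def by linarith
        hence "e * a * \<bar>w\<bar> \<le> e * a * 1" using assms by (intro mult_left_mono) auto
        hence "exp (1 + 2 * (e * a) * \<bar>Re (of_real w)\<bar> + (e * a)\<^sup>2 * (Im (of_real w))\<^sup>2) \<le> exp (1 + 2 * (e * a))"
          by simp
        thus "norm (exp (- ((of_real (e * a) * (of_real w + of_int m))\<^sup>2)) :: complex)
              \<le> exp (1 + 2 * (e * a)) * exp (- 2 * (e * a)) ^ nat \<bar>m\<bar>"
          using assms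
          by (intro order.trans[OF gauss_term_bound[of "e * a" "of_real w"]] mult_right_mono) auto
      qed (use assms in auto)
      thus ?thesis using assms theta_nonneg[of "e * a" w] by (simp add: theta_has_sum(2) eq)
    qed
    thus ?thesis by blast
  qed
  then obtain C where C: "\<And>y. theta (e * a) y \<le> C" by blast
  have "(\<lambda>n::int. C * exp (- ((e * c * (0 + of_int n))\<^sup>2))) summable_on UNIV"
    using theta_has_sum(1)[of "e * c" 0] assms
    by (intro summable_on_cmult_right has_sum_imp_summable[where S = "theta (e * c) 0"]) auto
  thus 2: "?g summable_on UNIV"
    by (rule summable_on_comparison_test) (use C theta_nonneg in \<open>auto simp: mult.commute intro!: mult_right_mono\<close>)
  have "?f summable_on (UNIV \<times> UNIV)"
    by (rule summable_on_SigmaI[OF 1 2]) auto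
  thus "(?f has_sum theta2 a c x e) UNIV"
    using has_sum_SigmaI[OF 1 has_sum_infsum[OF 2]] by (simp add: theta2_def)
qed

text \<open>In each row the shift n x is dropped at the cost of O(e^2), and the weights of the rows
  add up to O(1/e). The double sum thus decouples into a product up to O(e), and \<open>x\<close>
  disappears from the main term.\<close>

lemma theta2_approx:
  assumes "0 < a" "0 < c" "0 < e" "e * a \<le> 1" "e * c \<le> 1"
  shows "\<bar>theta2 a c x e - theta (e * c) 0 * theta (e * a) 0\<bar> \<le> 72 * exp 7 * a\<^sup>2 / c * e"
proof -
  let ?w = "\<lambda>n::int. exp (- ((e * c * (0 + of_int n))\<^sup>2))"
  have w: "(?w has_sum theta (e * c) 0) UNIV" using assms by (intro theta_has_sum) auto
  have "((\<lambda>n. ?w n * theta (e * a) (of_int n * x)) has_sum theta2 a c x e) UNIV"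
    using has_sum_infsum[OF theta2_has_sum(2)[OF assms(1-3), of x]] by (simp add: theta2_def)
  hence 1: "((\<lambda>n. ?w n * theta (e * a) (of_int n * x) - ?w n * theta (e * a) 0) has_sum
           (theta2 a c x e - theta (e * c) 0 * theta (e * a) 0)) UNIV"
    unfolding diff_conv_add_uminus by (intro has_sum_add has_sum_uminusI has_sum_cmult_left w)
  have 2: "((\<lambda>n. ?w n * (24 * exp 4 * (e * a)\<^sup>2)) has_sum (theta (e * c) 0 * (24 * exp 4 * (e * a)\<^sup>2))) UNIV"
    by (intro has_sum_cmult_left w)
  have "norm (theta2 a c x e - theta (e * c) 0 * theta (e * a) 0) \<le> theta (e * c) 0 * (24 * exp 4 * (e * a)\<^sup>2)"
  proof (rule norm_infsum_le[OF 1 2])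
    fix n :: int
    have "\<bar>theta (e * a) (of_int n * x) - theta (e * a) 0\<bar> \<le> 24 * exp 4 * (e * a)\<^sup>2"
      by (rule theta_almost_const) (use assms in auto)
    hence "?w n * \<bar>theta (e * a) (of_int n * x) - theta (e * a) 0\<bar> \<le> ?w n * (24 * exp 4 * (e * a)\<^sup>2)"
      by (intro mult_left_mono) auto
    thus "norm (?w n * theta (e * a) (of_int n * x) - ?w n * theta (e * a) 0) \<le> ?w n * (24 * exp 4 * (e * a)\<^sup>2)"
      by (simp add: abs_mult flip: right_diff_distrib)
  qed
  also have "\<dots> \<le> (3 * exp 3 / (e * c)) * (24 * exp 4 * (e * a)\<^sup>2)"
    using assms by (intro mult_right_mono theta_bound) auto
  also have "\<dots> = 72 * (exp 3 * exp 4) * a\<^sup>2 / c * e"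
    using assms by (simp add: field_simps power2_eq_square)
  also have "exp 3 * exp 4 = exp (7::real)" by (simp flip: exp_add)
  finally show ?thesis by simp
qed

text \<open>The factor 4 is 2 * 2, one doubling for each of the two one-dimensional factors of the
  decoupled sum. By \<open>theta_double\<close> each doubling costs O(e^2), against the other factor
  of size O(1/e).\<close>

lemma theta2_limit:
  assumes "0 < a" "0 < c"
  shows "((\<lambda>e. 4 * theta2 a c x (2 * e) - theta2 a c x e) \<longlongrightarrow> 0) (at_right 0)"
proof -
  \<comment> \<open>The error of \<open>theta2_approx\<close> enters once at e and with weight 4 at
    2 e, so 9 times, for which 10 is allowed; the error of the product is 288 times the last
    bracket, for which 600 is allowed.\<close>
  define K where "K = 5 * (72 * exp 7 * a\<^sup>2 / c) * 2 + 600 * exp 7 * (c\<^sup>2 / a + a\<^sup>2 / c)"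
  have "((\<lambda>e. K * e) \<longlongrightarrow> K * 0) (at_right 0)" by (intro tendsto_intros)
  hence lim: "((\<lambda>e. K * e) \<longlongrightarrow> 0) (at_right 0)" by simp
  show ?thesis
  proof (rule Lim_null_comparison[OF _ lim])
    have "\<forall>\<^sub>F e in at_right 0. 0 < e \<and> e < min (1 / (2 * a)) (1 / (2 * c))"
      using assms by (intro eventually_at_rightI[of 0 "min (1 / (2 * a)) (1 / (2 * c))"]) auto
    thus "\<forall>\<^sub>F e in at_right 0. norm (4 * theta2 a c x (2 * e) - theta2 a c x e) \<le> K * e"
    proof eventually_elim
      case (elim e)
      hence e: "e > 0" "2 * (e * a) \<le> 1" "2 * (e * c) \<le> 1" "e * a \<le> 1" "e * c \<le> 1"
        using assms by (auto simp: field_simps)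
      define A A' C C' where "A = theta (e * a) 0" and "A' = 2 * theta (2 * (e * a)) 0"
        and "C = theta (e * c) 0" and "C' = 2 * theta (2 * (e * c)) 0"
      have "\<bar>theta2 a c x e - C * A\<bar> \<le> 72 * exp 7 * a\<^sup>2 / c * e"
        unfolding A_def C_def by (rule theta2_approx) (use e assms in auto)
      moreover have "\<bar>theta2 a c x (2 * e) - C' * A' / 4\<bar> \<le> 72 * exp 7 * a\<^sup>2 / c * (2 * e)"
        using theta2_approx[of a c "2 * e" x] e assms by (simp add: A'_def C'_def mult_ac)
      moreover have "\<bar>C' * A' - C * A\<bar> \<le> 600 * exp 7 * (c\<^sup>2 / a + a\<^sup>2 / c) * e"
      proof -
        have "\<bar>A - A'\<bar> \<le> 96 * exp 4 * (e * a)\<^sup>2" "\<bar>C - C'\<bar> \<le> 96 * exp 4 * (e * c)\<^sup>2"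
          unfolding A_def A'_def C_def C'_def using e assms by (auto intro!: theta_double)
        moreover have "0 \<le> A'" "0 \<le> C" by (auto simp: A'_def C_def theta_nonneg)
        moreover have "A' \<le> 2 * (3 * exp 3 / (2 * (e * a)))" "C \<le> 3 * exp 3 / (e * c)"
          unfolding A'_def C_def using e assms by (auto intro!: mult_left_mono theta_bound simp del: times_divide_eq_right)
        ultimately have "\<bar>C - C'\<bar> * \<bar>A'\<bar> + \<bar>C\<bar> * \<bar>A - A'\<bar> \<le>
            (96 * exp 4 * (e * c)\<^sup>2) * (2 * (3 * exp 3 / (2 * (e * a)))) + (3 * exp 3 / (e * c)) * (96 * exp 4 * (e * a)\<^sup>2)"
          by (intro add_mono mult_mono) auto
        also have "\<dots> = 288 * (exp 4 * exp 3) * (c\<^sup>2 / a + a\<^sup>2 / c) * e"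
          using e assms by (simp add: field_simps power2_eq_square)
        also have "exp 4 * exp 3 = exp (7::real)" by (simp flip: exp_add)
        also have "288 * exp 7 * (c\<^sup>2 / a + a\<^sup>2 / c) * e \<le> 600 * exp 7 * (c\<^sup>2 / a + a\<^sup>2 / c) * e"
          using e assms by (intro mult_right_mono) auto
        moreover have "\<bar>C' * A' - C * A\<bar> \<le> \<bar>C - C'\<bar> * \<bar>A'\<bar> + \<bar>C\<bar> * \<bar>A - A'\<bar>"
        proof -
          have "C' * A' - C * A = - ((C - C') * A') - C * (A - A')" by (simp add: algebra_simps)
          thus ?thesis by (metis abs_minus_cancel abs_mult abs_triangle_ineq4)
        qed
        ultimately show ?thesis by linarith
      qed
      moreover have "K * e = 72 * exp 7 * a\<^sup>2 / c * e + 4 * (72 * exp 7 * a\<^sup>2 / c * (2 * e)) + 72 * exp 7 * a\<^sup>2 / c * e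
           + 600 * exp 7 * (c\<^sup>2 / a + a\<^sup>2 / c) * e"
        by (simp add: K_def algebra_simps)
      moreover have "0 \<le> 72 * exp 7 * a\<^sup>2 / c * e" using e assms by auto
      ultimately show ?case unfolding real_norm_def by linarith
    qed
  qed
qed

section \<open>Abel summation and Lambert series\<close>

lemma sum_periodic:
  fixes c :: "nat \<Rightarrow> 'a :: comm_ring_1"
  assumes "\<And>n. c (n + p) = c n"
  shows "(\<Sum>n<p. c (m + n)) = (\<Sum>n<p. c n)"
proof (induction m)
  case (Suc m)
  have "(\<Sum>n<p. c (Suc m + n)) = (\<Sum>n<Suc p. c (m + n)) - c m"
    by (subst sum.lessThan_Suc_shift) simp
  also have "\<dots> = (\<Sum>n<p. c (m + n))" using assms[of m] by simp
  finally show ?case using Suc by simp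
qed simp

lemma partial_sums_periodic:
  fixes c :: "nat \<Rightarrow> real"
  assumes per: "\<And>n. c (n + p) = c n" and zero: "(\<Sum>n<p. c n) = 0"
  shows "(\<Sum>n<m + p. c n) = (\<Sum>n<m. c n)"
proof -
  have "(\<Sum>n<m + p. c n) = (\<Sum>n<m. c n) + (\<Sum>n<p. c (m + n))"
    by (induction p) auto
  thus ?thesis using sum_periodic[where c = c and p = p and m = m, OF per] zero by simp
qed

lemma periodic_bounded:
  fixes c :: "nat \<Rightarrow> real"
  assumes per: "\<And>n. c (n + p) = c n" and "p > 0"
  shows "\<bar>c n\<bar> \<le> (\<Sum>n<p. \<bar>c n\<bar>)"
proof -
  have "c (n mod p + p * k) = c (n mod p)" for k
  proof (induction k)
    case (Suc k)
    thus ?case using per[of "n mod p + p * k"] by (simp add: add_ac)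
  qed simp
  from this[of "n div p"] have "c n = c (n mod p)" by simp
  thus ?thesis using member_le_sum[of "n mod p" "{..<p}" "\<lambda>n. \<bar>c n\<bar>"] \<open>p > 0\<close> by simp
qed

lemma summation_by_parts:
  fixes c w :: "nat \<Rightarrow> real"
  shows "(\<Sum>n<N. c n * w n) = (\<Sum>n<N. (\<Sum>k<Suc n. c k) * (w n - w (Suc n))) + (\<Sum>k<N. c k) * w N"
  by (induction N) (auto simp: algebra_simps)

text \<open>Vanishing of the sum over a period makes the partial sums of \<open>c\<close> periodic,
  hence bounded by \<open>K\<close>. The boundary term dies with \<open>w\<close>, and monotonicity
  lets the differences of \<open>w\<close> telescope to \<open>w 0\<close>.\<close>

lemma sums_by_parts:
  fixes c w :: "nat \<Rightarrow> real"
  assumes per: "\<And>n. c (n + p) = c n" and zero: "(\<Sum>n<p. c n) = 0" and "p > 0"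
    and dec: "\<And>n. w (Suc n) \<le> w n" and lim: "w \<longlonglongrightarrow> 0"
  defines "K \<equiv> (\<Sum>n<p. \<bar>\<Sum>k<n. c k\<bar>)"
  shows "summable (\<lambda>n. (\<Sum>k<Suc n. c k) * (w n - w (Suc n)))" (is "summable ?t")
    and "(\<lambda>n. c n * w n) sums (\<Sum>n. (\<Sum>k<Suc n. c k) * (w n - w (Suc n)))"
    and "\<bar>\<Sum>n. (\<Sum>k<Suc n. c k) * (w n - w (Suc n))\<bar> \<le> K * w 0"
proof -
  have K: "\<bar>\<Sum>k<n. c k\<bar> \<le> K" for n
    unfolding K_def
    by (rule periodic_bounded[of "\<lambda>n. \<Sum>k<n. c k"]) (use partial_sums_periodic[OF per zero] \<open>p > 0\<close> in auto)
  have s: "(\<lambda>n. K * (w n - w (Suc n))) sums (K * (w 0 - 0))"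
    by (intro sums_mult telescope_sums' lim)
  have le: "norm (?t n) \<le> K * (w n - w (Suc n))" for n
    unfolding real_norm_def abs_mult using K[of "Suc n"] dec[of n] by (intro mult_mono) auto
  show sm: "summable ?t"
    by (rule summable_comparison_test'[OF sums_summable[OF s]]) (use le in auto)
  have "(\<lambda>N. (\<Sum>k<N. c k) * w N) \<longlonglongrightarrow> 0"
    by (rule Lim_null_comparison[where g = "\<lambda>N. K * \<bar>w N\<bar>"])
       (use K tendsto_mult_right_zero[OF tendsto_rabs_zero[OF lim], of K] in
         \<open>auto simp: abs_mult intro!: always_eventually mult_right_mono\<close>)
  hence "(\<lambda>N. (\<Sum>n<N. ?t n) + (\<Sum>k<N. c k) * w N) \<longlonglongrightarrow> (\<Sum>n. ?t n) + 0"
    by (intro tendsto_add summable_LIMSEQ sm)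
  thus "(\<lambda>n. c n * w n) sums (\<Sum>n. ?t n)"
    by (simp add: sums_def summation_by_parts[of c w])
  have "norm (\<Sum>n. ?t n) \<le> (\<Sum>n. K * (w n - w (Suc n)))"
    by (rule norm_suminf_le[OF le sums_summable[OF s]])
  thus "\<bar>\<Sum>n. ?t n\<bar> \<le> K * w 0" using sums_unique[OF s] by simp
qed

text \<open>Summation by parts twice. The partial sums of \<open>c\<close> are periodic with mean L
  = -(sum of n c n)/p. The mean contributes exactly L w 0 by telescoping; the rest is again periodic
  with sum zero and is summed by parts against the differences of \<open>w\<close>, which decrease
  by convexity. This leaves an error of order w 0 - w 1.\<close>

lemma abel_sum_periodic_bound:
  fixes c w :: "nat \<Rightarrow> real"
  assumes per: "\<And>n. c (n + p) = c n" and zero: "(\<Sum>n<p. c n) = 0" and p: "p > 0"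
    and dec: "\<And>n. w (Suc n) \<le> w n" and lim: "w \<longlonglongrightarrow> 0"
    and conv: "\<And>n. w (Suc n) - w (Suc (Suc n)) \<le> w n - w (Suc n)"
  shows "\<exists>S. (\<lambda>n. c n * w n) sums S \<and>
    \<bar>S + (\<Sum>n<p. real n * c n) / p * w 0\<bar> \<le>
      (\<Sum>n<p. \<bar>\<Sum>k<n. (\<Sum>j<Suc k. c j) + (\<Sum>n<p. real n * c n) / p\<bar>) * (w 0 - w 1)"
proof -
  define L where "L = - (\<Sum>n<p. real n * c n) / p"
  define d where "d n = (\<Sum>k<Suc n. c k) - L" for n
  note s = sums_by_parts(2)[OF per zero p dec lim]
  note sm = sums_by_parts(1)[OF per zero p dec lim]
  have perd: "d (n + p) = d n" for n
    using partial_sums_periodic[OF per zero, of "Suc n"] by (simp add: d_def)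
  \<comment> \<open>The term \<open>c n\<close> occurs in N - n of the first N partial sums; at N =
    p this evaluates the mean \<open>L\<close>.\<close>
  have "(\<Sum>n<N. \<Sum>k<Suc n. c k) = (\<Sum>n<N. (real N - n) * c n)" for N
  proof (induction N)
    case (Suc N)
    have "(\<Sum>n<Suc N. (real (Suc N) - n) * c n) = (\<Sum>n<N. (real N - n) * c n + c n) + c N"
      by (simp add: algebra_simps)
    thus ?case using Suc by (simp add: sum.distrib)
  qed simp
  hence "(\<Sum>n<p. \<Sum>k<Suc n. c k) = p * (\<Sum>n<p. c n) - (\<Sum>n<p. real n * c n)"
    by (simp add: algebra_simps sum_subtractf sum_distrib_left)
  hence "(\<Sum>n<p. d n) = 0"
    using zero p by (simp add: d_def sum_subtractf sum.distrib L_def del: sum.lessThan_Suc)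
  note s' = sums_by_parts[OF perd this p, of "\<lambda>n. w n - w (Suc n)"]
  have lim': "(\<lambda>n. w n - w (Suc n)) \<longlonglongrightarrow> 0"
    using tendsto_diff[OF lim LIMSEQ_Suc[OF lim]] by simp
  have "(\<lambda>n. d n * (w n - w (Suc n))) sums (\<Sum>n. (\<Sum>k<Suc n. d k) * (w n - w (Suc n) - (w (Suc n) - w (Suc (Suc n)))))"
    using s'(2) conv lim' by simp
  hence "(\<lambda>n. d n * (w n - w (Suc n)) + L * (w n - w (Suc n))) sums
     ((\<Sum>n. (\<Sum>k<Suc n. d k) * (w n - w (Suc n) - (w (Suc n) - w (Suc (Suc n))))) + L * (w 0 - 0))"
    by (intro sums_add sums_mult telescope_sums' lim)
  hence "(\<lambda>n. (\<Sum>k<Suc n. c k) * (w n - w (Suc n))) sums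
     ((\<Sum>n. (\<Sum>k<Suc n. d k) * (w n - w (Suc n) - (w (Suc n) - w (Suc (Suc n))))) + L * (w 0 - 0))"
    by (simp add: d_def algebra_simps)
  hence "(\<Sum>n. (\<Sum>k<Suc n. c k) * (w n - w (Suc n))) - L * w 0 =
     (\<Sum>n. (\<Sum>k<Suc n. d k) * (w n - w (Suc n) - (w (Suc n) - w (Suc (Suc n)))))"
    by (simp add: sums_iff)
  moreover have "\<bar>\<Sum>n. (\<Sum>k<Suc n. d k) * (w n - w (Suc n) - (w (Suc n) - w (Suc (Suc n))))\<bar>
     \<le> (\<Sum>n<p. \<bar>\<Sum>k<n. d k\<bar>) * (w 0 - w 1)"
    using s'(3) conv lim' by simp
  ultimately show ?thesis using s by (intro exI conjI) (auto simp: L_def d_def)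
qed

section \<open>The weight 1/(e^x + 1) and its sums against a periodic sequence\<close>

definition fermi :: "real \<Rightarrow> real" where "fermi x = 1 / (exp x + 1)"

text \<open>
  Replacing $x$ by $2x$ and doubling removes the pole of $1/(e^x-1)$ at 0; applied twice, this
  regularizes \<open>4 F (4 t) - F t\<close>.
\<close>

lemma fermi_eq:
  assumes "x > 0"
  shows "2 / (exp (2 * x) - 1) - 1 / (exp x - 1) = - fermi x"
proof -
  define y where "y = exp x"
  have "y > 1" using assms by (simp add: y_def)
  have "exp (2 * x) = y * y" by (simp add: y_def exp_double power2_eq_square)
  moreover from \<open>y > 1\<close> have "y * y > 1 * 1" by (intro mult_strict_mono) auto
  ultimately show ?thesis
    unfolding \<open>exp (2 * x) = y * y\<close> fermi_def y_def[symmetric]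
    by (simp add: divide_simps) (use \<open>y > 1\<close> in \<open>simp add: algebra_simps\<close>)
qed

text \<open>With q = exp x and r = exp t, clearing denominators in the second difference leaves the
  numerator q (r - 1)^2 (q r - 1), which is nonnegative on the half-line. This is the convexity
  required of the weights n -> \<open>fermi (t * n)\<close>.\<close>

lemma fermi_convex:
  assumes "x \<ge> 0" "t \<ge> 0"
  shows "fermi (x + t) - fermi (x + 2 * t) \<le> fermi x - fermi (x + t)"
proof -
  define q r where "q = exp x" and "r = exp t"
  have qr: "q \<ge> 1" "r \<ge> 1" "q * r \<ge> 1 * 1" using assms by (auto simp: q_def r_def simp flip: exp_add)
  have pos: "q + 1 > 0" "q * r + 1 > 0" "q * (r * r) + 1 > 0" using qr by (auto intro!: add_pos_pos mult_pos_pos)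
  have "(1 / (q + 1) - 1 / (q * r + 1)) - (1 / (q * r + 1) - 1 / (q * (r * r) + 1)) =
     q * (r - 1)\<^sup>2 * (q * r - 1) / ((q + 1) * (q * r + 1) * (q * (r * r) + 1))"
    using pos by (simp add: divide_simps) (simp add: algebra_simps power2_eq_square)
  also have "\<dots> \<ge> 0" using qr pos by (intro divide_nonneg_pos mult_nonneg_nonneg mult_pos_pos) auto
  finally show ?thesis
    by (simp add: fermi_def exp_add q_def r_def exp_double power2_eq_square)
qed

text \<open>The first weight is \<open>fermi 0\<close>, that is 1/2, for every t, and the error is a
  multiple of 1/2 - \<open>fermi t\<close>, which vanishes at 0. So the limit is half the mean of
  the partial sums of \<open>c\<close>.\<close>

lemma fermi_sum_limit:
  fixes c :: "nat \<Rightarrow> real" and t :: real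
  assumes per: "\<And>n. c (n + p) = c n" and zero: "(\<Sum>n<p. c n) = 0" and p: "p > 0"
  shows "((\<lambda>t::real. \<Sum>n. c n * fermi (t * n)) \<longlongrightarrow> - (\<Sum>n<p. real n * c n) / p / 2) (at_right 0)"
    and "t > 0 \<Longrightarrow> summable (\<lambda>n. c n * fermi (t * n))"
proof -
  define K where "K = (\<Sum>n<p. \<bar>\<Sum>k<n. (\<Sum>j<Suc k. c j) + (\<Sum>n<p. real n * c n) / p\<bar>)"
  have ex: "\<exists>S. (\<lambda>n. c n * fermi (t * n)) sums S \<and>
    \<bar>S + (\<Sum>n<p. real n * c n) / p * fermi (t * real 0)\<bar> \<le> K * (fermi (t * real 0) - fermi (t * real 1))" if "t > 0" for t :: real
    unfolding K_def
  proof (rule abel_sum_periodic_bound[OF per zero p, of "\<lambda>n. fermi (t * real n)"])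
    show "fermi (t * real (Suc n)) \<le> fermi (t * real n)" for n
      using that by (auto simp: fermi_def intro!: divide_left_mono add_pos_pos mult_left_mono mult_pos_pos)
    show "(\<lambda>n. fermi (t * real n)) \<longlonglongrightarrow> 0"
      unfolding fermi_def using that by real_asymp
    show "fermi (t * real (Suc n)) - fermi (t * real (Suc (Suc n)))
         \<le> fermi (t * real n) - fermi (t * real (Suc n))" for n
      using fermi_convex[of "t * n" t] that by (simp add: algebra_simps)
  qed
  thus "t > 0 \<Longrightarrow> summable (\<lambda>n. c n * fermi (t * n))" by (auto simp: sums_iff)
  have "((\<lambda>t. K * (1 / 2 - fermi t)) \<longlongrightarrow> K * (1 / 2 - fermi 0)) (at_right 0)"
    unfolding fermi_def by (intro tendsto_intros) auto
  hence 1: "((\<lambda>t. K * (1 / 2 - fermi t)) \<longlongrightarrow> 0) (at_right 0)" by (simp add: fermi_def)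
  have "((\<lambda>t::real. (\<Sum>n. c n * fermi (t * n)) - (- (\<Sum>n<p. real n * c n) / p / 2)) \<longlongrightarrow> 0) (at_right 0)"
  proof (rule Lim_null_comparison[OF _ 1])
    show "\<forall>\<^sub>F t::real in at_right 0. norm ((\<Sum>n. c n * fermi (t * n)) - (- (\<Sum>n<p. real n * c n) / p / 2)) \<le> K * (1 / 2 - fermi t)"
      using eventually_at_right_less[of 0]
      by eventually_elim (use ex in \<open>fastforce simp: fermi_def sums_iff algebra_simps\<close>)
  qed
  thus "((\<lambda>t::real. \<Sum>n. c n * fermi (t * n)) \<longlongrightarrow> - (\<Sum>n<p. real n * c n) / p / 2) (at_right 0)"
    by (rule LIM_zero_cancel)
qed

section \<open>Lambert series\<close>

lemma has_sum_exp_geometric: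
  assumes "x > (0::real)"
  shows "((\<lambda>m::nat. exp (- x * real m)) has_sum (1 / (exp x - 1))) {1..}"
proof -
  have "((\<lambda>m. exp (- x) ^ m) has_sum (exp (- x) / (1 - exp (- x)))) {1..}"
    using assms by (intro has_sum_geometric_from_1) auto
  also have "(\<lambda>m. exp (- x) ^ m) = (\<lambda>m::nat. exp (- x * real m))"
    by (simp add: exp_of_nat_mult[symmetric] mult.commute)
  also have "exp (- x) / (1 - exp (- x)) = 1 / (exp x - 1)"
    using assms by (simp add: exp_minus field_simps)
  finally show ?thesis .
qed

text \<open>Both series arrange the same double series of terms c(d) exp(-t d m): once by d, once by
  the product n = d m.\<close>

lemma lambert_has_sum:
  fixes c :: "nat \<Rightarrow> real"
  assumes bd: "\<And>n. \<bar>c n\<bar> \<le> 1" and t: "t > 0"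
  shows "\<exists>S. ((\<lambda>d. c d / (exp (t * d) - 1)) has_sum S) {1..} \<and>
             ((\<lambda>n. (\<Sum>d | d dvd n. c d) * exp (- t * real n)) has_sum S) {1..}"
proof -
  let ?f = "\<lambda>(d, m). c d * exp (- t * real d * real m)"
  have "(\<lambda>(d::nat, m::nat). exp (- t * real d * real m)) summable_on ({1..} \<times> {1..})"
  proof (rule summable_on_comparison_test)
    show "(\<lambda>(d::nat, m::nat). exp t * (exp (- t * real d) * exp (- t * real m))) summable_on ({1..} \<times> {1..})"
    proof (rule summable_on_SigmaI)
      show "((\<lambda>y. case (d, y) of (d, m) \<Rightarrow> exp t * (exp (- t * real d) * exp (- t * real m))) has_sum
          exp t * (exp (- t * real d) * (1 / (exp t - 1)))) {1..}" for d :: nat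
        unfolding prod.case by (intro has_sum_cmult_right has_sum_exp_geometric t)
      show "(\<lambda>d. exp t * (exp (- t * real d) * (1 / (exp t - 1)))) summable_on {1..}"
        by (intro summable_on_cmult_right summable_on_cmult_left has_sum_imp_summable[OF has_sum_exp_geometric] t)
    qed auto
  next
    fix x :: "nat \<times> nat" assume "x \<in> {1..} \<times> {1..}"
    then obtain d m where x: "x = (d, m)" "d \<ge> 1" "m \<ge> 1" by auto
    \<comment> \<open>Equivalently d m \<ge> d + m - 1, which dominates the double series by exp(t)
      times a product of two geometric series.\<close>
    have "(real d - 1) * (real m - 1) \<ge> 0" using x by (intro mult_nonneg_nonneg) auto
    hence "t * (real d + real m) \<le> t * (1 + real d * real m)" using t
      by (intro mult_left_mono) (auto simp: algebra_simps)
    thus "(case x of (d, m) \<Rightarrow> exp (- t * real d * real m)) \<le>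
         (case x of (d, m) \<Rightarrow> exp t * (exp (- t * real d) * exp (- t * real m)))"
      by (simp add: x algebra_simps flip: exp_add)
  qed auto
  hence "(\<lambda>x. norm (?f x)) summable_on ({1..} \<times> {1..})"
    by (rule Infinite_Sum.abs_summable_on_comparison_test')
       (use bd in \<open>auto simp: abs_mult intro!: mult_left_le_one_le\<close>)
  hence sm: "?f summable_on ({1..} \<times> {1..})" by (rule abs_summable_summable)
  define S where "S = infsum ?f ({1..} \<times> {1..})"
  have S: "(?f has_sum S) ({1..} \<times> {1..})" unfolding S_def using sm by (rule has_sum_infsum)
  have 1: "((\<lambda>d. c d * (1 / (exp (t * d) - 1))) has_sum S) {1..}"
  proof (rule has_sum_SigmaD[OF S])
    fix d :: nat assume "d \<in> {1..}"
    hence "t * d > 0" using t by auto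
    from has_sum_cmult_right[OF has_sum_exp_geometric[OF this], of "c d"]
    show "((\<lambda>m. ?f (d, m)) has_sum (c d * (1 / (exp (t * d) - 1)))) {1..}" by (simp add: mult_ac)
  qed
  have "((\<lambda>(n, d). c d * exp (- t * real n)) has_sum S) (SIGMA n:{1..}. {d. d dvd n})"
    by (subst has_sum_reindex_bij_witness[of _ "\<lambda>(d, m). (d * m, d)" "\<lambda>(n, d). (d, n div d)" "{1..} \<times> {1..}" ?f _ _ S])
       (use S in \<open>auto elim!: dvdE simp: mult_ac\<close>)
  hence 2: "((\<lambda>n. (\<Sum>d | d dvd n. c d * exp (- t * real n))) has_sum S) {1..}"
    by (rule has_sum_SigmaD) (auto intro!: has_sum_finite)
  show ?thesis using 1 2 by (auto simp: sum_distrib_right)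
qed

text \<open>The two fermi sums, at 2t and at t, enter with weights -2 and -1 and have the same limit
  \<open>L\<close>, so the total is -3 L with L = -(sum of n c n)/(2p).\<close>

lemma lambert_limit:
  fixes c :: "nat \<Rightarrow> real"
  assumes bd: "\<And>n. \<bar>c n\<bar> \<le> 1" and c0: "c 0 = 0"
    and per: "\<And>n. c (n + p) = c n" and zero: "(\<Sum>n<p. c n) = 0" and p: "p > 0"
  defines "F \<equiv> \<lambda>t::real. \<Sum>\<^sub>\<infinity>n\<in>{1..}. (\<Sum>d | d dvd n. c d) * exp (- t * real n)"
  shows "((\<lambda>t. 4 * F (4 * t) - F t) \<longlongrightarrow> 3 / 2 * ((\<Sum>n<p. real n * c n) / p)) (at_right 0)"
proof -
  have F: "((\<lambda>d. c d / (exp (t * d) - 1)) has_sum F t) {1..}" if "t > 0" for t :: real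
    using lambert_has_sum[of c t, OF bd that] by (auto simp: F_def infsumI)
  note sm = fermi_sum_limit(2)[OF per zero p] and lim = fermi_sum_limit(1)[OF per zero p]
  define G where "G t = (\<Sum>n. c n * fermi (t * n))" for t :: real
  have eq: "4 * F (4 * t) - F t = - 2 * G (2 * t) - G t" if t: "t > 0" for t :: real
  proof -
    have "((\<lambda>d. 4 * (c d / (exp (4 * t * d) - 1)) + - (c d / (exp (t * d) - 1))) has_sum 4 * F (4 * t) + - F t) {1..}"
      by (intro has_sum_add has_sum_uminusI has_sum_cmult_right F) (use t in auto)
    also have "?this \<longleftrightarrow> ((\<lambda>d. - 2 * (c d * fermi (2 * t * d)) - c d * fermi (t * d)) has_sum 4 * F (4 * t) + - F t) {1..}"
    proof (rule has_sum_cong)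
      fix d :: nat assume "d \<in> {1..}"
      hence d: "t * d > 0" "2 * (t * d) > 0" using t by auto
      \<comment> \<open>Twice the identity for 2x plus the identity for x, where x = t d: the terms
        2/(e^{2x} - 1) cancel.\<close>
      have e: "4 / (exp (2 * (2 * (t * d))) - 1) - 1 / (exp (t * d) - 1) = - 2 * fermi (2 * (t * d)) - fermi (t * d)"
        using fermi_eq[OF d(1)] fermi_eq[OF d(2)] by argo
      have "4 * (c d / (exp (4 * t * d) - 1)) + - (c d / (exp (t * d) - 1)) =
          c d * (4 / (exp (2 * (2 * (t * d))) - 1) - 1 / (exp (t * d) - 1))"
        by (simp add: algebra_simps)
      also have "\<dots> = - 2 * (c d * fermi (2 * t * d)) - c d * fermi (t * d)"
        unfolding e by (simp add: algebra_simps)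
      finally show "4 * (c d / (exp (4 * t * d) - 1)) + - (c d / (exp (t * d) - 1)) = \<dots>" .
    qed
    \<comment> \<open>The series over all naturals starts at d = 0, a term that vanishes because
      \<open>c 0 = 0\<close>.\<close>
    also have "\<dots> \<longleftrightarrow> ((\<lambda>d. - 2 * (c d * fermi (2 * t * d)) - c d * fermi (t * d)) has_sum 4 * F (4 * t) + - F t) UNIV"
      by (intro has_sum_cong_neutral) (auto simp: c0 not_le)
    finally have "(\<lambda>d. - 2 * (c d * fermi (2 * t * d)) - c d * fermi (t * d)) sums (4 * F (4 * t) + - F t)"
      by (rule has_sum_imp_sums)
    moreover have "(\<lambda>d. - 2 * (c d * fermi (2 * t * d)) - c d * fermi (t * d)) sums (- 2 * G (2 * t) - G t)"
      unfolding G_def by (intro sums_diff sums_mult summable_sums sm) (use t in auto)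
    ultimately show ?thesis using sums_unique2 by fastforce
  qed
  define L where "L = - (\<Sum>n<p. real n * c n) / p / 2"
  have "filterlim (\<lambda>t::real. 2 * t) (at_right 0) (at_right 0)"
    by (auto simp: filterlim_at eventually_at_filter intro!: tendsto_eq_intros)
  from filterlim_compose[OF lim this] have "((\<lambda>t. - 2 * G (2 * t) - G t) \<longlongrightarrow> - 2 * L - L) (at_right 0)"
    unfolding G_def by (intro tendsto_intros) (use lim in \<open>auto simp: L_def\<close>)
  also have "- 2 * L - L = 3 / 2 * ((\<Sum>n<p. real n * c n) / p)" by (simp add: L_def)
  also have "((\<lambda>t. - 2 * G (2 * t) - G t) \<longlongrightarrow> 3 / 2 * ((\<Sum>n<p. real n * c n) / p)) (at_right 0) \<longleftrightarrow> ?thesis"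
    by (rule filterlim_cong[OF refl refl])
       (use eventually_at_right_less[of 0] in \<open>auto elim!: eventually_mono simp: eq\<close>)
  finally show ?thesis .
qed

section \<open>Multiplicative functions\<close>

lemma Legendre_values: "Legendre a m \<in> {-1, 0, 1}"
  by (simp add: Legendre_def)

text \<open>Turns the congruences of Euler's criterion into equations between symbols: two of the
  values -1, 0, 1 differ by at most 2 < m.\<close>

lemma eq_if_cong_small:
  fixes x y m :: int
  assumes "[x = y] (mod m)" "x \<in> {-1, 0, 1}" "y \<in> {-1, 0, 1}" "m > 2"
  shows "x = y"
proof -
  have "m dvd (x - y)" using assms(1) by (simp add: cong_iff_dvd_diff)
  moreover have "\<bar>x - y\<bar> < m" using assms by auto
  ultimately show ?thesis using zdvd_not_zless[of "\<bar>x - y\<bar>" m] by force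
qed

lemma Legendre_mult:
  assumes "prime l" "2 < l"
  shows "Legendre (a * b) (int l) = Legendre a (int l) * Legendre b (int l)"
proof (rule eq_if_cong_small)
  have "[Legendre (a * b) (int l) = (a * b) ^ ((l - 1) div 2)] (mod int l)"
    using assms by (rule euler_criterion)
  also have "(a * b) ^ ((l - 1) div 2) = a ^ ((l - 1) div 2) * b ^ ((l - 1) div 2)"
    by (rule power_mult_distrib)
  also have "[a ^ ((l - 1) div 2) * b ^ ((l - 1) div 2) = Legendre a (int l) * Legendre b (int l)] (mod int l)"
    by (intro cong_mult cong_sym[OF euler_criterion] assms)
  finally show "[Legendre (a * b) (int l) = Legendre a (int l) * Legendre b (int l)] (mod int l)" .
  show "Legendre a (int l) * Legendre b (int l) \<in> {-1, 0, 1}"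
    using Legendre_values[of a l] Legendre_values[of b l] by auto
qed (use assms Legendre_values in auto)

lemma Legendre_minus_one:
  assumes "prime l" "2 < l"
  shows "Legendre (-1) (int l) = (-1) ^ ((l - 1) div 2)"
proof (rule eq_if_cong_small)
  show "[Legendre (-1) (int l) = (-1) ^ ((l - 1) div 2)] (mod int l)" using assms by (rule euler_criterion)
  show "(-1) ^ ((l - 1) div 2) \<in> {-1, 0, 1::int}" by (cases "even ((l - 1) div 2)") auto
qed (use assms Legendre_values in auto)

lemma Legendre_cong:
  assumes "[a = b] (mod m)"
  shows "Legendre a m = Legendre b m"
proof -
  have "[a = 0] (mod m) \<longleftrightarrow> [b = 0] (mod m)" "QuadRes m a \<longleftrightarrow> QuadRes m b"
    unfolding QuadRes_def using assms cong_trans cong_sym by blast+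
  thus ?thesis by (simp add: Legendre_def)
qed

section \<open>Multiplicative functions and their sums over power divisors\<close>

definition multiplicative :: "(nat \<Rightarrow> int) \<Rightarrow> bool" where
  "multiplicative h \<longleftrightarrow> h 1 = 1 \<and> (\<forall>a>0. \<forall>b>0. coprime a b \<longrightarrow> h (a * b) = h a * h b)"

lemma multiplicative_eqI:
  assumes f: "multiplicative f" and g: "multiplicative g"
    and eq: "\<And>l e. prime l \<Longrightarrow> f (l ^ e) = g (l ^ e)" and "n > 0"
  shows "f n = g n"
  using \<open>n > 0\<close>
proof (induction n rule: less_induct)
  case (less n)
  show ?case
  proof (cases "n = 1")
    case True
    thus ?thesis using f g by (simp add: multiplicative_def)
  next
    case False
    then obtain l where l: "prime l" "l dvd n" using prime_factor_nat by blast
    obtain m where m: "n = l ^ multiplicity l n * m" "\<not> l dvd m"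
      using multiplicity_decompose'[of n l] l less.prems by (metis not_gr_zero not_prime_unit)
    let ?e = "multiplicity l n"
    have "?e > 0" using l less.prems by (simp add: prime_multiplicity_gt_zero_iff)
    hence "l ^ ?e > 1" using prime_gt_1_nat[OF l(1)] by (intro one_less_power) auto
    have "m > 0" using m less.prems by (cases m) auto
    have "m < n" using \<open>m > 0\<close> \<open>l ^ ?e > 1\<close> by (subst m(1)) simp
    have "coprime (l ^ ?e) m" using l m by (simp add: prime_imp_coprime)
    hence "f n = f (l ^ ?e) * f m" "g n = g (l ^ ?e) * g m"
      using f g \<open>m > 0\<close> \<open>l ^ ?e > 1\<close> m(1) unfolding multiplicative_def
      by (metis less_trans zero_less_one)+
    thus ?thesis using eq[OF l(1)] less.IH[OF \<open>m < n\<close> \<open>m > 0\<close>] by simp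
  qed
qed

text \<open>Dirichlet convolution of \<open>h\<close> with the indicator of \<open>s\<close>-th
  powers. Exponent 1 gives divisor sums; exponent 2 gives the count of ideals of norm
  \<open>n\<close> sorted by the largest integer \<open>k\<close> dividing them.\<close>

definition power_div_sum :: "nat \<Rightarrow> (nat \<Rightarrow> int) \<Rightarrow> nat \<Rightarrow> int" where
  "power_div_sum s h n = (\<Sum>k | k ^ s dvd n. h (n div k ^ s))"

lemma finite_power_divisors:
  assumes "s > 0" "n > (0::nat)"
  shows "finite {k. k ^ s dvd n}"
proof (rule finite_subset)
  have "k dvd n" if "k ^ s dvd n" for k
    using assms that dvd_trans[OF dvd_power[of s k]] by blast
  thus "{k. k ^ s dvd n} \<subseteq> {k. k dvd n}" by auto
qed (use assms in auto)

lemma gcd_coprime_mult: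
  fixes a b k :: nat
  assumes "coprime a b"
  shows "gcd k (a * b) = gcd k a * gcd k b"
proof (rule dvd_antisym)
  have "gcd k (a * b) dvd gcd (gcd k a * k) (gcd k a * b)"
  proof (rule gcd_greatest)
    have "gcd k (a * b) dvd gcd (k * b) (a * b)" by (meson dvd_mult2 gcd_dvd1 gcd_dvd2 gcd_greatest)
    thus "gcd k (a * b) dvd gcd k a * b" by (simp add: gcd_mult_distrib_nat mult.commute)
  qed simp
  thus "gcd k (a * b) dvd gcd k a * gcd k b" by (simp add: gcd_mult_distrib_nat)
  have "coprime (gcd k a) (gcd k b)" using assms by (rule coprime_divisors[rotated 2]) auto
  thus "gcd k a * gcd k b dvd gcd k (a * b)" by (simp add: divides_mult mult_dvd_mono)
qed

text \<open>For coprime a and b the maps k -> (gcd k a, gcd k b) and (i, j) -> i j are inverse to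
  each other between the two index sets.\<close>

lemma multiplicative_power_div_sum:
  assumes h: "multiplicative h" and s: "s > 0"
  shows "multiplicative (power_div_sum s h)"
  unfolding multiplicative_def
proof (intro conjI allI impI)
  show "power_div_sum s h 1 = 1"
    using h s by (simp add: power_div_sum_def multiplicative_def)
next
  fix a b :: nat assume ab: "a > 0" "b > 0" "coprime a b"
  have cop: "coprime i j" if "i ^ s dvd a" "j ^ s dvd b" for i j
    using coprime_divisors[OF that ab(3)] s by simp
  have cop': "coprime i b" if "i ^ s dvd a" for i
    using coprime_divisors[OF that dvd_refl ab(3)] s by simp
  have cop'': "coprime j a" if "j ^ s dvd b" for j
    using coprime_divisors[OF dvd_refl that ab(3)] s by (simp add: coprime_commute)
  have dvd1: "i dvd a" if "i ^ s dvd a" for i a :: nat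
    using s that dvd_trans[OF dvd_power[of s i]] by blast
  have ga: "gcd (i * j) a = i" "gcd (i * j) b = j" if "i ^ s dvd a" "j ^ s dvd b" for i j
  proof -
    have "gcd (i * j) a = gcd i a" using cop''[OF that(2)] by (simp add: gcd_mult_right_right_cancel gcd_mult_left_right_cancel coprime_commute)
    thus "gcd (i * j) a = i" using dvd1[OF that(1)] by (simp add: gcd_nat.absorb1)
    have "gcd (i * j) b = gcd j b" using cop'[OF that(1)] by (simp add: gcd_mult_left_left_cancel coprime_commute)
    thus "gcd (i * j) b = j" using dvd1[OF that(2)] by (simp add: gcd_nat.absorb1)
  qed
  have "power_div_sum s h a * power_div_sum s h b =
      (\<Sum>(i, j)\<in>{k. k ^ s dvd a} \<times> {k. k ^ s dvd b}. h (a div i ^ s) * h (b div j ^ s))"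
    by (simp add: power_div_sum_def sum_product sum.cartesian_product)
  also have "\<dots> = (\<Sum>k | k ^ s dvd a * b. h (a * b div k ^ s))"
  proof (rule sum.reindex_bij_witness[of _ "\<lambda>k. (gcd k a, gcd k b)" "\<lambda>(i, j). i * j"])
    fix k assume "k \<in> {k. k ^ s dvd a * b}"
    hence k: "k ^ s dvd a * b" by simp
    have "k = gcd k (a * b)" using dvd1[OF k] by (simp add: gcd_nat.absorb1)
    also have "\<dots> = gcd k a * gcd k b" using ab(3) by (rule gcd_coprime_mult)
    finally have eq: "gcd k a * gcd k b = k" by simp
    thus "(case (gcd k a, gcd k b) of (i, j) \<Rightarrow> i * j) = k" by simp
    have "gcd k a ^ s dvd a * b" "gcd k b ^ s dvd a * b"
      by (rule dvd_trans[OF _ k]; simp add: dvd_power_same)+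
    moreover have "coprime (gcd k a ^ s) b" "coprime (gcd k b ^ s) a"
      using coprime_divisors[of "gcd k a" a b b] coprime_divisors[of a a "gcd k b" b] ab(3)
      by (simp_all add: coprime_commute)
    ultimately show "(gcd k a, gcd k b) \<in> {k. k ^ s dvd a} \<times> {k. k ^ s dvd b}"
      by (simp add: coprime_dvd_mult_left_iff coprime_dvd_mult_right_iff)
  next
    fix x assume "x \<in> {k. k ^ s dvd a} \<times> {k. k ^ s dvd b}"
    then obtain i j where x: "x = (i, j)" "i ^ s dvd a" "j ^ s dvd b" by auto
    show "(gcd (case x of (i, j) \<Rightarrow> i * j) a, gcd (case x of (i, j) \<Rightarrow> i * j) b) = x"
      using ga x by simp
    show "(case x of (i, j) \<Rightarrow> i * j) \<in> {k. k ^ s dvd a * b}"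
      using x by (simp add: power_mult_distrib mult_dvd_mono)
    have "a * b div (i * j) ^ s = (a div i ^ s) * (b div j ^ s)"
      using x by (simp add: power_mult_distrib div_mult_div_if_dvd)
    moreover have "coprime (a div i ^ s) (b div j ^ s)"
      using ab(3) x by (intro coprime_divisors[of "a div i ^ s" a "b div j ^ s" b]) (auto elim!: dvdE)
    moreover have "a div i ^ s > 0" "b div j ^ s > 0"
      using ab x by (auto intro!: Nat.gr0I simp: dvd_div_eq_0_iff)
    ultimately show "h (a * b div (case x of (i, j) \<Rightarrow> i * j) ^ s) = (case x of (i, j) \<Rightarrow> h (a div i ^ s) * h (b div j ^ s))"
      using h x by (simp add: multiplicative_def)
  qed
  finally show "power_div_sum s h (a * b) = power_div_sum s h a * power_div_sum s h b"
    by (simp add: power_div_sum_def)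
qed

lemma power_div_sum_prime_power_small:
  assumes l: "prime (l::nat)" and "e < s"
  shows "power_div_sum s h (l ^ e) = h (l ^ e)"
proof -
  have "k = 1" if "k ^ s dvd l ^ e" for k
  proof -
    have "k dvd k ^ s" using assms by (intro dvd_power) auto
    hence "k dvd l ^ e" using that dvd_trans by blast
    then obtain i where i: "k = l ^ i" using divides_primepow_nat[OF l] by blast
    hence "i * s \<le> e" using that l by (simp add: power_mult[symmetric] power_dvd_imp_le[OF _ prime_gt_1_nat])
    hence "i = 0" using assms by (cases i) auto
    thus ?thesis using i by simp
  qed
  hence "{k. k ^ s dvd l ^ e} = {1}" by auto
  thus ?thesis by (simp add: power_div_sum_def)
qed

text \<open>Apart from k = 1 every admissible k is a multiple of l, and removing one factor l lowers
  the exponent by s. This recursion carries the comparison at prime powers.\<close>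

lemma power_div_sum_prime_power:
  assumes l: "prime (l::nat)" and "s > 0"
  shows "power_div_sum s h (l ^ (e + s)) = h (l ^ (e + s)) + power_div_sum s h (l ^ e)"
proof -
  have l0: "l > 0" using l prime_gt_0_nat by blast
  have "{k. k ^ s dvd l ^ (e + s)} = insert 1 ((\<lambda>k. l * k) ` {k. k ^ s dvd l ^ e})"
  proof (intro equalityI subsetI)
    fix k assume "k \<in> {k. k ^ s dvd l ^ (e + s)}"
    hence k: "k ^ s dvd l ^ (e + s)" by simp
    have "k dvd k ^ s" using assms by (intro dvd_power) auto
    hence "k dvd l ^ (e + s)" using k dvd_trans by blast
    then obtain i where i: "k = l ^ i" using divides_primepow_nat[OF l] by blast
    show "k \<in> insert 1 ((\<lambda>k. l * k) ` {k. k ^ s dvd l ^ e})"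
    proof (cases i)
      case (Suc j)
      have "l ^ s * (l ^ j) ^ s dvd l ^ s * l ^ e"
        using k by (simp add: i Suc power_mult_distrib power_add mult_ac)
      hence "(l ^ j) ^ s dvd l ^ e" using l0 by simp
      thus ?thesis using i Suc by auto
    qed (use i in auto)
  qed (auto simp: power_mult_distrib power_add mult.commute intro!: mult_dvd_mono)
  moreover have "1 \<notin> (\<lambda>k. l * k) ` {k. k ^ s dvd l ^ e}" using l by auto
  moreover have "finite {k. k ^ s dvd l ^ e}" using assms l0 by (intro finite_power_divisors) auto
  ultimately have "power_div_sum s h (l ^ (e + s)) =
     h (l ^ (e + s)) + (\<Sum>k\<in>(\<lambda>k. l * k) ` {k. k ^ s dvd l ^ e}. h (l ^ (e + s) div k ^ s))"
    by (simp add: power_div_sum_def)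
  also have "(\<Sum>k\<in>(\<lambda>k. l * k) ` {k. k ^ s dvd l ^ e}. h (l ^ (e + s) div k ^ s)) = power_div_sum s h (l ^ e)"
    unfolding power_div_sum_def using l0
    by (subst sum.reindex) (auto simp: inj_on_def power_mult_distrib power_add mult.commute intro!: sum.cong)
  finally show ?thesis .
qed

section \<open>Roots of the norm polynomial modulo integers\<close>

text \<open>The bound \<open>p > 3\<close> keeps the units of the ring of integers down to 1 and -1.
  The congruence makes (p + 1)/4 an integer, so that (1 + sqrt(-p))/2 is integral, and makes -1 a
  nonresidue.\<close>

locale prime_3_mod_4 =
  fixes p :: nat
  assumes prime_p: "prime p" and p_gt_3: "p > 3" and p_mod_4: "p mod 4 = 3"
begin

definition chi :: "nat \<Rightarrow> int" where "chi n = Legendre (int n) (int p)"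

text \<open>
  \<open>f x\<close> is the norm of $x + \omega$, where $\omega = (1 + \sqrt{-p})/2$.
\<close>

definition q :: int where "q = (int p + 1) div 4"

lemma p_eq: "int p = 4 * q - 1"
  using p_mod_4 unfolding q_def by presburger

lemma q_ge_2: "q \<ge> 2"
  using p_eq p_gt_3 by linarith

definition f :: "int \<Rightarrow> int" where "f x = x\<^sup>2 + x + q"

lemma four_f: "4 * f x = (2 * x + 1)\<^sup>2 + int p"
  by (simp add: f_def p_eq power2_eq_square algebra_simps)

lemma f_diff: "f x - f y = (x - y) * (x + y + 1)"
  by (simp add: f_def power2_eq_square algebra_simps)

lemma f_pos: "f x > 0"
  using four_f[of x] p_gt_3 zero_le_power2[of "2 * x + 1"] by linarith

lemma dvd_f_cong:
  assumes "[x = y] (mod m)"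
  shows "m dvd f x \<longleftrightarrow> m dvd f y"
proof -
  have "m dvd f x - f y"
    using assms by (simp add: f_diff cong_iff_dvd_diff)
  thus ?thesis by (metis dvd_diff_commute dvd_diff_right_iff diff_diff_eq2 dvd_add_right_iff diff_add_cancel)
qed

lemma dvd_f_mod: "m dvd f (x mod m) \<longleftrightarrow> m dvd f x"
  by (rule dvd_f_cong) simp

definition roots :: "nat \<Rightarrow> int set" where
  "roots a = {x. 0 \<le> x \<and> x < int a \<and> int a dvd f x}"

text \<open>Counts the ideals of norm \<open>a\<close> that are not divisible by an integer greater
  than 1: they are the lattices \<open>hnf 1 a b\<close> with \<open>b\<close> a root.\<close>

definition rho :: "nat \<Rightarrow> int" where "rho a = int (card (roots a))"

lemma finite_roots [simp]: "finite (roots a)"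
  by (rule finite_subset[of _ "{0..<int a}"]) (auto simp: roots_def)

lemma multiplicative_rho: "multiplicative rho"
  unfolding multiplicative_def
proof (intro conjI allI impI)
  have "roots 1 = {0}" by (auto simp: roots_def)
  thus "rho 1 = 1" by (simp add: rho_def)
next
  fix a b :: nat assume ab: "a > 0" "b > 0" "coprime a b"
  have cop: "coprime (int a) (int b)" using ab by simp
  have "bij_betw (\<lambda>x. (x mod int a, x mod int b)) (roots (a * b)) (roots a \<times> roots b)"
    unfolding bij_betw_def
  proof (intro conjI equalityI subsetI inj_onI)
    fix x y assume xy: "x \<in> roots (a * b)" "y \<in> roots (a * b)"
      and eq: "(x mod int a, x mod int b) = (y mod int a, y mod int b)"
    have "[x = y] (mod int a * int b)"
      using eq cop by (intro coprime_cong_mult) (auto simp: cong_def)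
    thus "x = y" using xy by (simp add: roots_def cong_def)
  next
    fix z assume "z \<in> (\<lambda>x. (x mod int a, x mod int b)) ` roots (a * b)"
    then obtain x where x: "x \<in> roots (a * b)" "z = (x mod int a, x mod int b)" by auto
    have "int a dvd f x" "int b dvd f x"
      using x(1) by (auto simp: roots_def intro: dvd_mult_left dvd_mult_right)
    thus "z \<in> roots a \<times> roots b" using x ab by (simp add: roots_def dvd_f_mod)
  next
    fix z assume "z \<in> roots a \<times> roots b"
    then obtain u v where z: "z = (u, v)" "u \<in> roots a" "v \<in> roots b" by auto
    obtain x where x: "[x = u] (mod int a)" "[x = v] (mod int b)"
      using binary_chinese_remainder_int[OF cop] by blast
    define y where "y = x mod (int a * int b)"
    have y: "[y = u] (mod int a)" "[y = v] (mod int b)"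
      using x by (auto simp: y_def cong_def mod_mult2_eq mod_mod_cancel)
    have "int a * int b dvd f y"
      using z y dvd_f_cong[OF y(1)] dvd_f_cong[OF y(2)] cop by (auto simp: roots_def intro: divides_mult)
    hence "y \<in> roots (a * b)" using ab by (simp add: roots_def y_def)
    moreover have "z = (y mod int a, y mod int b)"
      using y z by (auto simp: roots_def cong_def)
    ultimately show "z \<in> (\<lambda>x. (x mod int a, x mod int b)) ` roots (a * b)" by blast
  qed
  hence "card (roots (a * b)) = card (roots a \<times> roots b)" by (rule bij_betw_same_card)
  thus "rho (a * b) = rho a * rho b" by (simp add: rho_def card_cartesian_product)
qed

text \<open>
  A root \<open>x\<close> modulo $l$ is simple because \<open>l\<close> divides neither \<open>p\<close> nor, hence, $2x + 1$;
  so it lifts uniquely.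
\<close>

lemma not_dvd_deriv:
  assumes "prime l" "l \<noteq> p" "int l dvd f x"
  shows "\<not> int l dvd 2 * x + 1"
proof
  assume "int l dvd 2 * x + 1"
  moreover have "int l dvd (2 * x + 1)\<^sup>2 + int p"
    using assms(3) by (simp flip: four_f)
  ultimately have "int l dvd int p"
    by (metis dvd_add_right_iff dvd_mult power2_eq_square)
  thus False using assms(1,2) prime_p primes_dvd_imp_eq by auto
qed

text \<open>Reduction is injective on roots because of \<open>f_diff\<close>: if x and y agree
  modulo l, then x + y + 1 is congruent to 2x + 1, a unit. The exponents start at 1, since modulo
  l^0 there is one root whatever \<open>rho l\<close> is.\<close>

lemma rho_hensel:
  assumes l: "prime l" "l \<noteq> p"
  shows "rho (l ^ (e + 2)) = rho (l ^ (e + 1))"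
proof -
  let ?m = "int l ^ (e + 1)" and ?M = "int l ^ (e + 2)"
  have l0: "int l > 0" using l prime_gt_0_nat by simp
  have dM: "?m dvd ?M" by (simp add: le_imp_power_dvd)
  have dl: "int l dvd ?m" by simp
  have Mm: "?M = ?m * int l" by simp
  have "bij_betw (\<lambda>x. x mod ?m) (roots (l ^ (e + 2))) (roots (l ^ (e + 1)))"
    unfolding bij_betw_def
  proof (intro conjI equalityI subsetI inj_onI)
    fix x y assume xy: "x \<in> roots (l ^ (e + 2))" "y \<in> roots (l ^ (e + 2))" and eq: "x mod ?m = y mod ?m"
    have x: "?M dvd f x" "?M dvd f y" using xy by (auto simp: roots_def)
    have d: "?m dvd x - y" using eq by (simp add: mod_eq_dvd_iff)
    have "int l dvd f x" using x(1) dM dl dvd_trans by blast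
    hence nd: "\<not> int l dvd 2 * x + 1" using not_dvd_deriv l by blast
    have "int l dvd x - y" using d dl dvd_trans by blast
    moreover have "x + y + 1 = 2 * x + 1 - (x - y)" by simp
    ultimately have "\<not> int l dvd x + y + 1"
      using nd by (metis dvd_diff_left_iff)
    hence "coprime (x + y + 1) ?M"
      using l by (metis coprime_commute coprime_power_left_iff prime_imp_coprime prime_int_nat_transfer nat_int of_nat_0_le_iff)
    moreover have "?M dvd (x - y) * (x + y + 1)" using x by (simp flip: f_diff)
    ultimately have "?M dvd x - y" by (simp add: coprime_dvd_mult_left_iff coprime_commute)
    hence "x mod ?M = y mod ?M" by (simp add: mod_eq_dvd_iff)
    thus "x = y" using xy by (simp add: roots_def)
  next
    fix z assume "z \<in> (\<lambda>x. x mod ?m) ` roots (l ^ (e + 2))"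
    then obtain x where "z = x mod ?m" "?M dvd f x" by (auto simp: roots_def)
    moreover from this have "?m dvd f x" using dM dvd_trans by blast
    ultimately show "z \<in> roots (l ^ (e + 1))" using l0 by (simp add: roots_def dvd_f_mod)
  next
    fix z assume z: "z \<in> roots (l ^ (e + 1))"
    hence zm: "?m dvd f z" by (simp add: roots_def)
    then obtain k where k: "f z = ?m * k" by blast
    have "int l dvd f z" using zm dl dvd_trans by blast
    hence "\<not> int l dvd 2 * z + 1" using not_dvd_deriv l by blast
    hence "coprime (2 * z + 1) (int l)"
      using l by (metis coprime_commute prime_imp_coprime prime_int_nat_transfer nat_int of_nat_0_le_iff)
    \<comment> \<open>Newton's step: modulo \<open>?M\<close> the value at \<open>z + ?m * s\<close>
      is \<open>?m * (k + (2 * z + 1) * s)\<close>, so \<open>s\<close> has to solve this linear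
      congruence modulo l.\<close>
    then obtain s where s: "[(2 * z + 1) * s = - k] (mod int l)"
      using cong_solve_coprime_int[of "2 * z + 1" "int l"]
      by (metis cong_scalar_right mult.assoc mult_1 )
    define y where "y = (z + ?m * s) mod ?M"
    have "f (z + ?m * s) = f z + ?m * s * (2 * z + 1) + ?m * (?m * s\<^sup>2)"
      by (simp add: f_def power2_eq_square algebra_simps)
    also have "\<dots> = ?m * (k + (2 * z + 1) * s) + ?m * (?m * s\<^sup>2)"
      using k by (simp add: algebra_simps)
    finally have eq: "f (z + ?m * s) = ?m * (k + (2 * z + 1) * s) + ?m * (?m * s\<^sup>2)" .
    have "int l dvd k + (2 * z + 1) * s"
      using s by (simp add: cong_iff_dvd_diff add.commute)
    hence "?M dvd ?m * (k + (2 * z + 1) * s)" unfolding Mm by (rule mult_dvd_mono[OF dvd_refl])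
    moreover have "?M dvd ?m * (?m * s\<^sup>2)" unfolding Mm by (rule mult_dvd_mono[OF dvd_refl]) simp
    ultimately have "?M dvd f (z + ?m * s)" unfolding eq by (rule dvd_add)
    hence "y \<in> roots (l ^ (e + 2))" using l0 unfolding y_def by (simp add: roots_def dvd_f_mod del: power_Suc power_add add_2_eq_Suc')
    moreover have "y mod ?m = z"
      using z dM unfolding y_def by (simp add: mod_mod_cancel roots_def del: power_Suc)
    ultimately show "z \<in> (\<lambda>x. x mod ?m) ` roots (l ^ (e + 2))" by blast
  qed
  thus ?thesis by (simp only: rho_def bij_betw_same_card)
qed

text \<open>The reflection x -> -1 - x preserves \<open>f\<close>, and the two roots it pairs differ
  by 2x + 1, which l does not divide. No square is completed, so l = 2 is covered too.\<close>

lemma rho_prime: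
  assumes l: "prime l" "l \<noteq> p"
  shows "rho l = (if \<exists>x. int l dvd f x then 2 else 0)"
proof (cases "\<exists>x. int l dvd f x")
  case True
  then obtain x where x: "int l dvd f x" by blast
  have l0: "int l > 0" using l prime_gt_0_nat by simp
  have "roots l = {x mod int l, (- 1 - x) mod int l}"
  proof (intro equalityI subsetI)
    fix y assume y: "y \<in> roots l"
    hence "int l dvd f y - f x" using x by (simp add: roots_def)
    hence "int l dvd y - x \<or> int l dvd y + x + 1"
      using l by (simp add: f_diff prime_dvd_mult_iff)
    moreover have "y + x + 1 = y - (- 1 - x)" by simp
    ultimately have "y mod int l = x mod int l \<or> y mod int l = (- 1 - x) mod int l"
      unfolding mod_eq_dvd_iff by metis
    thus "y \<in> {x mod int l, (- 1 - x) mod int l}" using y by (auto simp: roots_def)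
  next
    fix y assume "y \<in> {x mod int l, (- 1 - x) mod int l}"
    moreover have "f (- 1 - x) = f x" by (simp add: f_def power2_eq_square algebra_simps)
    ultimately show "y \<in> roots l" using l0 x by (auto simp: roots_def dvd_f_mod)
  qed
  moreover have "x mod int l \<noteq> (- 1 - x) mod int l"
    using not_dvd_deriv[OF l x] by (simp add: mod_eq_dvd_iff algebra_simps)
  ultimately show ?thesis using True by (simp add: rho_def)
next
  case False
  hence "roots l = {}" by (auto simp: roots_def)
  thus ?thesis using False by (simp add: rho_def)
qed

section \<open>The quadratic character modulo \<open>p\<close>\<close>

lemma p_gt_2: "2 < p" using p_gt_3 by simp

lemma odd_half: "odd ((p - 1) div 2)"
  using p_mod_4 by presburger

lemma chi_mult: "chi (m * n) = chi m * chi n"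
  using Legendre_mult[OF prime_p p_gt_2] by (simp add: chi_def)

lemma chi_values: "chi n \<in> {-1, 0, 1}"
  unfolding chi_def by (rule Legendre_values)

lemma chi_periodic: "chi (n + p) = chi n"
  unfolding chi_def by (rule Legendre_cong) (simp add: cong_def)

lemma chi_eq_0_iff: "chi n = 0 \<longleftrightarrow> p dvd n"
  by (auto simp: chi_def Legendre_def cong_0_iff)

lemma chi_1: "chi 1 = 1"
proof -
  have "chi 1 * chi 1 = chi 1" using chi_mult[of 1 1] by simp
  moreover have "chi 1 \<noteq> 0" using p_gt_3 by (simp add: chi_eq_0_iff)
  ultimately show ?thesis by simp
qed

lemma chi_0: "chi 0 = 0"
  by (simp add: chi_eq_0_iff)

lemma chi_minus: "n \<le> p \<Longrightarrow> chi (p - n) = - chi n"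
proof -
  assume "n \<le> p"
  hence "chi (p - n) = Legendre (-1 * int n) (int p)"
    unfolding chi_def by (intro Legendre_cong) (simp add: of_nat_diff cong_iff_dvd_diff)
  also have "\<dots> = - chi n"
    using Legendre_mult[OF prime_p p_gt_2, of "-1" "int n"] Legendre_minus_one[OF prime_p p_gt_2] odd_half
    by (simp add: chi_def)
  finally show ?thesis .
qed

lemma sum_chi: "(\<Sum>n<p. chi n) = 0"
proof -
  have "(\<Sum>n\<in>{1..<p}. chi n) = (\<Sum>n\<in>{1..<p}. chi (p - n))"
    by (rule sum.reindex_bij_witness[of _ "\<lambda>n. p - n" "\<lambda>n. p - n"]) auto
  also have "\<dots> = - (\<Sum>n\<in>{1..<p}. chi n)"
    by (subst sum_negf[symmetric], rule sum.cong) (auto simp: chi_minus)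
  finally have "(\<Sum>n\<in>{1..<p}. chi n) = 0" by simp
  moreover have "{..<p} = insert 0 {1..<p}" using p_gt_3 by auto
  ultimately show ?thesis by (simp add: chi_0)
qed

text \<open>Gauss's lemma. Here (p - 1)/2 = 2q - 1, and the doubles 2x exceeding it are those with x
  from q to 2q - 1, which are q in number. The parity of q also decides about roots modulo 2, where
  \<open>f\<close> is constantly q.\<close>

lemma chi_2: "chi 2 = (if even q then 1 else -1)"
proof -
  interpret GAUSS p 2
    by unfold_locales (use prime_p p_gt_3 in \<open>auto simp: cong_iff_dvd_diff dest: zdvd_imp_le\<close>)
  have A: "A = {0<..2 * q - 1}" unfolding A_def using p_eq by auto
  have "C = (\<lambda>x. 2 * x) ` A"
    unfolding C_def B_def image_image
    by (intro image_cong refl) (use p_eq in \<open>auto simp: A\<close>)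
  hence "E = (\<lambda>x. 2 * x) ` {q..2 * q - 1}"
    unfolding E_def using q_ge_2 p_eq by (auto simp: A)
  hence "card E = nat q" by (simp add: card_image inj_on_def)
  thus ?thesis using gauss_lemma q_ge_2 by (simp add: chi_def even_nat_iff uminus_power_if)
qed

section \<open>Numbers of roots modulo prime powers and ideals of given norm\<close>

lemma ex_root_iff_QuadRes:
  assumes l: "prime l" "2 < l"
  shows "(\<exists>x. int l dvd f x) \<longleftrightarrow> QuadRes (int l) (- int p)"
proof
  assume "\<exists>x. int l dvd f x"
  then obtain x where "int l dvd f x" by blast
  hence "int l dvd (2 * x + 1)\<^sup>2 + int p" by (simp flip: four_f)
  thus "QuadRes (int l) (- int p)"
    unfolding QuadRes_def by (intro exI[of _ "2 * x + 1"]) (simp add: cong_iff_dvd_diff)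
next
  assume "QuadRes (int l) (- int p)"
  then obtain y where y: "[y\<^sup>2 = - int p] (mod int l)" unfolding QuadRes_def by blast
  have "odd (int l)" using l prime_odd_nat by simp
  \<comment> \<open>Exactly one of y and y + l is odd, and only an odd square root has the form 2x +
    1.\<close>
  define z where "z = (if odd y then y else y + int l)"
  have "odd z" using \<open>odd (int l)\<close> by (simp add: z_def)
  then obtain x where x: "z = 2 * x + 1" by (auto elim: oddE)
  have "[z = y] (mod int l)" by (simp add: z_def cong_def)
  hence "[z\<^sup>2 = - int p] (mod int l)" using y cong_pow cong_trans by blast
  hence "int l dvd 4 * f x" by (simp add: four_f x cong_iff_dvd_diff)
  moreover have "coprime (int l) 4"
    using \<open>odd (int l)\<close> coprime_power_right_iff[of "int l" 2 2] by simp
  ultimately have "int l dvd f x" by (simp add: coprime_dvd_mult_right_iff)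
  thus "\<exists>x. int l dvd f x" by blast
qed

text \<open>As (p - 1)/2 is odd, the sign in quadratic reciprocity is the symbol of -1 modulo l, and
  it cancels the one produced by the minus sign of -p.\<close>

lemma Legendre_minus_p:
  assumes l: "prime l" "2 < l" "l \<noteq> p"
  shows "Legendre (- int p) (int l) = chi l"
proof -
  have "Legendre (- int p) (int l) = Legendre (-1) (int l) * Legendre (int p) (int l)"
    using Legendre_mult[OF l(1,2), of "-1" "int p"] by simp
  moreover have "Legendre (int p) (int l) * chi l = (-1) ^ ((p - 1) div 2 * ((l - 1) div 2))"
    unfolding chi_def using Quadratic_Reciprocity[OF prime_p p_gt_2 l(1,2)] l(3) by simp
  moreover have "(-1) ^ ((p - 1) div 2 * ((l - 1) div 2)) = Legendre (-1) (int l)"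
    using Legendre_minus_one[OF l(1,2)] odd_half by (simp add: power_mult)
  moreover have "chi l \<in> {-1, 1}"
    using chi_values[of l] chi_eq_0_iff[of l] primes_dvd_imp_eq[OF prime_p l(1)] l(3) by auto
  moreover have "Legendre (int p) (int l) \<in> {-1, 0, 1}" by (rule Legendre_values)
  ultimately show ?thesis by auto
qed

lemma rho_prime_eq_chi:
  assumes l: "prime l" "l \<noteq> p"
  shows "rho l = 1 + chi l"
proof (cases "l = 2")
  case True
  have "even (f x) \<longleftrightarrow> even q" for x by (simp add: f_def)
  thus ?thesis using rho_prime[OF l] chi_2 True by simp
next
  case False
  hence l2: "2 < l" using l prime_ge_2_nat[of l] by simp
  have "\<not> int l dvd int p" using primes_dvd_imp_eq[OF l(1) prime_p] l by auto
  hence "Legendre (- int p) (int l) = (if QuadRes (int l) (- int p) then 1 else - 1)"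
    by (simp add: Legendre_def cong_0_iff)
  thus ?thesis using rho_prime[OF l] ex_root_iff_QuadRes[OF l(1) l2] Legendre_minus_p[OF l(1) l2 l(2)] by simp
qed

lemma rho_p: "rho p = 1"
proof -
  have "int p dvd f x \<longleftrightarrow> int p dvd 2 * x + 1" for x
  proof -
    have "coprime (int p) 4"
      using p_mod_4 coprime_power_right_iff[of "int p" 2 2] by simp presburger
    hence "int p dvd f x \<longleftrightarrow> int p dvd 4 * f x" by (simp add: coprime_dvd_mult_right_iff)
    also have "\<dots> \<longleftrightarrow> int p dvd (2 * x + 1)\<^sup>2" by (simp add: four_f)
    also have "\<dots> \<longleftrightarrow> int p dvd 2 * x + 1" using prime_p by (simp add: prime_dvd_power_iff)
    finally show ?thesis .
  qed
  hence "roots p = {2 * q - 1}"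
  proof -
    have "x = 2 * q - 1" if x: "0 \<le> x" "x < int p" "int p dvd 2 * x + 1" for x
    proof -
      obtain k where k: "2 * x + 1 = int p * k" using x(3) by (elim dvdE)
      have "int p * k < int p * 2" "int p * 0 < int p * k" using x k by linarith+
      hence "k = 1" using p_gt_3 by (simp add: mult_less_cancel_left zero_less_mult_iff)
      thus ?thesis using k p_eq by simp
    qed
    moreover have "2 * (2 * q - 1) + 1 = int p" by (simp add: p_eq)
    ultimately show ?thesis
      using q_ge_2 p_eq \<open>\<And>x. int p dvd f x \<longleftrightarrow> int p dvd 2 * x + 1\<close> by (auto simp: roots_def)
  qed
  thus ?thesis by (simp add: rho_def)
qed

text \<open>The double root modulo p does not lift: a root modulo p^2 would make p divide 2x + 1,
  hence p^2 divide (2x + 1)^2 and then p itself.\<close>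

lemma rho_p_power: "rho (p ^ (e + 2)) = 0"
proof -
  have False if "int p ^ (e + 2) dvd f x" for x
  proof -
    have p2: "(int p)\<^sup>2 dvd 4 * f x"
      using that le_imp_power_dvd[of 2 "e + 2" "int p"] dvd_trans dvd_mult by (metis le_add2)
    hence "int p dvd (2 * x + 1)\<^sup>2 + int p" unfolding four_f by (metis dvd_mult_left power2_eq_square)
    hence "int p dvd 2 * x + 1" using prime_p by (simp add: prime_dvd_power_iff)
    hence "(int p)\<^sup>2 dvd (2 * x + 1)\<^sup>2" by (rule dvd_power_same)
    hence "(int p)\<^sup>2 dvd int p" using p2 unfolding four_f by (simp add: dvd_add_right_iff)
    hence "int p * int p \<le> int p * 1" using p_gt_3 by (auto dest!: zdvd_imp_le simp: power2_eq_square)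
    thus False using p_gt_3 by simp
  qed
  hence "roots (p ^ (e + 2)) = {}" by (auto simp: roots_def simp del: power_Suc)
  thus ?thesis by (simp add: rho_def)
qed

text \<open>The right-hand side equals chi(l)^(e+1) + chi(l)^(e+2), the amount by which the divisor
  sum of \<open>chi\<close> grows from l^e to l^(e+2). It is 2, 0 or 0 for l split, inert or
  ramified.\<close>

lemma rho_prime_power:
  assumes l: "prime l"
  shows "rho (l ^ (e + 2)) = (1 + chi l) * chi l ^ (e + 1)"
proof (cases "l = p")
  case True
  thus ?thesis using rho_p_power by (simp add: chi_eq_0_iff)
next
  case False
  have "rho (l ^ (e + 1)) = 1 + chi l" for e
    by (induction e) (use rho_hensel[OF l False] rho_prime_eq_chi[OF l False] in simp_all)
  moreover have "(1 + chi l) * chi l ^ (e + 1) = 1 + chi l"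
    using chi_values[of l] chi_eq_0_iff[of l] primes_dvd_imp_eq[OF prime_p l] False by auto
  ultimately show ?thesis using rho_hensel[OF l False] by simp
qed

lemma chi_power: "chi (l ^ e) = chi l ^ e"
  by (induction e) (simp_all add: chi_mult chi_1[simplified])

text \<open>The factorization of the Dedekind zeta function into the Riemann zeta function and the
  L-function of \<open>chi\<close>, read off coefficientwise. At prime powers the exponent advances
  by two, because removing k = l from an ideal divides its norm by l^2.\<close>

theorem sum_rho_eq_sum_chi:
  assumes "n > 0"
  shows "(\<Sum>k | k\<^sup>2 dvd n. rho (n div k\<^sup>2)) = (\<Sum>d | d dvd n. chi d)"
proof -
  have mchi: "multiplicative chi" by (simp add: multiplicative_def chi_mult chi_1[simplified])
  have "power_div_sum 2 rho n = power_div_sum 1 chi n"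
  proof (rule multiplicative_eqI[OF multiplicative_power_div_sum[OF multiplicative_rho]
        multiplicative_power_div_sum[OF mchi] _ assms])
    fix l e :: nat assume l: "prime l"
    note s = power_div_sum_prime_power_small[OF l] power_div_sum_prime_power[OF l]
    have D: "power_div_sum 1 chi (l ^ (e + 1)) = chi l ^ (e + 1) + power_div_sum 1 chi (l ^ e)" for e
      using s(2)[of 1 chi e] by (simp add: chi_power del: power_Suc)
    have "rho l = 1 + chi l" using rho_p rho_prime_eq_chi[OF l] chi_eq_0_iff[of p] by (cases "l = p") auto
    hence base: "power_div_sum 2 rho (l ^ e) = power_div_sum 1 chi (l ^ e)" if "e < 2" for e
      using that s(1)[of 0 1 chi] s(1)[of 0 2 rho] s(1)[of 1 2 rho] D[of 0] multiplicative_rho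
      by (auto simp: less_2_cases_iff multiplicative_def chi_1[simplified])
    show "power_div_sum 2 rho (l ^ e) = power_div_sum 1 chi (l ^ e)"
    proof (induction e rule: less_induct)
      case (less e)
      show ?case
      proof (cases "e < 2")
        case False
        then obtain k where e: "e = k + 2" by (metis add.commute le_Suc_ex not_less)
        have "power_div_sum 2 rho (l ^ e) = (1 + chi l) * chi l ^ (k + 1) + power_div_sum 1 chi (l ^ k)"
          using s(2)[of 2 rho k] rho_prime_power[OF l, of k] less.IH[of k] by (simp add: e)
        also have "\<dots> = power_div_sum 1 chi (l ^ (k + 1 + 1))"
          unfolding D by (simp add: algebra_simps)
        finally show ?thesis by (simp add: e)
      qed (use base in auto)
    qed
  qed auto
  also have "power_div_sum 1 chi n = (\<Sum>d | d dvd n. chi d)"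
    unfolding power_div_sum_def
    by (rule sum.reindex_bij_witness[of _ "\<lambda>d. n div d" "\<lambda>d. n div d"])
       (use assms in \<open>auto simp: div_dvd_iff_mult elim!: dvdE\<close>)
  finally show ?thesis by (simp add: power_div_sum_def)
qed

end

section \<open>Rings of integers\<close>

lemma int_subgroup_principal:
  fixes J :: "int set"
  assumes add: "\<And>x y. x \<in> J \<Longrightarrow> y \<in> J \<Longrightarrow> x + y \<in> J" and neg: "\<And>x. x \<in> J \<Longrightarrow> - x \<in> J"
    and nz: "\<exists>x\<in>J. x \<noteq> 0"
  obtains n where "n > 0" "J = range (\<lambda>k. n * k)"
proof -
  obtain x where x: "x \<in> J" "x \<noteq> 0" using nz by blast
  have ex: "\<exists>m. m > 0 \<and> int m \<in> J"
    using x neg[OF x(1)] by (intro exI[of _ "nat \<bar>x\<bar>"]) (auto simp: abs_if)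
  define m where "m = (LEAST m. m > 0 \<and> int m \<in> J)"
  have m: "m > 0" "int m \<in> J" using LeastI_ex[OF ex] unfolding m_def by auto
  have min: "m \<le> k" if "k > 0" "int k \<in> J" for k
    unfolding m_def using that by (intro Least_le) auto
  have zero: "0 \<in> J" using add[OF x(1) neg[OF x(1)]] by simp
  have nmult: "int m * int k \<in> J" for k
    by (induction k) (use zero add m in \<open>auto simp: algebra_simps\<close>)
  have mult: "int m * k \<in> J" for k
    using nmult[of "nat k"] neg[OF nmult[of "nat (- k)"]] by (cases "k \<ge> 0") auto
  have "J = range (\<lambda>k. int m * k)"
  proof (intro equalityI subsetI)
    fix y assume y: "y \<in> J"
    have "y mod int m = y + int m * (- (y div int m))" by (simp add: minus_div_mult_eq_mod[symmetric])
    hence "y mod int m \<in> J" using add[OF y mult] by metis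
    moreover have "y mod int m \<ge> 0" "y mod int m < int m" using m by auto
    ultimately have "y mod int m = 0"
      using min[of "nat (y mod int m)"] by (cases "y mod int m = 0") auto
    thus "y \<in> range (\<lambda>k. int m * k)" by (auto elim!: dvdE simp: mod_eq_0_iff_dvd)
  qed (use mult in auto)
  thus ?thesis using that[of "int m"] m by simp
qed

section \<open>Ideals of subrings of the complex numbers\<close>

definition subring_of_complex :: "complex set \<Rightarrow> bool" where
  "subring_of_complex A \<longleftrightarrow> 0 \<in> A \<and> 1 \<in> A \<and>
     (\<forall>x\<in>A. \<forall>y\<in>A. x + y \<in> A \<and> x * y \<in> A) \<and> (\<forall>x\<in>A. - x \<in> A)"

definition ring_on :: "complex set \<Rightarrow> complex ring" where
  "ring_on A = \<lparr>carrier = A, mult = (*), one = 1, zero = 0, add = (+)\<rparr>"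

text \<open>Ideals of \<open>ring_on A\<close> in terms of complex arithmetic, with no reference to
  ring records. Closure under negation is the case r = -1.\<close>

definition ideal_in :: "complex set \<Rightarrow> complex set \<Rightarrow> bool" where
  "ideal_in A I \<longleftrightarrow> I \<subseteq> A \<and> 0 \<in> I \<and> (\<forall>x\<in>I. \<forall>y\<in>I. x + y \<in> I) \<and> (\<forall>r\<in>A. \<forall>x\<in>I. r * x \<in> I)"

lemma cring_ring_on:
  assumes "subring_of_complex A"
  shows "cring (ring_on A)"
proof (rule cringI)
  have "\<exists>y\<in>A. y + x = 0" if "x \<in> A" for x
    using that assms by (intro bexI[of _ "- x"]) (auto simp: subring_of_complex_def)
  thus "abelian_group (ring_on A)"
    using assms by (intro abelian_groupI) (auto simp: ring_on_def subring_of_complex_def add_ac)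
  show "comm_monoid (ring_on A)"
    using assms by (intro comm_monoidI) (auto simp: ring_on_def subring_of_complex_def mult_ac)
qed (auto simp: ring_on_def algebra_simps)

lemma ideal_ring_on_iff:
  assumes "subring_of_complex A"
  shows "ideal I (ring_on A) \<longleftrightarrow> ideal_in A I"
proof
  assume "ideal I (ring_on A)"
  then interpret ideal I "ring_on A" .
  show "ideal_in A I"
    using a_subset additive_subgroup.zero_closed[OF additive_subgroup_axioms]
      additive_subgroup.a_closed[OF additive_subgroup_axioms] I_l_closed
    by (auto simp: ideal_in_def ring_on_def)
next
  assume I: "ideal_in A I"
  interpret cring "ring_on A" by (rule cring_ring_on) fact
  have neg: "- x \<in> I" if "x \<in> I" for x
  proof -
    have "- 1 * x \<in> I" using I assms that unfolding ideal_in_def subring_of_complex_def by blast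
    thus ?thesis by simp
  qed
  show "ideal I (ring_on A)"
  proof (rule idealI)
    show "ring (ring_on A)" by (rule ring_axioms)
    have minus: "\<ominus>\<^bsub>ring_on A\<^esub> x = - x" if "x \<in> I" for x
      using that neg[OF that] I minus_equality[of "- x" x]
      by (auto simp: ring_on_def ideal_in_def)
    show "subgroup I (add_monoid (ring_on A))"
    proof (rule add.subgroupI)
      show "\<ominus>\<^bsub>ring_on A\<^esub> x \<in> I" if "x \<in> I" for x
        using minus[OF that] neg[OF that] by simp
    qed (use I in \<open>auto simp: ideal_in_def ring_on_def\<close>)
    show "x \<otimes>\<^bsub>ring_on A\<^esub> a \<in> I" "a \<otimes>\<^bsub>ring_on A\<^esub> x \<in> I" if "a \<in> I" "x \<in> carrier (ring_on A)" for a x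
    proof -
      have "x * a \<in> I" using that I by (simp add: ideal_in_def ring_on_def)
      thus "x \<otimes>\<^bsub>ring_on A\<^esub> a \<in> I" "a \<otimes>\<^bsub>ring_on A\<^esub> x \<in> I"
        by (simp_all add: ring_on_def Groups.mult.commute[of a x])
    qed
  qed
qed

lemma nonzero_ideals_ring_on:
  assumes "subring_of_complex A"
  shows "nonzero_ideals (ring_on A) = {I. ideal_in A I \<and> I \<noteq> {0}}"
  unfolding nonzero_ideals_def ideal_ring_on_iff[OF assms] by (simp add: ring_on_def)

lemma ideal_class_rel_ring_on:
  "ideal_class_rel (ring_on A) = {(I, J). I \<in> nonzero_ideals (ring_on A) \<and> J \<in> nonzero_ideals (ring_on A) \<and>
     (\<exists>\<alpha>\<in>A - {0}. \<exists>\<beta>\<in>A - {0}. (*) \<alpha> ` I = (*) \<beta> ` J)}"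
proof -
  have "carrier (ring_on A) = A" "mult (ring_on A) = (*)" "\<zero>\<^bsub>ring_on A\<^esub> = 0" by (simp_all add: ring_on_def)
  thus ?thesis unfolding ideal_class_rel_def by simp
qed

lemma subring_of_complex_Ints: "subring_of_complex \<int>"
  by (auto simp: subring_of_complex_def)

text \<open>The denominator in the relative class number. Any two nonzero ideals of the integers,
  generated by n and m, become equal after multiplication by m and n.\<close>

lemma class_number_Rats: "class_number \<rat> = 1"
proof -
  have eq: "ring_of_integers \<rat> = ring_on \<int>"
    using rational_algebraic_int_is_int
    by (auto simp: ring_of_integers_def ring_on_def Ints_subset_Rats[THEN subsetD] int_imp_algebraic_int)
  define N where "N = nonzero_ideals (ring_on \<int>)"
  have N: "\<exists>n::int. n > 0 \<and> I = (\<lambda>x. of_int n * x) ` \<int>" if "I \<in> N" for I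
  proof -
    have I: "ideal_in \<int> I" "I \<noteq> {0}"
      using that unfolding N_def nonzero_ideals_ring_on[OF subring_of_complex_Ints] by auto
    define J where "J = {k::int. of_int k \<in> I}"
    have eq: "I = of_int ` J" using I by (auto simp: J_def ideal_in_def elim!: Ints_cases)
    have neg: "- x \<in> J" if "x \<in> J" for x
    proof -
      have "(- 1 :: complex) \<in> \<int>" by simp
      hence "(- 1) * of_int x \<in> I" using I(1) that unfolding ideal_in_def J_def by blast
      thus ?thesis by (simp add: J_def)
    qed
    have "\<exists>x\<in>J. x \<noteq> 0" using I unfolding eq by (auto simp: ideal_in_def)
    then obtain n where "n > 0" "J = range (\<lambda>k. n * k)"
      using int_subgroup_principal[of J] neg I(1) by (auto simp: J_def ideal_in_def)
    thus ?thesis unfolding eq by (intro exI[of _ n]) (auto simp: image_image Ints_def)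
  qed
  have "(I, J) \<in> ideal_class_rel (ring_on \<int>)" if "I \<in> N" "J \<in> N" for I J
  proof -
    from N[OF that(1)] N[OF that(2)] obtain n m :: int
      where nm: "n > 0" "I = (\<lambda>x. of_int n * x) ` \<int>" "m > 0" "J = (\<lambda>x. of_int m * x) ` \<int>" by blast
    have "(\<lambda>x. of_int m * x) ` I = (\<lambda>x. of_int n * x) ` J"
      unfolding nm image_image by (intro image_cong refl) (simp add: mult_ac)
    moreover have "of_int m \<in> \<int> - {0 :: complex}" "of_int n \<in> \<int> - {0 :: complex}" using nm by auto
    ultimately show ?thesis
      using that unfolding ideal_class_rel_ring_on N_def by blast
  qed
  hence "ideal_class_rel (ring_on \<int>) `` {I} = N" if "I \<in> N" for I
    using that by (auto simp: ideal_class_rel_def N_def)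
  moreover have "\<int> \<noteq> {0::complex}" using Ints_1 by (metis singletonD zero_neq_one)
  hence "\<int> \<in> N"
    unfolding N_def nonzero_ideals_ring_on[OF subring_of_complex_Ints] by (simp add: ideal_in_def)
  ultimately have "N // ideal_class_rel (ring_on \<int>) = {N}"
    unfolding quotient_def by blast
  thus ?thesis by (simp add: class_number_def eq N_def)
qed

text \<open>If y = a/b in lowest terms, then b^n divides c for every n, which is impossible for b
  \<ge> 2 because the powers outgrow c.\<close>

lemma rat_powers_bounded_denominator_imp_int:
  fixes y :: real
  assumes y: "y \<in> \<rat>" and c: "c \<noteq> 0" and int: "\<And>n. of_int c * y ^ n \<in> \<int>"
  shows "y \<in> \<int>"
proof -
  obtain a b where ab: "b > 0" "coprime a b" "y = of_int a / of_int b"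
    using y by (elim Rats_cases') auto
  have "b ^ n dvd c" for n
  proof -
    obtain k where k: "of_int c * y ^ n = of_int k" using int[of n] by (elim Ints_cases)
    have "real_of_int (c * a ^ n) = of_int (k * b ^ n)"
      using k ab by (simp add: power_divide field_simps)
    hence "c * a ^ n = k * b ^ n" by (simp only: of_int_eq_iff)
    hence "b ^ n dvd c * a ^ n" by simp
    moreover have "coprime (b ^ n) (a ^ n)" using ab by (simp add: coprime_commute)
    ultimately show ?thesis by (simp add: coprime_dvd_mult_left_iff)
  qed
  hence le: "b ^ n \<le> \<bar>c\<bar>" for n using c by (metis dvd_imp_le_int abs_of_pos ab(1) zero_less_power)
  have "b = 1"
  proof (rule ccontr)
    assume "b \<noteq> 1"
    hence "2 \<le> b" using ab by simp
    hence "2 ^ nat \<bar>c\<bar> \<le> b ^ nat \<bar>c\<bar>" by (intro power_mono) auto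
    also have "\<dots> \<le> \<bar>c\<bar>" by (rule le)
    finally have "2 ^ nat \<bar>c\<bar> \<le> \<bar>c\<bar>" .
    moreover have "int (nat \<bar>c\<bar>) < 2 ^ nat \<bar>c\<bar>"
      using of_nat_less_two_power[of "nat \<bar>c\<bar>", where ?'a = int] by simp
    ultimately show False by simp
  qed
  thus ?thesis using ab by simp
qed

lemma complex_of_rat: "complex_of_rat a = of_real (of_rat a)"
  by (cases a) (simp add: of_rat_rat)

section \<open>The ring of integers of the imaginary quadratic field\<close>

context prime_3_mod_4
begin

definition rtp :: complex where "rtp = \<i> * of_real (sqrt (real p))"

definition w :: complex where "w = (1 + rtp) / 2"

definition el :: "int \<Rightarrow> int \<Rightarrow> complex" where "el m n = of_int m + of_int n * w"

definition Oint :: "complex set" where "Oint = {el m n | m n. True}"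

lemma sqrt_p_pos: "sqrt (real p) > 0" using p_gt_3 by simp

lemma rtp_square: "rtp * rtp = - of_nat p"
proof -
  have "complex_of_real (sqrt (real p)) * of_real (sqrt (real p)) = of_nat p"
    by (simp flip: of_real_mult)
  thus ?thesis by (simp add: rtp_def algebra_simps flip: mult.assoc)
qed

lemma csqrt_minus_p: "csqrt (of_int (- int p)) = rtp"
proof -
  have "csqrt (of_int (- int p)) = csqrt (- of_real (real p))" by simp
  also have "\<dots> = \<i> * csqrt (of_real (real p))"
    by (rule csqrt_minus) (use p_gt_3 in auto)
  finally show ?thesis by (simp add: rtp_def)
qed

lemma rtp_parts [simp]: "Re rtp = 0" "Im rtp = sqrt p" by (simp_all add: rtp_def)

lemma w_parts [simp]: "Re w = 1 / 2" "Im w = sqrt p / 2" by (simp_all add: w_def)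

lemma Re_el [simp]: "Re (el m n) = of_int m + of_int n / 2"
  and Im_el [simp]: "Im (el m n) = of_int n * sqrt p / 2"
  by (simp_all add: el_def)

lemma el_eq_iff [simp]: "el m n = el m' n' \<longleftrightarrow> m = m' \<and> n = n'"
  using sqrt_p_pos by (auto simp: complex_eq_iff)

lemma el_add: "el m n + el m' n' = el (m + m') (n + n')"
  by (simp add: el_def algebra_simps)

lemma el_minus: "- el m n = el (- m) (- n)"
  by (simp add: el_def)

lemma w_square: "w * w = w - of_int q"
proof -
  have "of_int (int p) = (of_int (4 * q - 1) :: complex)" using p_eq by simp
  hence "of_nat p = (4 * of_int q - 1 :: complex)" by simp
  moreover have "(2 * w - 1) * (2 * w - 1) = - of_nat p" using rtp_square by (simp add: w_def diff_divide_distrib add_divide_distrib)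
  ultimately have "(2 * w - 1) * (2 * w - 1) = - (4 * of_int q - 1)" by simp
  moreover have "(2 * w - 1) * (2 * w - 1) = 4 * (w * w) - 4 * w + 1" by (simp add: algebra_simps)
  ultimately have "4 * (w * w) - 4 * w + 1 = - (4 * of_int q - 1)" by simp
  hence "4 * (w * w) = 4 * (w - of_int q)" by (simp add: algebra_simps)
  thus ?thesis by (metis mult_cancel_left zero_neq_numeral)
qed

lemma el_mult: "el m n * el m' n' = el (m * m' - q * n * n') (m * n' + n * m' + n * n')"
proof -
  have "el m n * el m' n' = of_int (m * m') + of_int (m * n' + n * m') * w + of_int (n * n') * (w * w)"
    by (simp add: el_def algebra_simps)
  thus ?thesis unfolding w_square by (simp add: el_def algebra_simps)
qed

lemma el_of_int: "el m 0 = of_int m" by (simp add: el_def)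

lemma el_in_Oint [simp]: "el m n \<in> Oint" by (auto simp: Oint_def)

lemma of_int_in_Oint [simp]: "of_int m \<in> Oint" using el_in_Oint[of m 0] by (simp only: el_of_int)

lemma subring_Oint: "subring_of_complex Oint"
proof -
  have "0 \<in> Oint" "1 \<in> Oint" using of_int_in_Oint[of 0] of_int_in_Oint[of 1] by simp_all
  thus ?thesis
    by (auto simp: subring_of_complex_def Oint_def el_add el_mult el_minus)
qed

lemma norm_el: "(cmod (el m n))\<^sup>2 = of_int (m\<^sup>2 + m * n + n\<^sup>2 * q)"
proof -
  have "real p = real_of_int (int p)" by simp
  hence p: "real p = 4 * of_int q - 1" unfolding p_eq by simp
  have "(cmod (el m n))\<^sup>2 = (of_int m + of_int n / 2)\<^sup>2 + (of_int n)\<^sup>2 * (sqrt (real p))\<^sup>2 / 4"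
    unfolding cmod_power2 by (simp add: power_mult_distrib power_divide)
  also have "(sqrt (real p))\<^sup>2 = 4 * of_int q - 1" using p by simp
  finally show ?thesis by (simp add: power2_eq_square algebra_simps add_divide_distrib diff_divide_distrib)
qed

lemma quadratic_field_eq: "quadratic_field (- int p) = {of_rat x + of_rat y * rtp | x y. True}"
  unfolding quadratic_field_def csqrt_minus_p ..

lemma quadratic_field_Reals: "quadratic_field (- int p) \<inter> \<real> = \<rat>"
proof (intro equalityI subsetI)
  fix z assume "z \<in> quadratic_field (- int p) \<inter> \<real>"
  then obtain x y where z: "z = of_rat x + of_rat y * rtp" "z \<in> \<real>" unfolding quadratic_field_eq by auto
  note r = complex_of_rat
  have "Im z = of_rat y * sqrt p" unfolding z(1) r by simp
  hence "(of_rat y :: real) = 0" using z(2) sqrt_p_pos by (auto simp: complex_is_Real_iff)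
  thus "z \<in> \<rat>" using z(1) by simp
next
  fix z :: complex assume "z \<in> \<rat>"
  then obtain x where x: "z = of_rat x" by (elim Rats_cases)
  have "z = of_rat x + of_rat 0 * rtp" by (simp add: x)
  hence "z \<in> quadratic_field (- int p)" unfolding quadratic_field_eq by blast
  moreover have "z = of_real (of_rat x)" unfolding x by (rule complex_of_rat)
  ultimately show "z \<in> quadratic_field (- int p) \<inter> \<real>" by (metis IntI Reals_of_real)
qed

lemma algebraic_int_el: "algebraic_int (el m n)"
proof -
  let ?P = "[:of_int (m\<^sup>2 + m * n + n\<^sup>2 * q), - of_int (2 * m + n), 1 :: complex:]"
  have "poly ?P (el m n) = 0"
  proof -
    have "poly ?P (el m n) = el m n * el m n - of_int (2 * m + n) * el m n + of_int (m\<^sup>2 + m * n + n\<^sup>2 * q)"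
      by (simp add: algebra_simps)
    also have "\<dots> = 0"
      unfolding el_of_int[symmetric] minus_mult_left diff_conv_add_uminus el_minus el_mult el_add
      by (simp add: power2_eq_square algebra_simps el_of_int)
    finally show ?thesis .
  qed
  moreover have "\<forall>i. poly.coeff ?P i \<in> \<int>" by (auto simp: coeff_pCons split: nat.splits)
  ultimately show ?thesis by (intro algebraic_int.intros[of ?P]) auto
qed

text \<open>
  This replaces the closure of the algebraic integers under ring operations: the powers of an
  algebraic integer have a common denominator, hence so do the powers of its norm, which is
  therefore an integer; the same applied to \<open>x + 1\<close> gives the trace.
\<close>

lemma bounded_denominator:
  assumes x: "x = of_rat r + of_rat s * rtp" and alg: "algebraic_int x"
  shows "\<exists>c::int. c > 0 \<and> (\<forall>n. \<exists>a b. of_int c * x ^ n = of_int a + of_int b * rtp)"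
proof -
  define R where "R = {of_int a + of_int b * rtp | a b. True}"
  have Radd: "u + v \<in> R" if uv: "u \<in> R" "v \<in> R" for u v
  proof -
    obtain a b a' b' where "u = of_int a + of_int b * rtp" "v = of_int a' + of_int b' * rtp"
      using uv by (auto simp: R_def)
    hence "u + v = of_int (a + a') + of_int (b + b') * rtp" by (simp add: algebra_simps)
    thus ?thesis unfolding R_def by blast
  qed
  have Rmult: "u * v \<in> R" if uvR: "u \<in> R" "v \<in> R" for u v
  proof -
    obtain a b a' b' where uv: "u = of_int a + of_int b * rtp" "v = of_int a' + of_int b' * rtp"
      using uvR by (auto simp: R_def)
    have "u * v = of_int (a * a') + of_int (a * b' + b * a') * rtp + of_int (b * b') * (rtp * rtp)"
      by (simp add: uv algebra_simps)
    also have "\<dots> = of_int (a * a' - b * b' * int p) + of_int (a * b' + b * a') * rtp"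
      unfolding rtp_square by (simp add: algebra_simps)
    finally show ?thesis unfolding R_def by blast
  qed
  have Rint: "of_int k \<in> R" for k
  proof -
    have "of_int k = of_int k + of_int 0 * rtp" by simp
    thus ?thesis unfolding R_def by blast
  qed
  have Rpow: "u ^ n \<in> R" if "u \<in> R" for u n
    by (induction n) (use that Rmult Rint[of 1] in auto)
  have Rsum: "(\<Sum>i\<in>A. g i) \<in> R" if "\<And>i. i \<in> A \<Longrightarrow> g i \<in> R" for A :: "nat set" and g
    using that by (induction A rule: infinite_finite_induct) (use Rint[of 0] Radd in auto)
  obtain P where P: "lead_coeff P = 1" "\<forall>i. poly.coeff P i \<in> \<int>" "poly P x = 0"
    using alg by (auto elim: algebraic_int.cases)
  define d where "d = degree P"
  obtain r1 r2 where r: "r = of_int r1 / of_int r2" "r2 > 0" using quotient_of_div quotient_of_denom_pos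
    by (metis surj_pair)
  obtain s1 s2 where s: "s = of_int s1 / of_int s2" "s2 > 0" using quotient_of_div quotient_of_denom_pos
    by (metis surj_pair)
  define E where "E = r2 * s2"
  have E: "E > 0" using r s by (simp add: E_def)
  have "of_int E * x = of_int (r1 * s2) + of_int (s1 * r2) * rtp"
  proof -
    have rs: "of_int r2 * of_rat r = (of_int r1 :: complex)" "of_int s2 * of_rat s = (of_int s1 :: complex)"
      using r s by (simp_all add: of_rat_divide)
    have "of_int E * x = of_int s2 * (of_int r2 * of_rat r) + of_int r2 * (of_int s2 * of_rat s) * rtp"
      by (simp add: x E_def algebra_simps)
    thus ?thesis unfolding rs by (simp add: mult.commute)
  qed
  hence Ex: "of_int E * x \<in> R" unfolding R_def by blast
  \<comment> \<open>Below the degree d the factor E^d clears the denominators of r and s directly;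
    higher powers are reduced by the monic polynomial, whose integral coefficients bring in no new
    denominators.\<close>
  have "of_int (E ^ d) * x ^ n \<in> R" for n
  proof (induction n rule: less_induct)
    case (less n)
    show ?case
    proof (cases "n < d")
      case True
      hence "of_int (E ^ d) * x ^ n = of_int (E ^ (d - n)) * (of_int E * x) ^ n"
        by (simp add: power_mult_distrib flip: power_add mult.assoc)
      thus ?thesis using Rmult Rint Rpow Ex by metis
    next
      case False
      have "0 = x ^ (n - d) * poly P x" by (simp add: P)
      also have "\<dots> = x ^ (n - d) * ((\<Sum>i<d. poly.coeff P i * x ^ i) + x ^ d)"
        unfolding poly_altdef using P(1) by (simp add: d_def lessThan_Suc_atMost[symmetric])
      also have "\<dots> = (\<Sum>i<d. poly.coeff P i * x ^ (n - d + i)) + x ^ n"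
        using False by (simp add: algebra_simps sum_distrib_left power_add[symmetric])
      finally have "x ^ n = - (\<Sum>i<d. poly.coeff P i * x ^ (n - d + i))" by (simp add: eq_neg_iff_add_eq_0 add.commute)
      hence "of_int (E ^ d) * x ^ n = of_int (- 1) * (\<Sum>i<d. poly.coeff P i * (of_int (E ^ d) * x ^ (n - d + i)))"
        by (simp add: sum_distrib_left sum_negf mult_ac)
      also have "\<dots> \<in> R"
      proof (rule Rmult[OF Rint Rsum])
        fix i assume "i \<in> {..<d}"
        hence "of_int (E ^ d) * x ^ (n - d + i) \<in> R" using False by (intro less.IH) auto
        moreover have "poly.coeff P i \<in> R" using P(2) Rint by (metis Ints_cases)
        ultimately show "poly.coeff P i * (of_int (E ^ d) * x ^ (n - d + i)) \<in> R" using Rmult by blast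
      qed
      finally show ?thesis .
    qed
  qed
  thus ?thesis using E unfolding R_def by (intro exI[of _ "E ^ d"]) auto
qed

lemma norm_in_Ints:
  assumes x: "x = of_rat r + of_rat s * rtp"
    and c: "c > 0" "\<And>n. \<exists>a b. of_int c * x ^ n = of_int a + of_int b * rtp"
  shows "(cmod x)\<^sup>2 \<in> \<int>"
proof (rule rat_powers_bounded_denominator_imp_int)
  note R = complex_of_rat
  have "(cmod x)\<^sup>2 = of_rat (r\<^sup>2 + of_nat p * s\<^sup>2)"
    unfolding x R cmod_power2 using p_gt_3 by (simp add: of_rat_add of_rat_mult of_rat_power power_mult_distrib mult.commute)
  thus "(cmod x)\<^sup>2 \<in> \<rat>" by simp
  show "c\<^sup>2 \<noteq> 0" using c by simp
  fix n
  obtain a b where ab: "of_int c * x ^ n = of_int a + of_int b * rtp" using c(2) by blast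
  have "of_int (c\<^sup>2) * ((cmod x)\<^sup>2) ^ n = (cmod (of_int c * x ^ n))\<^sup>2"
    by (simp add: norm_mult norm_power power_mult_distrib flip: power_mult) (simp add: mult.commute)
  also have "\<dots> = of_int (a\<^sup>2 + int p * b\<^sup>2)"
    unfolding ab cmod_power2 by (simp add: power_mult_distrib mult.commute)
  finally show "of_int (c\<^sup>2) * ((cmod x)\<^sup>2) ^ n \<in> \<int>" by simp
qed

lemma algebraic_int_imp_Oint:
  assumes "x \<in> quadratic_field (- int p)" "algebraic_int x"
  shows "x \<in> Oint"
proof -
  obtain r s where x: "x = of_rat r + of_rat s * rtp" using assms(1) unfolding quadratic_field_eq by auto
  note R = complex_of_rat
  obtain c where c: "c > 0" "\<And>n. \<exists>a b. of_int c * x ^ n = of_int a + of_int b * rtp"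
    using bounded_denominator[OF x assms(2)] by blast
  have c1: "\<exists>a b. of_int c * (x + 1) ^ n = of_int a + of_int b * rtp" for n
  proof -
    obtain a b where ab: "\<And>n. of_int c * x ^ n = of_int (a n) + of_int (b n) * rtp" using c(2) by metis
    have "of_int c * (x + 1) ^ n = (\<Sum>k\<le>n. of_nat (n choose k) * (of_int c * x ^ k))"
      by (simp add: binomial_ring sum_distrib_left mult_ac)
    also have "\<dots> = of_int (\<Sum>k\<le>n. of_nat (n choose k) * a k) + of_int (\<Sum>k\<le>n. of_nat (n choose k) * b k) * rtp"
      unfolding ab by (simp add: algebra_simps sum.distrib sum_distrib_right sum_distrib_left)
    finally show ?thesis by blast
  qed
  have x1: "x + 1 = of_rat (r + 1) + of_rat s * rtp" by (simp add: x of_rat_add)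
  obtain N where N: "(cmod x)\<^sup>2 = of_int N" using norm_in_Ints[OF x c] by (elim Ints_cases)
  obtain N' where N': "(cmod (x + 1))\<^sup>2 = of_int N'" using norm_in_Ints[OF x1 c(1) c1] by (elim Ints_cases)
  have Re: "Re x = of_rat r" "Im x = of_rat s * sqrt p" unfolding x R by simp_all
  \<comment> \<open>The trace: |x + 1|^2 = |x|^2 + 2 Re x + 1.\<close>
  define T where "T = N' - N - 1"
  have T: "of_int T = 2 * Re x"
    unfolding T_def of_int_diff N[symmetric] N'[symmetric] cmod_power2
    by (simp add: power2_eq_square algebra_simps)
  define y :: real where "y = 2 * of_rat s"
  have y: "real p * y\<^sup>2 = of_int (4 * N - T\<^sup>2)"
  proof -
    have "real_of_int (T\<^sup>2) = (2 * Re x)\<^sup>2" by (simp flip: T)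
    hence "real_of_int (4 * N - T\<^sup>2) = 4 * (cmod x)\<^sup>2 - (2 * Re x)\<^sup>2" by (simp add: N)
    thus ?thesis unfolding cmod_power2 Re y_def by (simp add: power_mult_distrib)
  qed
  \<comment> \<open>A priori p could still occur in the denominator of y. The rational number p y
    has an integral square, so it is an integer k; its square is divisible by p, so k is too, and y
    is an integer.\<close>
  have "(real p * y)\<^sup>2 = of_int (int p * (4 * N - T\<^sup>2))"
    using y by (simp add: power_mult_distrib power2_eq_square mult_ac)
  hence "algebraic_int ((real p * y)\<^sup>2)" by (simp only: algebraic_int_of_int)
  hence "algebraic_int (real p * y)"
    by (intro algebraic_int_root[where p = "Polynomial.monom 1 2" and x = "real p * y"]) (auto simp: poly_monom degree_monom_eq)
  moreover have "real p * y \<in> \<rat>" by (simp add: y_def)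
  ultimately obtain k where k: "real p * y = of_int k"
    using rational_algebraic_int_is_int by (metis Ints_cases)
  have "real_of_int (k\<^sup>2) = of_int (int p * (4 * N - T\<^sup>2))"
    using k y by (simp add: power2_eq_square) (metis (no_types, lifting) k mult.assoc mult.left_commute)
  hence "k\<^sup>2 = int p * (4 * N - T\<^sup>2)" by (simp only: of_int_eq_iff)
  hence "int p dvd k" using prime_p by (metis dvd_triv_left prime_dvd_power prime_nat_int_transfer)
  then obtain U where U: "k = int p * U" by blast
  have yU: "y = of_int U" using k U p_gt_3 by simp
  have "real_of_int (int p * U\<^sup>2) = of_int (4 * N - T\<^sup>2)" using y yU by simp
  hence "int p * U\<^sup>2 = 4 * N - T\<^sup>2" by (simp only: of_int_eq_iff)
  \<comment> \<open>Inserting p = 4q - 1 shows that T and U have the same parity, which is what puts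
    (T + U sqrt(-p))/2 into \<open>Oint\<close>.\<close>
  hence "4 * (N - q * U\<^sup>2) = (T - U) * (T + U)" by (simp add: p_eq algebra_simps power2_eq_square)
  hence "even ((T - U) * (T + U))" by (metis dvd_triv_left dvd_trans even_numeral)
  hence "even (T - U)" by simp
  then obtain m where m: "T - U = 2 * m" by blast
  have "x = el m U"
    using T m yU Re by (intro complex_eqI) (auto simp: y_def field_simps)
  thus ?thesis by simp
qed

lemma ring_of_integers_eq: "ring_of_integers (quadratic_field (- int p)) = ring_on Oint"
proof -
  have "el m n \<in> quadratic_field (- int p)" for m n
  proof -
    have "el m n = of_rat (of_int m + of_int n / 2) + of_rat (of_int n / 2) * rtp"
      by (simp add: el_def w_def of_rat_add of_rat_divide algebra_simps add_divide_distrib)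
    thus ?thesis unfolding quadratic_field_eq by blast
  qed
  hence "{x \<in> quadratic_field (- int p). algebraic_int x} = Oint"
    using algebraic_int_imp_Oint algebraic_int_el by (auto simp: Oint_def)
  thus ?thesis by (simp add: ring_of_integers_def ring_on_def)
qed

end

section \<open>Ideals as lattices\<close>

definition lat :: "complex \<Rightarrow> complex \<Rightarrow> complex set" where
  "lat u v = {of_int x * u + of_int y * v | x y. True}"

lemma in_lat: "of_int x * u + of_int y * v \<in> lat u v"
  by (auto simp: lat_def)

lemma generators_in_lat: "u \<in> lat u v" "v \<in> lat u v"
  using in_lat[of 1 u 0 v] in_lat[of 0 u 1 v] by simp_all

lemma image_mult_lat: "(*) g ` lat u v = lat (g * u) (g * v)"
proof -
  have "g * (of_int x * u + of_int y * v) = of_int x * (g * u) + of_int y * (g * v)" for x y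
    by (simp add: algebra_simps)
  thus ?thesis unfolding lat_def by (auto simp: image_def) metis
qed

lemma lat_rotate: "lat u v = lat v (- u)"
proof -
  have "of_int x * u + of_int y * v = of_int y * v + of_int (- x) * (- u)"
    "of_int x * v + of_int y * (- u) = of_int (- y) * u + of_int x * v" for x y
    by simp_all
  thus ?thesis unfolding lat_def by blast
qed

lemma lat_subset_covolume:
  assumes "lat u' v' \<subseteq> lat u v"
  shows "\<exists>d::int. Im (cnj u' * v') = of_int d * Im (cnj u * v)"
proof -
  obtain x y where u': "u' = of_int x * u + of_int y * v"
    using subsetD[OF assms generators_in_lat(1)] unfolding lat_def by blast
  obtain z t where v': "v' = of_int z * u + of_int t * v"
    using subsetD[OF assms generators_in_lat(2)] unfolding lat_def by blast
  have "Im (cnj u' * v') = of_int (x * t - y * z) * Im (cnj u * v)"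
    by (simp add: u' v' algebra_simps)
  thus ?thesis by blast
qed

text \<open>The two inclusions express each covolume as an integral multiple of the other, the
  factors being determinants of base changes. If the covolume is nonzero, the two determinants have
  product 1.\<close>

lemma lat_eq_covolume:
  assumes "lat u' v' = lat u v"
  shows "\<bar>Im (cnj u' * v')\<bar> = \<bar>Im (cnj u * v)\<bar>"
proof -
  let ?c = "Im (cnj u * v)" and ?c' = "Im (cnj u' * v')"
  obtain d d' :: int where d: "?c' = of_int d * ?c" "?c = of_int d' * ?c'"
    using lat_subset_covolume[OF equalityD1[OF assms]] lat_subset_covolume[OF equalityD2[OF assms]] by blast
  show ?thesis
  proof (cases "?c = 0")
    case False
    have "of_int (d' * d) * ?c = ?c" using d by (metis mult.assoc of_int_mult)
    hence "real_of_int (d' * d) = of_int 1" using False by simp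
    hence "d' * d = 1" by (simp only: of_int_eq_iff)
    hence "\<bar>d\<bar> = 1" by (metis abs_zmult_eq_1 mult.commute abs_one)
    hence "\<bar>real_of_int d\<bar> = 1" by linarith
    thus ?thesis using d(1) by (simp only: abs_mult)
  qed (use d in simp)
qed

text \<open>A function of the set, through an arbitrary choice of basis;
  \<open>lat_eq_covolume\<close> makes the choice harmless. It therefore applies directly to images
  of an ideal under multiplication.\<close>

definition covol :: "complex set \<Rightarrow> real" where
  "covol L = (SOME c. \<exists>u v. L = lat u v \<and> c = \<bar>Im (cnj u * v)\<bar>)"

lemma covol_lat: "covol (lat u v) = \<bar>Im (cnj u * v)\<bar>"
proof -
  have "\<exists>u' v'. lat u v = lat u' v' \<and> covol (lat u v) = \<bar>Im (cnj u' * v')\<bar>"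
    unfolding covol_def by (rule someI[of _ "\<bar>Im (cnj u * v)\<bar>"]) blast
  thus ?thesis using lat_eq_covolume by metis
qed

lemma covol_mult: "covol ((*) g ` lat u v) = (cmod g)\<^sup>2 * covol (lat u v)"
proof -
  have "cnj (g * u) * (g * v) = of_real ((cmod g)\<^sup>2) * (cnj u * v)"
    unfolding complex_norm_square by (simp add: mult_ac)
  moreover have "Im (of_real c * z) = c * Im z" for c z by simp
  ultimately have "Im (cnj (g * u) * (g * v)) = (cmod g)\<^sup>2 * Im (cnj u * v)" by (simp only:)
  thus ?thesis unfolding image_mult_lat covol_lat by (simp add: abs_mult)
qed

context prime_3_mod_4
begin

text \<open>
  The lattice $k (\mathbb{Z} a + \mathbb{Z} (b + \omega))$, an ideal of norm $k^2 a$ if \<open>a\<close> divides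
  \<open>f b\<close>.
\<close>

definition hnf :: "int \<Rightarrow> int \<Rightarrow> int \<Rightarrow> complex set" where
  "hnf k a b = {el m n | m n. k dvd n \<and> k * a dvd m - b * n}"

lemma el_in_hnf [simp]: "el m n \<in> hnf k a b \<longleftrightarrow> k dvd n \<and> k * a dvd m - b * n"
  by (auto simp: hnf_def)

lemma hnf_eq_lat: "hnf k a b = lat (el (k * a) 0) (el (k * b) k)"
proof -
  have eq: "of_int x * el (k * a) 0 + of_int y * el (k * b) k = el (x * (k * a) + y * (k * b)) (y * k)" for x y
    by (simp add: el_def algebra_simps)
  have "el m n \<in> lat (el (k * a) 0) (el (k * b) k)" if mn: "k dvd n" "k * a dvd m - b * n" for m n
  proof -
    obtain y where y: "n = k * y" using mn(1) by (elim dvdE)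
    obtain x where x: "m - b * n = k * a * x" using mn(2) by (elim dvdE)
    have "el m n = of_int x * el (k * a) 0 + of_int y * el (k * b) k"
      unfolding eq using x y by (simp add: algebra_simps)
    thus ?thesis using in_lat by metis
  qed
  moreover have "of_int x * el (k * a) 0 + of_int y * el (k * b) k \<in> hnf k a b" for x y
    unfolding eq by (simp add: algebra_simps)
  ultimately show ?thesis by (auto simp: hnf_def lat_def)
qed

lemma ideal_hnf:
  assumes "a dvd f b"
  shows "ideal_in Oint (hnf k a b)"
  unfolding ideal_in_def
proof (intro conjI ballI)
  show "hnf k a b \<subseteq> Oint" by (auto simp: hnf_def)
  show "0 \<in> hnf k a b" using el_in_hnf[of 0 0 k a b] by (simp add: el_def)
next
  fix x y assume "x \<in> hnf k a b" "y \<in> hnf k a b"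
  then obtain m n m' n' where xy: "x = el m n" "k dvd n" "k * a dvd m - b * n"
    "y = el m' n'" "k dvd n'" "k * a dvd m' - b * n'" by (auto simp: hnf_def)
  have "(m + m') - b * (n + n') = (m - b * n) + (m' - b * n')" by (simp add: algebra_simps)
  hence "k * a dvd (m + m') - b * (n + n')" using dvd_add[OF xy(3,6)] by (simp only:)
  thus "x + y \<in> hnf k a b" using xy by (simp add: el_add)
next
  fix x y assume "x \<in> Oint" "y \<in> hnf k a b"
  then obtain r s m n where xy: "x = el r s" "y = el m n" "k dvd n" "k * a dvd m - b * n"
    by (auto simp: hnf_def Oint_def)
  have "k dvd m - b * n" using xy(4) dvd_mult_left by blast
  hence "k dvd m" using xy(3) by (metis dvd_diff_right_iff dvd_mult dvd_diff_left_iff)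
  have "k * a dvd n * f b" using xy(3) assms by (rule mult_dvd_mono)
  \<comment> \<open>With m - b n already divisible by k a, the only other term is s n (f b); there k
    divides n and a divides f b.\<close>
  moreover have "(r * m - q * s * n) - b * (r * n + s * m + s * n) =
      r * (m - b * n) - s * (n * f b + b * (m - b * n))"
    by (simp add: f_def power2_eq_square algebra_simps)
  ultimately have "k * a dvd (r * m - q * s * n) - b * (r * n + s * m + s * n)" using xy(4) by simp
  moreover have "k dvd r * n + s * m + s * n" using xy(3) \<open>k dvd m\<close> by simp
  ultimately show "x * y \<in> hnf k a b" by (simp add: xy el_mult)
qed

lemma ideal_mult_el:
  assumes "ideal_in Oint I" "x \<in> I"
  shows "el m n * x \<in> I"
  using assms el_in_Oint unfolding ideal_in_def by blast

lemma ideal_add: "ideal_in Oint I \<Longrightarrow> x \<in> I \<Longrightarrow> y \<in> I \<Longrightarrow> x + y \<in> I"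
  by (auto simp: ideal_in_def)

text \<open>The conjugate of \<open>el m n\<close> is \<open>el (m + n) (- n)\<close>, so the ideal
  contains the norm of each of its elements.\<close>

lemma ideal_contains_positive_int:
  assumes I: "ideal_in Oint I" "I \<noteq> {0}"
  shows "\<exists>c>0. el c 0 \<in> I"
proof -
  obtain m n where mn: "el m n \<in> I" "el m n \<noteq> 0"
  proof -
    have "\<exists>x\<in>I. x \<noteq> 0" using I by (auto simp: ideal_in_def)
    then obtain x where x: "x \<in> I" "x \<noteq> 0" by blast
    then obtain m n where "x = el m n" using I(1) by (auto simp: ideal_in_def Oint_def)
    thus ?thesis using that x by blast
  qed
  let ?N = "m\<^sup>2 + m * n + n\<^sup>2 * q"
  have "el (m + n) (- n) * el m n = el ?N 0"
    by (simp add: el_mult power2_eq_square algebra_simps)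
  hence "el ?N 0 \<in> I" using ideal_mult_el[OF I(1) mn(1)] by metis
  moreover have "real_of_int ?N > 0" using mn(2) unfolding norm_el[symmetric] by simp
  hence "?N > 0" by (simp only: of_int_0_less_iff)
  ultimately show ?thesis by blast
qed

text \<open>Hermite normal form with respect to 1 and \<open>w\<close>: \<open>c\<close> generates
  the rational integers in \<open>I\<close>, and \<open>k\<close> generates the
  \<open>w\<close>-coordinates. Multiplication by \<open>w\<close> shows that k divides c and B.
  Multiplying k (b + w) by the conjugate of b + w puts k (f b) into \<open>I\<close>, hence a
  divides f b.\<close>

lemma ideal_eq_hnf:
  assumes I: "ideal_in Oint I" "I \<noteq> {0}"
  shows "\<exists>k a b. k > 0 \<and> a > 0 \<and> b \<in> roots (nat a) \<and> I = hnf k a b"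
proof -
  define J1 where "J1 = {m. el m 0 \<in> I}"
  define J2 where "J2 = {n. \<exists>m. el m n \<in> I}"
  have neg: "el (- m) (- n) \<in> I" if "el m n \<in> I" for m n
    using ideal_mult_el[OF I(1) that, of "-1" 0] by (simp add: el_mult)
  have add: "el (m + m') (n + n') \<in> I" if "el m n \<in> I" "el m' n' \<in> I" for m n m' n'
    using ideal_add[OF I(1) that] by (simp add: el_add)
  have smult: "el (r * m) (r * n) \<in> I" if "el m n \<in> I" for r m n
    using ideal_mult_el[OF I(1) that, of r 0] by (simp add: el_mult)
  have wmult: "el (- (q * n)) (m + n) \<in> I" if "el m n \<in> I" for m n
    using ideal_mult_el[OF I(1) that, of 0 1] by (simp add: el_mult)
  obtain c0 where c0: "c0 > 0" "el c0 0 \<in> I" using ideal_contains_positive_int[OF I] by blast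
  have "\<exists>x\<in>J1. x \<noteq> 0" using c0 by (auto simp: J1_def intro!: bexI[of _ c0])
  then obtain c where c: "c > 0" "J1 = range (\<lambda>j. c * j)"
    by (rule int_subgroup_principal[of J1, rotated 2])
       (use add[of _ 0 _ 0] neg[of _ 0] in \<open>auto simp: J1_def\<close>)
  have "\<exists>x\<in>J2. x \<noteq> 0" using wmult[OF c0(2)] c0 by (auto simp: J2_def intro!: bexI[of _ c0])
  moreover have "x + y \<in> J2" if "x \<in> J2" "y \<in> J2" for x y
    using that add unfolding J2_def mem_Collect_eq by metis
  moreover have "- x \<in> J2" if "x \<in> J2" for x
    using that neg unfolding J2_def mem_Collect_eq by metis
  ultimately obtain k where k: "k > 0" "J2 = range (\<lambda>j. k * j)"
    using int_subgroup_principal[of J2] by metis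
  have J1: "el m 0 \<in> I \<longleftrightarrow> c dvd m" for m
  proof -
    have "el m 0 \<in> I \<longleftrightarrow> m \<in> range (\<lambda>j. c * j)" unfolding c(2)[symmetric] by (simp add: J1_def)
    thus ?thesis by (auto simp: dvd_def)
  qed
  have J2: "k dvd n" if "el m n \<in> I" for m n
  proof -
    have "n \<in> range (\<lambda>j. k * j)" unfolding k(2)[symmetric] using that by (auto simp: J2_def)
    thus ?thesis by auto
  qed
  have "k \<in> J2" unfolding k(2) by (rule range_eqI[of _ _ 1]) simp
  then obtain B where B: "el B k \<in> I" by (auto simp: J2_def)
  have "el c 0 \<in> I" by (simp add: J1)
  from J2[OF wmult[OF this]] obtain a where a: "c = k * a" by (auto elim: dvdE)
  have "a > 0" using a c(1) k(1) by (simp add: zero_less_mult_iff)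
  from J2[OF wmult[OF B]] obtain b0 where b0: "B = k * b0" by (auto elim: dvdE)
  define b where "b = b0 mod a"
  have "k * b = B + (- (b0 div a)) * c"
    using minus_div_mult_eq_mod[of b0 a] by (simp add: a b0 b_def algebra_simps flip: minus_div_mult_eq_mod)
  moreover have "el (B + (- (b0 div a)) * c) (k + 0) \<in> I"
    by (intro add B) (simp add: J1)
  ultimately have bk: "el (k * b) k \<in> I" by simp
  have "I = hnf k a b"
  proof (intro equalityI subsetI)
    fix x assume x: "x \<in> I"
    then obtain m n where mn: "x = el m n" using I(1) by (auto simp: ideal_in_def Oint_def)
    have "k dvd n" using J2 x mn by simp
    then obtain y where y: "n = k * y" by (elim dvdE)
    have "el (m + (- y) * (k * b)) (n + (- y) * k) \<in> I"
      by (intro add smult bk) (use x mn in simp)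
    hence "k * a dvd m + (- y) * (k * b)" using y by (simp add: J1 a algebra_simps)
    thus "x \<in> hnf k a b" using y mn by (simp add: algebra_simps)
  next
    fix x assume "x \<in> hnf k a b"
    then obtain m n where mn: "x = el m n" "k dvd n" "k * a dvd m - b * n" by (auto simp: hnf_def)
    then obtain y where y: "n = k * y" by (elim dvdE)
    have "el (m - b * n) 0 \<in> I" using mn by (simp add: J1 a)
    hence "el ((m - b * n) + y * (k * b)) (0 + y * k) \<in> I" by (intro add smult bk)
    thus "x \<in> I" using mn y by (simp add: algebra_simps)
  qed
  moreover have "a dvd f b"
  proof -
    have "el (b + 1) (- 1) * el (k * b) k = el (k * f b) 0"
      by (simp add: el_mult f_def power2_eq_square algebra_simps)
    hence "el (k * f b) 0 \<in> I" using ideal_mult_el[OF I(1) bk] by metis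
    thus ?thesis using k(1) by (simp add: J1 a)
  qed
  ultimately show ?thesis
    using k(1) \<open>a > 0\<close> by (intro exI[of _ k] exI[of _ a] exI[of _ b]) (auto simp: roots_def b_def)
qed

lemma hnf_inject:
  assumes pos: "k > 0" "a > 0" "k' > 0" "a' > 0" and b: "0 \<le> b" "b < a" "0 \<le> b'" "b' < a'"
    and eq: "hnf k a b = hnf k' a' b'"
  shows "k = k' \<and> a = a' \<and> b = b'"
proof -
  have e: "el m n \<in> hnf k a b \<longleftrightarrow> el m n \<in> hnf k' a' b'" for m n using eq by simp
  have "k' dvd k" "k dvd k'" using e[of "k * b" k] e[of "k' * b'" k'] by (auto simp: mult.commute)
  hence k: "k = k'" using pos by (simp add: zdvd_antisym_nonneg)
  have "k' * a' dvd k * a" "k * a dvd k' * a'" using e[of "k * a" 0] e[of "k' * a'" 0] by auto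
  hence "a' dvd a" "a dvd a'" using k pos by auto
  hence a: "a = a'" using pos by (simp add: zdvd_antisym_nonneg)
  have "k * a dvd k * b - b' * k" using e[of "k * b" k] k a by (simp add: mult.commute)
  moreover have "k * b - b' * k = k * (b - b')" by (simp add: algebra_simps)
  ultimately have "a dvd b - b'" using pos by simp
  hence "b mod a = b' mod a" by (simp add: mod_eq_dvd_iff)
  thus ?thesis using k a b by simp
qed

lemma hnf_nonzero: "k > 0 \<Longrightarrow> a > 0 \<Longrightarrow> hnf k a b \<noteq> {0}"
proof -
  assume "k > 0" "a > 0"
  hence "k * a \<noteq> 0" by simp
  hence "el (k * a) 0 \<noteq> 0" by (simp add: el_of_int)
  moreover have "el (k * a) 0 \<in> hnf k a b" by simp
  ultimately show ?thesis by blast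
qed

section \<open>Parametrization of the nonzero ideals, and their norms\<close>

definition nz_ideals :: "complex set set" where
  "nz_ideals = {I. ideal_in Oint I \<and> I \<noteq> {0}}"

lemma nonzero_ideals_eq: "nonzero_ideals (ring_on Oint) = nz_ideals"
  unfolding nz_ideals_def by (rule nonzero_ideals_ring_on[OF subring_Oint])

definition triples :: "(nat \<times> nat \<times> int) set" where
  "triples = {(k, a, b). k > 0 \<and> a > 0 \<and> b \<in> roots a}"

lemma bij_triples: "bij_betw (\<lambda>(k, a, b). hnf (int k) (int a) b) triples nz_ideals"
  unfolding bij_betw_def
proof (intro conjI equalityI subsetI inj_onI)
  fix s t assume st: "s \<in> triples" "t \<in> triples"
    "(\<lambda>(k, a, b). hnf (int k) (int a) b) s = (\<lambda>(k, a, b). hnf (int k) (int a) b) t"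
  obtain k a b k' a' b' where eq: "s = (k, a, b)" "t = (k', a', b')" by (metis prod_cases3)
  have "int k = int k' \<and> int a = int a' \<and> b = b'"
    by (rule hnf_inject) (use st in \<open>auto simp: eq triples_def roots_def\<close>)
  thus "s = t" by (simp add: eq)
next
  fix I assume "I \<in> (\<lambda>(k, a, b). hnf (int k) (int a) b) ` triples"
  then obtain k a b where kab: "(k, a, b) \<in> triples" "I = hnf (int k) (int a) b" by auto
  have "ideal_in Oint I" unfolding kab(2)
    by (rule ideal_hnf) (use kab(1) in \<open>simp add: triples_def roots_def\<close>)
  moreover have "I \<noteq> {0}" unfolding kab(2)
    by (rule hnf_nonzero) (use kab(1) in \<open>simp_all add: triples_def\<close>)
  ultimately show "I \<in> nz_ideals" by (simp add: nz_ideals_def)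
next
  fix I assume "I \<in> nz_ideals"
  then obtain k a b where kab: "k > 0" "a > 0" "b \<in> roots (nat a)" "I = hnf k a b"
    using ideal_eq_hnf[of I] by (auto simp: nz_ideals_def)
  thus "I \<in> (\<lambda>(k, a, b). hnf (int k) (int a) b) ` triples"
    by (intro image_eqI[of _ _ "(nat k, nat a, b)"]) (auto simp: triples_def)
qed

text \<open>$\sqrt{p}/2$ is the covolume of the ring of integers.\<close>

definition nrm :: "complex set \<Rightarrow> real" where "nrm I = 2 / sqrt p * covol I"

lemma nrm_hnf: "k > 0 \<Longrightarrow> a > 0 \<Longrightarrow> nrm (hnf k a b) = of_int (k\<^sup>2 * a)"
  using sqrt_p_pos unfolding nrm_def hnf_eq_lat covol_lat
  by (simp add: abs_mult power2_eq_square)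

lemma nz_ideal_eq_lat:
  assumes "I \<in> nz_ideals"
  obtains u v where "I = lat u v" "Im (cnj u * v) \<noteq> 0"
proof -
  obtain k a b where kab: "k > 0" "a > 0" "I = hnf k a b"
    using assms ideal_eq_hnf[of I] by (auto simp: nz_ideals_def)
  have "nrm I > 0" using kab by (simp add: nrm_hnf)
  hence "covol (lat (el (k * a) 0) (el (k * b) k)) \<noteq> 0" using kab(3) by (auto simp: nrm_def hnf_eq_lat)
  hence "Im (cnj (el (k * a) 0) * el (k * b) k) \<noteq> 0" unfolding covol_lat by (rule contrapos_nn) simp
  thus ?thesis using that kab(3) unfolding hnf_eq_lat by blast
qed

lemma nrm_pos: "I \<in> nz_ideals \<Longrightarrow> nrm I > 0"
  by (elim nz_ideal_eq_lat) (use sqrt_p_pos in \<open>auto simp: nrm_def covol_lat\<close>)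

lemma nrm_mult: "I \<in> nz_ideals \<Longrightarrow> nrm ((*) g ` I) = (cmod g)\<^sup>2 * nrm I"
  by (elim nz_ideal_eq_lat) (simp add: nrm_def covol_mult)

end

section \<open>Ideal classes\<close>

context prime_3_mod_4
begin

definition class_rel :: "(complex set \<times> complex set) set" where
  "class_rel = {(I, J). I \<in> nz_ideals \<and> J \<in> nz_ideals \<and>
     (\<exists>\<alpha>\<in>Oint - {0}. \<exists>\<beta>\<in>Oint - {0}. (*) \<alpha> ` I = (*) \<beta> ` J)}"

lemma class_number_eq: "class_number (quadratic_field (- int p)) = card (nz_ideals // class_rel)"
  unfolding class_number_def ring_of_integers_eq class_rel_def ideal_class_rel_ring_on nonzero_ideals_eq ..

lemma Oint_mult: "x \<in> Oint \<Longrightarrow> y \<in> Oint \<Longrightarrow> x * y \<in> Oint"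
  using subring_Oint by (simp add: subring_of_complex_def)

lemma class_relI:
  assumes "I \<in> nz_ideals" "J \<in> nz_ideals" "\<alpha> \<in> Oint" "\<alpha> \<noteq> 0" "\<beta> \<in> Oint" "\<beta> \<noteq> 0" "(*) \<alpha> ` I = (*) \<beta> ` J"
  shows "(I, J) \<in> class_rel"
  using assms by (auto simp: class_rel_def)

lemma equiv_class_rel: "equiv nz_ideals class_rel"
proof (rule equivI)
  show "refl_on nz_ideals class_rel"
    by (rule refl_onI) (auto intro!: class_relI[of _ _ "of_int 1" "of_int 1"] simp del: of_int_1)
  show "sym class_rel" by (rule symI) (unfold class_rel_def, blast intro: sym)
  show "trans class_rel"
  proof (rule transI)
    fix I J K assume "(I, J) \<in> class_rel" "(J, K) \<in> class_rel"
    then obtain \<alpha> \<beta> \<gamma> \<delta> where *: "I \<in> nz_ideals" "J \<in> nz_ideals" "K \<in> nz_ideals"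
      "\<alpha> \<in> Oint" "\<alpha> \<noteq> 0" "\<beta> \<in> Oint" "\<beta> \<noteq> 0" "(*) \<alpha> ` I = (*) \<beta> ` J"
      "\<gamma> \<in> Oint" "\<gamma> \<noteq> 0" "\<delta> \<in> Oint" "\<delta> \<noteq> 0" "(*) \<gamma> ` J = (*) \<delta> ` K"
      unfolding class_rel_def by auto
    have "(*) (\<gamma> * \<alpha>) ` I = (*) \<gamma> ` ((*) \<alpha> ` I)" by (simp add: image_image mult_ac)
    also have "\<dots> = (*) \<beta> ` ((*) \<gamma> ` J)" unfolding *(8) by (simp add: image_image mult_ac)
    also have "\<dots> = (*) (\<beta> * \<delta>) ` K" unfolding *(13) by (simp add: image_image mult_ac)
    finally show "(I, K) \<in> class_rel"
      using * by (intro class_relI[of _ _ "\<gamma> * \<alpha>" "\<beta> * \<delta>"] Oint_mult) auto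
  qed
  show "class_rel \<subseteq> nz_ideals \<times> nz_ideals" by (auto simp: class_rel_def)
qed

section \<open>Reduction and finiteness of the set of classes\<close>

lemma hnf_in_nz_ideals: "k > 0 \<Longrightarrow> a > 0 \<Longrightarrow> a dvd f b \<Longrightarrow> hnf k a b \<in> nz_ideals"
  by (simp add: nz_ideals_def ideal_hnf hnf_nonzero)

lemma class_rel_hnf_scale:
  assumes "k > 0" "a > 0" "a dvd f b"
  shows "(hnf k a b, hnf 1 a b) \<in> class_rel"
proof (rule class_relI[of _ _ "of_int 1" "of_int k"])
  have "of_int k * el a 0 = el (k * a) 0" "of_int k * el b 1 = el (k * b) k" by (simp_all add: el_def algebra_simps)
  thus "(*) (of_int 1) ` hnf k a b = (*) (of_int k) ` hnf 1 a b"
    unfolding hnf_eq_lat image_mult_lat by simp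
qed (use assms in \<open>auto intro!: hnf_in_nz_ideals simp del: of_int_1\<close>)

lemma f_neg: "f (- b - 1) = f b"
  by (simp add: f_def power2_eq_square algebra_simps)

text \<open>Multiplication by the conjugate of $b + \omega$, whose norm is \<open>f b\<close>.\<close>

lemma class_rel_hnf_reduce:
  assumes "a > 0" "f b = a * a'"
  shows "(hnf 1 a b, hnf 1 a' (- b - 1)) \<in> class_rel"
proof (rule class_relI[of _ _ "el (b + 1) (- 1)" "el a 0"])
  have a': "a' > 0" using f_pos[of b] assms by (simp add: zero_less_mult_iff)
  show "hnf 1 a b \<in> nz_ideals" "hnf 1 a' (- b - 1) \<in> nz_ideals"
    using assms a' by (auto intro!: hnf_in_nz_ideals simp: f_neg)
  have e: "el (b + 1) (- 1) * el b 1 = el a 0 * el a' 0"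
    using assms(2) by (simp add: el_mult f_def power2_eq_square algebra_simps)
  have "(*) (el (b + 1) (- 1)) ` hnf 1 a b = lat (el a 0 * el (b + 1) (- 1)) (el a 0 * el a' 0)"
    unfolding hnf_eq_lat image_mult_lat mult_1 mult.commute[of "el (b + 1) (- 1)" "el a 0"] e ..
  also have "\<dots> = lat (el a 0 * el a' 0) (el a 0 * el (- b - 1) 1)"
    by (subst lat_rotate) (simp add: el_minus flip: mult_minus_right)
  also have "\<dots> = (*) (el a 0) ` hnf 1 a' (- b - 1)"
    unfolding hnf_eq_lat image_mult_lat by simp
  finally show "(*) (el (b + 1) (- 1)) ` hnf 1 a b = (*) (el a 0) ` hnf 1 a' (- b - 1)" .
  have "el m n \<noteq> 0" if "m \<noteq> 0 \<or> n \<noteq> 0" for m n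
    using that el_eq_iff[of m n 0 0] by (simp add: el_of_int)
  thus "el (b + 1) (- 1) \<noteq> 0" "el a 0 \<noteq> 0" using assms by auto
qed auto

lemma hnf_cong:
  assumes "[b = b'] (mod a)"
  shows "hnf 1 a b = hnf 1 a b'"
proof -
  have "a dvd m - b * n \<longleftrightarrow> a dvd m - b' * n" for m n
  proof -
    have "[m - b * n = m - b' * n] (mod a)" using assms by (intro cong_diff cong_mult cong_refl)
    thus ?thesis by (rule cong_dvd_iff[of _ _ a, simplified])
  qed
  thus ?thesis by (simp add: hnf_def)
qed

text \<open>Gauss reduction. Shifting b modulo a until |2b + 1| \<le> a gives 4 a a' \<le> a^2 + p,
  so for a > p the cofactor a' is at most a/2. The crude bound p suffices for finiteness.\<close>

lemma class_rel_hnf_small: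
  assumes "a > 0" "a dvd f b"
  shows "\<exists>a' b'. a' > 0 \<and> a' \<le> int p \<and> a' dvd f b' \<and> (hnf 1 a b, hnf 1 a' b') \<in> class_rel"
  using assms
proof (induction "nat a" arbitrary: a b rule: less_induct)
  case less
  show ?case
  proof (cases "a \<le> int p")
    case True
    have "(hnf 1 a b, hnf 1 a b) \<in> class_rel"
      using equiv_class_rel less.prems by (meson equivE refl_onD hnf_in_nz_ideals zero_less_one)
    thus ?thesis using True less.prems by blast
  next
    case False
    obtain b' where b': "[b = b'] (mod a)" "- a \<le> 2 * b' + 1" "2 * b' + 1 \<le> a"
    proof (cases "2 * (b mod a) + 1 \<le> a")
      case True
      moreover have "0 \<le> b mod a" using less.prems by simp
      hence "- a \<le> 2 * (b mod a) + 1" using less.prems(1) by linarith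
      ultimately show ?thesis using that[of "b mod a"] by simp
    next
      case F: False
      have "[b = b mod a - a] (mod a)" by (simp add: cong_def)
      moreover have "b mod a < a" using less.prems by simp
      ultimately show ?thesis using that[of "b mod a - a"] F by simp
    qed
    have "a dvd f b'" using less.prems(2) dvd_f_cong[OF b'(1)] by simp
    then obtain a' where a': "f b' = a * a'" by (elim dvdE)
    have a'0: "a' > 0" using f_pos[of b'] a' less.prems by (simp add: zero_less_mult_iff)
    have "\<bar>2 * b' + 1\<bar> \<le> \<bar>a\<bar>" using b' by linarith
    hence "(2 * b' + 1)\<^sup>2 \<le> a\<^sup>2" by (rule abs_le_square_iff[THEN iffD1])
    hence "4 * (a * a') \<le> a * a + int p" unfolding a'[symmetric] four_f by (simp add: power2_eq_square)
    moreover have "1 * a \<le> a * a" using less.prems by (intro mult_right_mono) auto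
    ultimately have "4 * (a * a') \<le> 2 * (a * a)" using False by linarith
    hence "a * (2 * a') \<le> a * a" by linarith
    hence "2 * a' \<le> a" using less.prems by (simp add: mult_le_cancel_left_pos)
    hence "nat a' < nat a" using a'0 by linarith
    moreover have "a' dvd f (- b' - 1)" unfolding f_neg a' by simp
    ultimately obtain a'' b'' where r: "a'' > 0" "a'' \<le> int p" "a'' dvd f b''"
      "(hnf 1 a' (- b' - 1), hnf 1 a'' b'') \<in> class_rel"
      using less.hyps[of a' "- b' - 1"] a'0 by blast
    have "(hnf 1 a b, hnf 1 a' (- b' - 1)) \<in> class_rel"
      unfolding hnf_cong[OF b'(1)] using less.prems a' by (intro class_rel_hnf_reduce)
    with r(4) have "(hnf 1 a b, hnf 1 a'' b'') \<in> class_rel"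
      using equiv_class_rel by (meson equivE transD)
    thus ?thesis using r by blast
  qed
qed

text \<open>Finiteness is what allows the limit to be taken class by class, and what makes
  \<open>card\<close> a genuine count.\<close>

lemma finite_classes: "finite (nz_ideals // class_rel)"
proof (rule finite_subset)
  show "nz_ideals // class_rel \<subseteq> (\<lambda>(a, b). class_rel `` {hnf 1 a b}) ` ({1..int p} \<times> {0..int p})"
  proof
    fix C assume "C \<in> nz_ideals // class_rel"
    then obtain I where I: "I \<in> nz_ideals" "C = class_rel `` {I}" by (auto elim: quotientE)
    obtain k a b where kab: "k > 0" "a > 0" "b \<in> roots (nat a)" "I = hnf k a b"
      using I(1) ideal_eq_hnf[of I] by (auto simp: nz_ideals_def)
    have ab: "a dvd f b" using kab by (simp add: roots_def)
    obtain a' b' where r: "a' > 0" "a' \<le> int p" "a' dvd f b'" "(hnf 1 a b, hnf 1 a' b') \<in> class_rel"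
      using class_rel_hnf_small[OF kab(2) ab] by blast
    have "hnf 1 a' b' = hnf 1 a' (b' mod a')" by (rule hnf_cong) simp
    moreover have "(I, hnf 1 a' b') \<in> class_rel"
      using r(4) class_rel_hnf_scale[OF kab(1,2) ab] equiv_class_rel unfolding kab(4) by (meson equivE transD)
    hence "C = class_rel `` {hnf 1 a' b'}" unfolding I(2) by (rule equiv_class_eq[OF equiv_class_rel])
    moreover have "b' mod a' \<le> int p" "0 \<le> b' mod a'"
      using r(2) pos_mod_bound[OF r(1), of b'] pos_mod_sign[OF r(1), of b'] by linarith+
    hence "(a', b' mod a') \<in> {1..int p} \<times> {0..int p}" using r(1,2) by simp
    ultimately show "C \<in> (\<lambda>(a, b). class_rel `` {hnf 1 a b}) ` ({1..int p} \<times> {0..int p})"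
      by (metis (mono_tags, lifting) case_prod_conv image_eqI)
  qed
qed auto

text \<open>
  The inverse of \<open>J\<close> as a fractional ideal: the ideals in the class of \<open>J\<close> are the \<open>g J\<close> with nonzero
  \<open>g\<close> in \<open>colon J\<close>, and \<open>g\<close> is determined up to sign because the units are $\pm 1$.
\<close>

definition colon :: "complex set \<Rightarrow> complex set" where
  "colon J = {g. \<forall>x\<in>J. g * x \<in> Oint}"

text \<open>Multiplication by a positive integer c in \<open>J\<close> carries
  \<open>colon J\<close> onto a nonzero ideal, which has a lattice basis by the normal form;
  dividing by c gives a basis of \<open>colon J\<close>.\<close>

lemma colon_eq_lat:
  assumes J: "J \<in> nz_ideals"
  obtains u v where "colon J = lat u v" "Im (cnj u * v) \<noteq> 0"
proof -
  have idl: "ideal_in Oint J" using J by (simp add: nz_ideals_def)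
  obtain c where c: "c > 0" "el c 0 \<in> J"
    using ideal_contains_positive_int[of J] J by (auto simp: nz_ideals_def)
  define I where "I = (*) (el c 0) ` colon J"
  have c0: "el c 0 \<noteq> 0" using c by (simp add: el_of_int)
  have "ideal_in Oint I"
    unfolding ideal_in_def
  proof (intro conjI ballI)
    show "I \<subseteq> Oint" using c by (auto simp: I_def colon_def mult.commute)
    have "0 \<in> colon J" using of_int_in_Oint[of 0] by (simp add: colon_def)
    thus "0 \<in> I" unfolding I_def by (intro image_eqI[of _ _ 0]) auto
    show "x + y \<in> I" if "x \<in> I" "y \<in> I" for x y
    proof -
      obtain g h where gh: "g \<in> colon J" "h \<in> colon J" "x = el c 0 * g" "y = el c 0 * h"
        using \<open>x \<in> I\<close> \<open>y \<in> I\<close> by (auto simp: I_def)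
      have "g + h \<in> colon J"
        using gh subring_Oint by (auto simp: colon_def algebra_simps subring_of_complex_def)
      thus ?thesis unfolding I_def gh by (intro image_eqI[of _ _ "g + h"]) (auto simp: algebra_simps)
    qed
    show "r * x \<in> I" if "r \<in> Oint" "x \<in> I" for r x
    proof -
      obtain g where g: "g \<in> colon J" "x = el c 0 * g" using \<open>x \<in> I\<close> by (auto simp: I_def)
      have "r * g \<in> colon J" using g \<open>r \<in> Oint\<close> Oint_mult by (auto simp: colon_def mult.assoc)
      thus ?thesis unfolding I_def g by (intro image_eqI[of _ _ "r * g"]) (auto simp: algebra_simps)
    qed
  qed
  moreover have "1 \<in> colon J" using idl by (auto simp: colon_def ideal_in_def)
  hence "el c 0 * 1 \<in> I" unfolding I_def by (rule imageI)
  hence "I \<noteq> {0}" using c0 by auto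
  ultimately have "I \<in> nz_ideals" by (simp add: nz_ideals_def)
  then obtain u v where uv: "I = lat u v" "Im (cnj u * v) \<noteq> 0" by (rule nz_ideal_eq_lat)
  have "colon J = (*) (inverse (el c 0)) ` I"
    using c0 by (simp add: I_def image_image flip: mult.assoc)
  hence "colon J = lat (inverse (el c 0) * u) (inverse (el c 0) * v)" by (simp add: uv image_mult_lat)
  moreover have "Im (cnj (inverse (el c 0) * u) * (inverse (el c 0) * v)) \<noteq> 0"
  proof -
    have "covol ((*) (inverse (el c 0)) ` lat u v) \<noteq> 0"
      unfolding covol_mult using c0 uv(2) by (simp add: covol_lat)
    thus ?thesis unfolding image_mult_lat covol_lat by simp
  qed
  ultimately show ?thesis by (rule that)
qed

text \<open>The multiplier g need not be integral, but the class relation asks for integral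
  witnesses; g c and c serve, with c a positive integer in \<open>J\<close>.\<close>

lemma image_colon_in_class:
  assumes J: "J \<in> nz_ideals" and g: "g \<in> colon J" "g \<noteq> 0"
  shows "(*) g ` J \<in> class_rel `` {J}"
proof -
  have idl: "ideal_in Oint J" using J by (simp add: nz_ideals_def)
  obtain c where c: "c > 0" "el c 0 \<in> J"
    using ideal_contains_positive_int[of J] J by (auto simp: nz_ideals_def)
  have c0: "el c 0 \<noteq> 0" using c by (simp add: el_of_int)
  have "ideal_in Oint ((*) g ` J)"
    unfolding ideal_in_def
  proof (intro conjI ballI)
    show "(*) g ` J \<subseteq> Oint" using g by (auto simp: colon_def)
    show "0 \<in> (*) g ` J" using idl by (intro image_eqI[of _ _ 0]) (auto simp: ideal_in_def)
    show "x + y \<in> (*) g ` J" if "x \<in> (*) g ` J" "y \<in> (*) g ` J" for x y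
    proof -
      obtain s t where "s \<in> J" "t \<in> J" "x = g * s" "y = g * t"
        using \<open>x \<in> (*) g ` J\<close> \<open>y \<in> (*) g ` J\<close> by blast
      thus ?thesis using ideal_add[OF idl] by (intro image_eqI[of _ _ "s + t"]) (auto simp: algebra_simps)
    qed
    show "r * x \<in> (*) g ` J" if "r \<in> Oint" "x \<in> (*) g ` J" for r x
    proof -
      obtain s where "s \<in> J" "x = g * s" using \<open>x \<in> (*) g ` J\<close> by blast
      thus ?thesis using idl \<open>r \<in> Oint\<close>
        by (intro image_eqI[of _ _ "r * s"]) (auto simp: ideal_in_def)
    qed
  qed
  moreover have "g * el c 0 \<in> (*) g ` J" using c by blast
  hence "(*) g ` J \<noteq> {0}" using c0 g(2) by (metis mult_eq_0_iff singletonD)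
  ultimately have gJ: "(*) g ` J \<in> nz_ideals" by (simp add: nz_ideals_def)
  have "(*) (el c 0) ` ((*) g ` J) = (*) (g * el c 0) ` J" by (simp add: image_image mult_ac)
  hence "(J, (*) g ` J) \<in> class_rel"
    using g c c0 by (intro class_relI[of _ _ "g * el c 0" "el c 0"] J gJ) (auto simp: colon_def)
  thus ?thesis by simp
qed

lemma class_eq_image_colon:
  assumes J: "J \<in> nz_ideals" and I: "I \<in> class_rel `` {J}"
  shows "\<exists>g\<in>colon J - {0}. I = (*) g ` J"
proof -
  obtain \<alpha> \<beta> where ab: "\<alpha> \<in> Oint" "\<alpha> \<noteq> 0" "\<beta> \<in> Oint" "\<beta> \<noteq> 0" "(*) \<alpha> ` J = (*) \<beta> ` I" "I \<in> nz_ideals"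
    using I by (auto simp: class_rel_def)
  have "I = (*) (inverse \<beta>) ` ((*) \<beta> ` I)" using ab by (simp add: image_image flip: mult.assoc)
  also have "\<dots> = (*) (inverse \<beta> * \<alpha>) ` J" unfolding ab(5)[symmetric] by (simp add: image_image mult_ac)
  finally have eq: "I = (*) (inverse \<beta> * \<alpha>) ` J" .
  hence "inverse \<beta> * \<alpha> \<in> colon J" using ab(6) by (auto simp: colon_def nz_ideals_def ideal_in_def)
  thus ?thesis using eq ab by (intro bexI[of _ "inverse \<beta> * \<alpha>"]) auto
qed

text \<open>Four times the norm equation reads (2m + n)^2 + p n^2 = 4, which forces n = 0 once p >
  4. For p = 3 the sixth roots of unity would be further solutions.\<close>

lemma norm_one_unit:
  assumes "d \<in> Oint" "cmod d = 1"
  shows "d = 1 \<or> d = - 1"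
proof -
  obtain m n where d: "d = el m n" using assms(1) by (auto simp: Oint_def)
  have "real_of_int (m\<^sup>2 + m * n + n\<^sup>2 * q) = of_int 1" unfolding norm_el[symmetric] using assms d by simp
  hence N: "m\<^sup>2 + m * n + n\<^sup>2 * q = 1" by (simp only: of_int_eq_iff)
  have "(2 * m + n)\<^sup>2 + int p * n\<^sup>2 = 4 * (m\<^sup>2 + m * n + n\<^sup>2 * q)"
    by (simp add: p_eq power2_eq_square algebra_simps)
  hence *: "(2 * m + n)\<^sup>2 + int p * n\<^sup>2 = 4" using N by simp
  have "p \<noteq> 4" using p_mod_4 by auto
  hence "int p > 4" using p_gt_3 by simp
  have "n = 0"
  proof (rule ccontr)
    assume "n \<noteq> 0"
    hence "n\<^sup>2 \<ge> 1" by (simp add: int_one_le_iff_zero_less)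
    hence "int p * n\<^sup>2 \<ge> int p * 1" by (intro mult_left_mono) auto
    thus False using * \<open>int p > 4\<close> zero_le_power2[of "2 * m + n"] by linarith
  qed
  hence "m\<^sup>2 = 1" using N by simp
  hence "m = 1 \<or> m = - 1" by (simp add: power2_eq_1_iff)
  thus ?thesis using \<open>n = 0\<close> d by (auto simp: el_of_int)
qed

text \<open>Comparing covolumes gives |d| = 1. Integrality is the Cayley-Hamilton argument: d is a
  root of the characteristic polynomial of its matrix on a basis of \<open>J\<close>. It lies in the
  field because \<open>J\<close> contains a nonzero integer.\<close>

lemma ideal_stabilizer:
  assumes J: "J \<in> nz_ideals" and d: "(*) d ` J = J"
  shows "d = 1 \<or> d = - 1"
proof (rule norm_one_unit)
  have "(cmod d)\<^sup>2 * nrm J = nrm J" using nrm_mult[OF J, of d] d by simp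
  hence "(cmod d)\<^sup>2 = 1" using nrm_pos[OF J] by simp
  thus "cmod d = 1" using power2_eq_1_iff[of "cmod d"] norm_ge_zero[of d] by linarith
  obtain u v where uv: "J = lat u v" "Im (cnj u * v) \<noteq> 0" using J by (rule nz_ideal_eq_lat)
  have uv0: "u \<noteq> 0" "v \<noteq> 0" using uv(2) by auto
  have "d * u \<in> lat u v" "d * v \<in> lat u v" using d uv(1) generators_in_lat by blast+
  then obtain x y z t :: int where xy: "d * u = of_int x * u + of_int y * v" "d * v = of_int z * u + of_int t * v"
    unfolding lat_def by auto
  have "(d - of_int x) * u = of_int y * v" "(d - of_int t) * v = of_int z * u"
    using xy by (simp_all add: algebra_simps)
  hence "((d - of_int x) * u) * ((d - of_int t) * v) = (of_int y * v) * (of_int z * u)" by simp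
  hence "((d - of_int x) * (d - of_int t)) * (u * v) = (of_int y * of_int z) * (u * v)" by (simp add: mult_ac)
  hence eq: "(d - of_int x) * (d - of_int t) = of_int y * of_int z"
    using uv0 by (simp only: mult_cancel_right) simp
  let ?P = "[:of_int (x * t - y * z), - of_int (x + t), 1 :: complex:]"
  have "poly ?P d = 0" using eq by (simp add: algebra_simps)
  moreover have "\<forall>i. poly.coeff ?P i \<in> \<int>" by (auto simp: coeff_pCons split: nat.splits)
  ultimately have alg: "algebraic_int d" by (intro algebraic_int.intros[of ?P]) auto
  obtain c where c: "c > 0" "el c 0 \<in> J"
    using ideal_contains_positive_int[of J] J by (auto simp: nz_ideals_def)
  have "d * el c 0 \<in> J" using c d by blast
  hence "d * el c 0 \<in> Oint" using J by (auto simp: nz_ideals_def ideal_in_def)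
  then obtain m n where mn: "d * of_int c = el m n" by (auto simp: Oint_def el_of_int)
  have "d = el m n / of_int c" using mn c by (simp add: field_simps)
  also have "\<dots> = of_rat ((of_int m + of_int n / 2) / of_int c) + of_rat (of_int n / 2 / of_int c) * rtp"
    using c by (simp add: el_def w_def of_rat_add of_rat_divide of_rat_mult field_simps)
  finally have "d \<in> quadratic_field (- int p)" unfolding quadratic_field_eq by blast
  thus "d \<in> Oint" using alg by (rule algebraic_int_imp_Oint)
qed

lemma colon_fibre:
  assumes J: "J \<in> nz_ideals" and g: "g \<in> colon J - {0}"
  shows "{h \<in> colon J - {0}. (*) h ` J = (*) g ` J} = {g, - g}" "g \<noteq> - g"
proof -
  have idl: "ideal_in Oint J" using J by (simp add: nz_ideals_def)
  show "g \<noteq> - g" using g by auto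
  have m: "(*) (- 1) ` J = J"
  proof -
    have "- x \<in> J" if "x \<in> J" for x
      using ideal_mult_el[OF idl that, of "-1" 0] by (simp add: el_of_int)
    thus ?thesis by (force simp: image_iff)
  qed
  have "(*) (- g) ` J = (*) g ` ((*) (- 1) ` J)" by (simp add: image_image)
  hence mg: "(*) (- g) ` J = (*) g ` J" by (simp only: m)
  have "- g \<in> colon J - {0}" using g el_minus by (auto simp: colon_def Oint_def)
  moreover have "h = g \<or> h = - g" if h: "(*) h ` J = (*) g ` J" for h
  proof -
    have "(*) (inverse g * h) ` J = (*) (inverse g) ` ((*) h ` J)" by (simp add: image_image mult_ac)
    also have "\<dots> = J" unfolding h using g by (simp add: image_image flip: mult.assoc)
    finally have "inverse g * h = 1 \<or> inverse g * h = - 1" by (rule ideal_stabilizer[OF J])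
    thus ?thesis using g by (auto simp: field_simps)
  qed
  ultimately show "{h \<in> colon J - {0}. (*) h ` J = (*) g ` J} = {g, - g}"
    using mg g by (intro equalityI subsetI; unfold mem_Collect_eq insert_iff empty_iff) metis+
qed

end

section \<open>The class number formula\<close>

context prime_3_mod_4
begin

text \<open>Writing g = m u + n v and v = u z, the norm of the ideal g J is nrm J |u|^2 ((m + n Re
  z)^2 + (n Im z)^2), a form of the shape treated by \<open>theta2\<close> at e = sqrt t. The 1
  subtracted is the term g = 0, and the half accounts for the pairs g, -g.\<close>

lemma class_theta_series:
  assumes J: "J \<in> nz_ideals"
  shows "\<exists>a c x. a > 0 \<and> c > 0 \<and>
    (\<forall>t>0. ((\<lambda>I. exp (- t * nrm I)) has_sum ((theta2 a c x (sqrt t) - 1) / 2)) (class_rel `` {J}))"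
proof -
  obtain u v where uv: "colon J = lat u v" "Im (cnj u * v) \<noteq> 0" using J by (rule colon_eq_lat)
  have u: "u \<noteq> 0" using uv(2) by auto
  define z where "z = v / u"
  have v: "v = u * z" using u by (simp add: z_def)
  have "cnj u * v = of_real ((cmod u)\<^sup>2) * z" unfolding v complex_norm_square by (simp add: mult_ac)
  moreover have "Im (of_real r * w) = r * Im w" for r w by simp
  ultimately have "Im (cnj u * v) = (cmod u)\<^sup>2 * Im z" by (simp only:)
  hence z: "Im z \<noteq> 0" using uv(2) by auto
  define a where "a = sqrt (nrm J) * cmod u"
  define c where "c = a * \<bar>Im z\<bar>"
  have a: "a > 0" using nrm_pos[OF J] u by (simp add: a_def)
  have c: "c > 0" using a z by (simp add: c_def)
  let ?g = "\<lambda>(n::int, m::int). of_int m * u + of_int n * v"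
  have bij: "bij_betw ?g UNIV (colon J)"
    unfolding bij_betw_def
  proof
    show "inj ?g"
    proof (rule injI, clarify)
      fix n m n' m' :: int
      assume "of_int m * u + of_int n * v = of_int m' * u + of_int n' * v"
      hence "u * (of_int m + of_int n * z) = u * (of_int m' + of_int n' * z)" by (simp add: v algebra_simps)
      hence "of_int m + of_int n * z = of_int m' + of_int n' * z" using u by simp
      hence "Im (of_int m + of_int n * z) = Im (of_int m' + of_int n' * z)"
        "Re (of_int m + of_int n * z) = Re (of_int m' + of_int n' * z)" by simp_all
      thus "n = n' \<and> m = m'" using z by simp
    qed
    show "range ?g = colon J" unfolding uv(1) lat_def by auto
  qed
  have main: "((\<lambda>I. exp (- t * nrm I)) has_sum ((theta2 a c (Re z) (sqrt t) - 1) / 2)) (class_rel `` {J})"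
    if t: "t > 0" for t
  proof -
    let ?e = "\<lambda>g. exp (- t * nrm ((*) g ` J))"
    have eq: "exp (- ((sqrt t * a * (of_int m + of_int n * Re z))\<^sup>2 + (sqrt t * c * of_int n)\<^sup>2)) = ?e (?g (n, m))" for n m :: int
    proof -
      have "?g (n, m) = u * (of_int m + of_int n * z)" by (simp add: v algebra_simps)
      hence "(cmod (?g (n, m)))\<^sup>2 = (cmod u)\<^sup>2 * ((of_int m + of_int n * Re z)\<^sup>2 + (of_int n * Im z)\<^sup>2)"
        by (simp add: norm_mult power_mult_distrib cmod_power2)
      moreover have "a\<^sup>2 = nrm J * (cmod u)\<^sup>2" "c\<^sup>2 = nrm J * (cmod u)\<^sup>2 * (Im z)\<^sup>2"
        using nrm_pos[OF J] by (simp_all add: a_def c_def power_mult_distrib)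
      ultimately have "(sqrt t * a * (of_int m + of_int n * Re z))\<^sup>2 + (sqrt t * c * of_int n)\<^sup>2 =
           t * ((cmod (?g (n, m)))\<^sup>2 * nrm J)"
        using t by (simp only: power_mult_distrib real_sqrt_pow2 less_imp_le) (simp add: algebra_simps)
      thus ?thesis unfolding nrm_mult[OF J] by simp
    qed
    have "(\<lambda>(n, m). exp (- ((sqrt t * a * (of_int m + of_int n * Re z))\<^sup>2 + (sqrt t * c * of_int n)\<^sup>2))) = (\<lambda>x. ?e (?g x))"
    proof
      fix x :: "int \<times> int"
      show "(case x of (n, m) \<Rightarrow> exp (- ((sqrt t * a * (of_int m + of_int n * Re z))\<^sup>2 + (sqrt t * c * of_int n)\<^sup>2))) = ?e (?g x)"
        using eq[where n = "fst x" and m = "snd x"] unfolding case_prod_unfold fst_conv snd_conv .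
    qed
    hence "((\<lambda>x. ?e (?g x)) has_sum theta2 a c (Re z) (sqrt t)) UNIV"
      using theta2_has_sum(1)[OF a c, of "sqrt t" "Re z"] t by simp
    hence "(?e has_sum theta2 a c (Re z) (sqrt t)) (colon J)"
      unfolding has_sum_reindex_bij_betw[OF bij, of ?e] .
    moreover have "(?e has_sum sum ?e {0}) {0}" by (rule has_sum_finite) simp
    moreover have "0 \<in> colon J" using in_lat[of 0 u 0 v] uv(1) by simp
    ultimately have "(?e has_sum (theta2 a c (Re z) (sqrt t) - sum ?e {0})) (colon J - {0})"
      by (intro has_sum_Diff) auto
    \<comment> \<open>By \<open>nrm_mult\<close> with g = 0 the zero image has \<open>nrm\<close> 0,
      so the omitted term is exp 0 = 1.\<close>
    hence sum0: "(?e has_sum (theta2 a c (Re z) (sqrt t) - 1)) (colon J - {0})"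
      using nrm_mult[OF J, of 0] by simp
    let ?B = "\<lambda>I. {h \<in> colon J - {0}. (*) h ` J = I}"
    have "((\<lambda>(I, h). ?e h) has_sum (theta2 a c (Re z) (sqrt t) - 1)) (SIGMA I:class_rel `` {J}. ?B I)"
      by (subst has_sum_reindex_bij_witness[of _ "\<lambda>h. ((*) h ` J, h)" snd "colon J - {0}" ?e _ _ "theta2 a c (Re z) (sqrt t) - 1"])
         (use sum0 image_colon_in_class[OF J] in auto)
    hence "((\<lambda>I. 2 * exp (- t * nrm I)) has_sum (theta2 a c (Re z) (sqrt t) - 1)) (class_rel `` {J})"
    proof (rule has_sum_SigmaD)
      fix I assume "I \<in> class_rel `` {J}"
      then obtain g where g: "g \<in> colon J - {0}" "I = (*) g ` J" using class_eq_image_colon[OF J] by blast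
      have B: "?B I = {g, - g}" unfolding g(2) by (rule colon_fibre(1)[OF J g(1)])
      have "(*) (- g) ` J = I" using B by blast
      hence "(\<Sum>h\<in>{g, - g}. ?e h) = 2 * exp (- t * nrm I)"
        using colon_fibre(2)[OF J g(1)] by (simp add: g(2))
      thus "((\<lambda>h. case (I, h) of (I, h) \<Rightarrow> ?e h) has_sum 2 * exp (- t * nrm I)) (?B I)"
        unfolding B prod.case using has_sum_finite[of "{g, - g}" ?e] by simp
    qed
    from has_sum_cmult_right[OF this, of "1 / 2"] show ?thesis by simp
  qed
  show ?thesis using a c main by blast
qed

text \<open>The exponential analogue of the Dedekind zeta function, in its arithmetic form;
  \<open>ideals_has_sum\<close> identifies it with the sum over ideals by sorting the triples (k, a,
  b) according to k^2 a.\<close>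

definition zeta_sum :: "real \<Rightarrow> real" where
  "zeta_sum t = (\<Sum>\<^sub>\<infinity>n\<in>{1..}. (\<Sum>d | d dvd n. real_of_int (chi d)) * exp (- t * real n))"

lemma card_triples:
  assumes "n > 0"
  shows "finite {(k, a, b). (k, a, b) \<in> triples \<and> k\<^sup>2 * a = n}" (is "finite ?T")
    and "int (card {(k, a, b). (k, a, b) \<in> triples \<and> k\<^sup>2 * a = n}) = (\<Sum>d | d dvd n. chi d)"
proof -
  let ?S = "SIGMA k:{k. k\<^sup>2 dvd n}. roots (n div k\<^sup>2)"
  have fin: "finite {k. k\<^sup>2 dvd n}" using assms by (intro finite_power_divisors) auto
  have bij: "bij_betw (\<lambda>(k, b). (k, n div k\<^sup>2, b)) ?S ?T"
  proof (rule bij_betwI[where g = "\<lambda>(k, a, b). (k, b)"])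
    show "(\<lambda>(k, b). (k, n div k\<^sup>2, b)) \<in> ?S \<rightarrow> ?T"
      using assms by (auto simp: triples_def Pi_def dvd_div_eq_0_iff intro!: Nat.gr0I)
    show "(\<lambda>(k, a, b). (k, b)) \<in> ?T \<rightarrow> ?S" by (auto simp: triples_def)
  qed (auto simp: triples_def)
  have "finite ?S" using fin by auto
  thus "finite ?T" using bij_betw_finite[OF bij] by simp
  have "int (card ?T) = int (card ?S)" by (simp add: bij_betw_same_card[OF bij])
  also have "\<dots> = (\<Sum>k | k\<^sup>2 dvd n. rho (n div k\<^sup>2))"
    using fin by (subst card_SigmaI) (auto simp: rho_def)
  also have "\<dots> = (\<Sum>d | d dvd n. chi d)" using assms by (rule sum_rho_eq_sum_chi)
  finally show "int (card ?T) = (\<Sum>d | d dvd n. chi d)" .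
qed

lemma chi_abs_le: "\<bar>real_of_int (chi n)\<bar> \<le> 1"
  using chi_values[of n] by auto

lemma ideals_has_sum:
  assumes t: "t > 0"
  shows "((\<lambda>I. exp (- t * nrm I)) has_sum zeta_sum t) nz_ideals"
proof -
  let ?c = "\<lambda>n. \<Sum>d | d dvd n. real_of_int (chi d)"
  let ?T = "\<lambda>n. {(k, a, b). (k, a, b) \<in> triples \<and> k\<^sup>2 * a = n}"
  let ?f = "\<lambda>(n::nat, s::nat \<times> nat \<times> int). exp (- t * real n)"
  have S: "((\<lambda>n. ?c n * exp (- t * real n)) has_sum zeta_sum t) {1..}"
    using lambert_has_sum[of "\<lambda>n. real_of_int (chi n)" t, OF chi_abs_le t]
    unfolding zeta_sum_def by (auto intro!: has_sum_infsum has_sum_imp_summable)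
  have inner: "((\<lambda>s. ?f (n, s)) has_sum (?c n * exp (- t * real n))) (?T n)" if "n \<in> {1..}" for n
  proof -
    have "n > 0" using that by auto
    note ct = card_triples[OF this]
    have "?c n = real_of_int (\<Sum>d | d dvd n. chi d)" by simp
    also have "\<dots> = real (card (?T n))" unfolding ct(2)[symmetric] by simp
    finally have "?c n = real (card (?T n))" .
    thus ?thesis using has_sum_finite[OF ct(1), of "\<lambda>s. ?f (n, s)"] by simp
  qed
  have "?f summable_on (SIGMA n:{1..}. ?T n)"
    by (rule summable_on_SigmaI[OF inner has_sum_imp_summable[OF S]]) auto
  hence "(?f has_sum zeta_sum t) (SIGMA n:{1..}. ?T n)" by (intro has_sum_SigmaI[OF inner S])
  also have "?this \<longleftrightarrow> ((\<lambda>(k, a, b). exp (- t * real (k\<^sup>2 * a))) has_sum zeta_sum t) triples"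
    by (rule has_sum_reindex_bij_witness[of _ "\<lambda>(k, a, b). (k\<^sup>2 * a, (k, a, b))" snd])
       (auto simp: triples_def)
  also have "\<dots> \<longleftrightarrow> ((\<lambda>s. exp (- t * nrm ((\<lambda>(k, a, b). hnf (int k) (int a) b) s))) has_sum zeta_sum t) triples"
    by (rule has_sum_cong) (auto simp: triples_def nrm_hnf)
  also have "\<dots> \<longleftrightarrow> ((\<lambda>I. exp (- t * nrm I)) has_sum zeta_sum t) nz_ideals"
    by (rule has_sum_reindex_bij_betw[OF bij_triples])
  finally show ?thesis .
qed

lemma zeta_sum_limit_chi:
  "((\<lambda>t. 4 * zeta_sum (4 * t) - zeta_sum t) \<longlongrightarrow> 3 / 2 * ((\<Sum>n<p. real n * real_of_int (chi n)) / p)) (at_right 0)"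
  unfolding zeta_sum_def
proof (rule lambert_limit)
  have "real_of_int (\<Sum>n<p. chi n) = 0" unfolding sum_chi by simp
  thus "(\<Sum>n<p. real_of_int (chi n)) = 0" by simp
qed (use chi_abs_le p_gt_3 in \<open>auto simp: chi_0 chi_periodic\<close>)

lemma zeta_sum_limit_classes:
  "((\<lambda>t. 4 * zeta_sum (4 * t) - zeta_sum t) \<longlongrightarrow> - 3 / 2 * real (card (nz_ideals // class_rel))) (at_right 0)"
proof -
  let ?Q = "nz_ideals // class_rel"
  have "\<exists>acx. fst acx > 0 \<and> fst (snd acx) > 0 \<and>
    (\<forall>t>0. ((\<lambda>I. exp (- t * nrm I)) has_sum ((theta2 (fst acx) (fst (snd acx)) (snd (snd acx)) (sqrt t) - 1) / 2)) C)"
    if "C \<in> ?Q" for C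
  proof -
    obtain J where J: "J \<in> nz_ideals" "C = class_rel `` {J}" using \<open>C \<in> ?Q\<close> by (auto elim: quotientE)
    obtain a c x where "a > 0 \<and> c > 0 \<and>
      (\<forall>t>0. ((\<lambda>I. exp (- t * nrm I)) has_sum ((theta2 a c x (sqrt t) - 1) / 2)) C)"
      using class_theta_series[OF J(1)] unfolding J(2) by blast
    thus ?thesis by (intro exI[of _ "(a, c, x)"]) simp
  qed
  then obtain acx where acx: "\<And>C. C \<in> ?Q \<Longrightarrow> fst (acx C) > 0 \<and> fst (snd (acx C)) > 0 \<and>
    (\<forall>t>0. ((\<lambda>I. exp (- t * nrm I)) has_sum
       ((theta2 (fst (acx C)) (fst (snd (acx C))) (snd (snd (acx C))) (sqrt t) - 1) / 2)) C)"
    by metis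
  define T where "T C = theta2 (fst (acx C)) (fst (snd (acx C))) (snd (snd (acx C)))" for C
  have T: "((\<lambda>I. exp (- t * nrm I)) has_sum ((T C (sqrt t) - 1) / 2)) C" if "C \<in> ?Q" "t > 0" for C t
    using acx[OF that(1)] that(2) unfolding T_def by blast
  have zeta: "zeta_sum t = (\<Sum>C\<in>?Q. (T C (sqrt t) - 1) / 2)" if t: "t > 0" for t
  proof -
    have "((\<lambda>(C, I). exp (- t * nrm I)) has_sum zeta_sum t) (SIGMA C:?Q. C)"
    proof (subst has_sum_reindex_bij_witness[of _ "\<lambda>I. (class_rel `` {I}, I)" snd nz_ideals "\<lambda>I. exp (- t * nrm I)" _ _ "zeta_sum t"])
      show "(class_rel `` {snd a}, snd a) = a" if a: "a \<in> (SIGMA C:?Q. C)" for a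
      proof -
        obtain C I where CI: "a = (C, I)" "C \<in> ?Q" "I \<in> C" using a by auto
        then obtain J where "C = class_rel `` {J}" "(J, I) \<in> class_rel" by (auto elim!: quotientE)
        thus ?thesis using equiv_class_eq[OF equiv_class_rel] CI(1) by simp
      qed
      show "snd a \<in> nz_ideals" if "a \<in> (SIGMA C:?Q. C)" for a
        using that by (auto elim!: quotientE simp: class_rel_def)
      show "(class_rel `` {I}, I) \<in> (SIGMA C:?Q. C)" if "I \<in> nz_ideals" for I
        using that equiv_class_self[OF equiv_class_rel that] by (auto intro: quotientI)
    qed (use ideals_has_sum[OF t] in auto)
    hence "((\<lambda>C. (T C (sqrt t) - 1) / 2) has_sum zeta_sum t) ?Q"
      by (rule has_sum_SigmaD) (use T[OF _ t] in simp)
    thus ?thesis using finite_classes has_sum_finite has_sum_unique by blast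
  qed
  have "filterlim sqrt (at_right 0) (at_right 0)"
    by (auto simp: filterlim_at eventually_at_filter intro!: tendsto_eq_intros)
  have lim: "((\<lambda>t. 4 * T C (2 * sqrt t) - T C (sqrt t)) \<longlongrightarrow> 0) (at_right 0)" if "C \<in> ?Q" for C
    unfolding T_def
    by (rule filterlim_compose[OF theta2_limit \<open>filterlim sqrt (at_right 0) (at_right 0)\<close>])
       (use acx[OF that] in auto)
  \<comment> \<open>Each class contributes 4 (-1/2) - (-1/2) = -3/2 besides its theta part;
    replacing t by 4t doubles sqrt t.\<close>
  have "((\<lambda>t. \<Sum>C\<in>?Q. (4 * T C (2 * sqrt t) - T C (sqrt t)) / 2 - 3 / 2) \<longlongrightarrow> (\<Sum>C\<in>?Q. 0 / 2 - 3 / 2)) (at_right 0)"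
    by (intro tendsto_sum tendsto_intros lim) auto
  also have "(\<Sum>C\<in>?Q. 0 / 2 - 3 / 2) = - 3 / 2 * real (card ?Q)" by simp
  also have "((\<lambda>t. \<Sum>C\<in>?Q. (4 * T C (2 * sqrt t) - T C (sqrt t)) / 2 - 3 / 2) \<longlongrightarrow> - 3 / 2 * real (card ?Q)) (at_right 0)
      \<longleftrightarrow> ?thesis"
  proof (rule filterlim_cong[OF refl refl])
    have "(\<Sum>C\<in>?Q. (4 * T C (2 * sqrt t) - T C (sqrt t)) / 2 - 3 / 2) = 4 * zeta_sum (4 * t) - zeta_sum t"
      if t: "t > 0" for t
    proof -
      have "sqrt (4 * t) = 2 * sqrt t" by (simp add: real_sqrt_mult)
      thus ?thesis
        using t by (simp add: zeta sum_distrib_left field_simps flip: sum_subtractf)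
    qed
    thus "\<forall>\<^sub>F t in at_right 0. (\<Sum>C\<in>?Q. (4 * T C (2 * sqrt t) - T C (sqrt t)) / 2 - 3 / 2) = 4 * zeta_sum (4 * t) - zeta_sum t"
      using eventually_at_right_less[of 0] by (auto elim!: eventually_mono)
  qed
  finally show ?thesis .
qed

theorem class_number_formula:
  "real (class_number (quadratic_field (- int p))) = - (\<Sum>n<p. real n * real_of_int (chi n)) / real p"
  using tendsto_unique[OF _ zeta_sum_limit_classes zeta_sum_limit_chi]
  by (simp add: class_number_eq)

theorem relative_class_number_formula:
  "relative_class_number (quadratic_field (- int p)) = - (\<Sum>n<p. real n * real_of_int (chi n)) / real p"
  unfolding relative_class_number_def class_number_formula quadratic_field_Reals class_number_Rats by simp

end

section \<open>Digit expansions\<close>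

text \<open>The digits are known only through their range and their sum, so the tails
  \<open>T k\<close> are identified instead. They lie in [0, 1] and differ from c b^k / p by an
  integer, hence are its fractional part; the digit is then b T(k) - T(k + 1).\<close>

lemma digit_expansion:
  fixes a :: "nat \<Rightarrow> nat" and b p c :: nat
  assumes b: "b \<ge> 2" and p: "p > 1" and bp: "coprime b p" and cp: "coprime c p" and cl: "c < p"
    and digits: "\<And>k. k \<ge> 1 \<Longrightarrow> a k \<le> b - 1"
    and sums: "(\<lambda>k. real (a (Suc k)) / real b ^ Suc k) sums (real c / real p)"
  shows "real (a (Suc k)) = (real b * real (c * b ^ k mod p) - real (c * b ^ Suc k mod p)) / real p"
proof -
  define T where "T k = (\<Sum>i. real (a (Suc (i + k))) / real b ^ Suc i)" for k
  have b0: "real b > 0" using b by simp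
  have sm: "summable (\<lambda>i. real (a (Suc (i + k))) / real b ^ Suc i)" for k
  proof -
    have "summable (\<lambda>i. real (a (Suc (i + k))) / real b ^ Suc (i + k))"
      using summable_ignore_initial_segment[OF sums_summable[OF sums], of k] by simp
    hence "summable (\<lambda>i. real b ^ k * (real (a (Suc (i + k))) / real b ^ Suc (i + k)))"
      by (rule summable_mult)
    thus ?thesis using b0 by (simp add: power_add field_simps)
  qed
  have geo: "(\<lambda>i. (real b - 1) / real b ^ Suc i) sums 1"
  proof -
    have "(\<lambda>i. (real b - 1) / real b * (1 / real b) ^ i) sums ((real b - 1) / real b * (1 / (1 - 1 / real b)))"
      using b by (intro sums_mult geometric_sums) simp
    moreover have "(real b - 1) / real b * (1 / (1 - 1 / real b)) = 1" using b by (simp add: field_simps)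
    ultimately show ?thesis by (simp add: field_simps power_divide)
  qed
  have T01: "0 \<le> T k" "T k \<le> 1" for k
  proof -
    show "0 \<le> T k" unfolding T_def by (intro suminf_nonneg sm) simp
    have "T k \<le> (\<Sum>i. (real b - 1) / real b ^ Suc i)"
      unfolding T_def
    proof (intro suminf_le sm sums_summable[OF geo])
      fix i
      have "real (a (Suc (i + k))) \<le> real b - 1" using digits[of "Suc (i + k)"] b by linarith
      thus "real (a (Suc (i + k))) / real b ^ Suc i \<le> (real b - 1) / real b ^ Suc i"
        using b0 by (intro divide_right_mono) auto
    qed
    thus "T k \<le> 1" using geo by (simp add: sums_iff)
  qed
  have step: "real b * T k = real (a (Suc k)) + T (Suc k)" for k
  proof -
    have "T k = real (a (Suc k)) / real b + (\<Sum>i. real (a (Suc (Suc i + k))) / real b ^ Suc (Suc i))"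
      using suminf_split_head[OF sm[of k]] by (simp add: T_def)
    also have "(\<Sum>i. real (a (Suc (Suc i + k))) / real b ^ Suc (Suc i)) = T (Suc k) / real b"
      unfolding T_def by (subst suminf_divide[symmetric, OF sm]) (simp add: mult_ac)
    finally show ?thesis using b0 by (simp add: field_simps)
  qed
  have T0: "T 0 = real c / real p" using sums by (simp add: T_def sums_iff)
  have Tk: "\<exists>m::int. real (c * b ^ k) = real p * (of_int m + T k)" for k
  proof (induction k)
    case 0
    show ?case using T0 p by (intro exI[of _ 0]) simp
  next
    case (Suc k)
    then obtain m :: int where m: "real (c * b ^ k) = real p * (of_int m + T k)" by blast
    have "real (c * b ^ Suc k) = real b * real (c * b ^ k)" by simp
    also have "\<dots> = real p * (real b * of_int m + real b * T k)" unfolding m by (simp add: algebra_simps)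
    also have "\<dots> = real p * (of_int (int b * m + int (a (Suc k))) + T (Suc k))"
      unfolding step by (simp add: algebra_simps)
    finally show ?case by blast
  qed
  have T: "T k = real (c * b ^ k mod p) / real p" for k
  proof -
    obtain m :: int where m: "real (c * b ^ k) = real p * (of_int m + T k)" using Tk by blast
    have "coprime (c * b ^ k) p" using bp cp by simp
    hence nd: "\<not> p dvd c * b ^ k" using p
      by (metis coprime_common_divisor_nat dvd_refl nat_neq_iff)
    \<comment> \<open>The value 1 belongs to an expansion ending in digits b - 1, and is possible
      only if p divides c b^k.\<close>
    have "T k \<noteq> 1"
    proof
      assume "T k = 1"
      hence "real_of_int (int (c * b ^ k)) = of_int (int p * (m + 1))" using m by simp
      hence "int (c * b ^ k) = int p * (m + 1)" by (simp only: of_int_eq_iff)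
      thus False using nd by (metis dvd_triv_left of_nat_dvd_iff)
    qed
    hence T1: "T k < 1" using T01[of k] by simp
    have eq: "real p * T k = of_int (int (c * b ^ k) - int p * m)" using m by (simp add: algebra_simps)
    have "real_of_int 0 \<le> of_int (int (c * b ^ k) - int p * m)" unfolding eq[symmetric] using T01 by simp
    moreover have "of_int (int (c * b ^ k) - int p * m) < real_of_int (int p)"
      unfolding eq[symmetric] using T1 p by simp
    ultimately have "0 \<le> int (c * b ^ k) - int p * m" "int (c * b ^ k) - int p * m < int p"
      by (simp_all only: of_int_le_iff of_int_less_iff)
    hence "int (c * b ^ k) - int p * m = (int (c * b ^ k) - int p * m) mod int p" by simp
    also have "\<dots> = int (c * b ^ k) mod int p" by (simp add: mod_diff_eq[symmetric])
    also have "\<dots> = int (c * b ^ k mod p)" by (rule zmod_int[symmetric])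
    finally have "real p * T k = of_int (int (c * b ^ k mod p))" unfolding eq by (simp only:)
    thus ?thesis using p by (simp add: field_simps)
  qed
  show ?thesis using step[of k] p unfolding T by (simp add: field_simps)
qed

context prime_3_mod_4
begin

section \<open>Sums over quadratic residues\<close>

lemma chi_square: "\<not> p dvd n \<Longrightarrow> chi (n\<^sup>2) = 1"
  using chi_values[of n] chi_eq_0_iff[of n] by (auto simp: power2_eq_square chi_mult)

lemma chi_mod: "chi (n mod p) = chi n"
  unfolding chi_def by (rule Legendre_cong) (simp add: cong_def zmod_int)

definition quad_residues :: "nat set" where "quad_residues = {n. n < p \<and> chi n = 1}"

lemma finite_quad_residues [simp]: "finite quad_residues" by (simp add: quad_residues_def)

text \<open>Since -1 is a nonresidue, n -> p - n exchanges residues and nonresidues.\<close>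

lemma card_quad_residues: "2 * card quad_residues = p - 1"
proof -
  let ?N = "{n. n < p \<and> chi n = - 1}"
  have "{..<p} = insert 0 (quad_residues \<union> ?N)"
  proof -
    have "chi n = 1 \<or> chi n = - 1" if "n < p" "n \<noteq> 0" for n
      using that chi_values[of n] chi_eq_0_iff[of n] by (auto dest: dvd_imp_le)
    thus ?thesis using p_gt_3 by (auto simp: quad_residues_def)
  qed
  hence "card {..<p} = Suc (card (quad_residues \<union> ?N))"
    by (simp add: quad_residues_def chi_0)
  moreover have "card (quad_residues \<union> ?N) = card quad_residues + card ?N"
    by (rule card_Un_disjoint) (auto simp: quad_residues_def)
  ultimately have "p = Suc (card quad_residues + card ?N)" by simp
  moreover have "card ?N = card quad_residues"
  proof (rule bij_betw_same_card[OF bij_betw_byWitness[where f = "\<lambda>n. p - n" and f' = "\<lambda>n. p - n"]])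
    have "p - n < p" if "chi n \<noteq> 0" for n using that p_gt_3 chi_0 by (cases n) auto
    thus "(\<lambda>n. p - n) ` ?N \<subseteq> quad_residues" "(\<lambda>n. p - n) ` quad_residues \<subseteq> ?N"
      by (auto simp: quad_residues_def chi_minus)
  qed (auto simp: quad_residues_def)
  ultimately show ?thesis by simp
qed

text \<open>For 0 < n < p the number 1 + chi(n) is twice the indicator of the residues; at n = 0 the
  weight n vanishes.\<close>

lemma sum_residues:
  "(\<Sum>n\<in>quad_residues. real n) = (real p * (real p - 1) / 2 + (\<Sum>n<p. real n * real_of_int (chi n))) / 2"
proof -
  have "(\<Sum>n<p. real n) = real p * (real p - 1) / 2"
    by (induction p) (auto simp: field_simps)
  moreover have "2 * (\<Sum>n\<in>quad_residues. real n) = (\<Sum>n<p. real n + real n * real_of_int (chi n))"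
  proof -
    have "(\<Sum>n<p. real n + real n * real_of_int (chi n)) = (\<Sum>n\<in>quad_residues. 2 * real n)"
    proof (rule sum.mono_neutral_cong_right)
      show "\<forall>n\<in>{..<p} - quad_residues. real n + real n * real_of_int (chi n) = 0"
      proof
        fix n assume "n \<in> {..<p} - quad_residues"
        hence "chi n = - 1 \<or> n = 0"
          using chi_values[of n] chi_eq_0_iff[of n] by (auto simp: quad_residues_def dest: dvd_imp_le)
        thus "real n + real n * real_of_int (chi n) = 0" by auto
      qed
    qed (auto simp: quad_residues_def)
    thus ?thesis by (simp add: sum_distrib_left)
  qed
  ultimately show ?thesis by (simp add: sum.distrib)
qed

text \<open>Both b and -1 are nonresidues, so n -> p - (n b mod p) permutes the residues. The
  remainders of n b therefore sum to p times the number of residues minus their sum, which turns the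
  factor b into b + 1.\<close>

lemma theta_sum:
  assumes b: "chi b = - 1"
  shows "(\<Sum>n\<in>quad_residues. (real b * real n - real (n * b mod p)) / real p) =
    (real b - 1) * (real p - 1) / 4 + (real b + 1) * ((\<Sum>n<p. real n * real_of_int (chi n)) / real p) / 2"
proof -
  define X where "X = (\<Sum>n<p. real n * real_of_int (chi n))"
  have cop: "coprime b p"
    using b chi_eq_0_iff[of b] prime_p by (metis coprime_commute neg_equal_0_iff_equal prime_imp_coprime zero_neq_one)
  have "(\<Sum>n\<in>quad_residues. real (n * b mod p)) = (\<Sum>n\<in>quad_residues. real (p - n))"
  proof -
    have nz: "0 < n" if "n \<in> quad_residues" for n using that by (auto simp: quad_residues_def chi_0 intro: Nat.gr0I)
    let ?h = "\<lambda>n. p - n * b mod p"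
    have lt: "n * b mod p < p" for n using p_gt_3 by simp
    have "?h ` quad_residues \<subseteq> quad_residues"
    proof
      fix m assume "m \<in> ?h ` quad_residues"
      then obtain n where n: "n \<in> quad_residues" "m = ?h n" by blast
      have "chi m = - chi (n * b mod p)" unfolding n(2) using lt[of n] by (intro chi_minus) simp
      also have "\<dots> = 1" using n(1) b by (simp add: chi_mod chi_mult quad_residues_def)
      finally have "chi m = 1" .
      moreover from this have "m \<noteq> p" by (auto simp: chi_eq_0_iff[THEN iffD2])
      ultimately show "m \<in> quad_residues" using n(2) by (simp add: quad_residues_def)
    qed
    moreover have inj: "inj_on ?h quad_residues"
    proof (rule inj_onI)
      fix x y assume xy: "x \<in> quad_residues" "y \<in> quad_residues" "?h x = ?h y"
      have "x * b mod p = y * b mod p" using xy(3) lt[of x] lt[of y] by linarith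
      hence "[x = y] (mod p)" using cop cong_mult_rcancel_nat[of b p x y] by (simp add: cong_def)
      thus "x = y" using xy by (simp add: quad_residues_def cong_def)
    qed
    ultimately have img: "?h ` quad_residues = quad_residues" by (intro endo_inj_surj) auto
    have "(\<Sum>n\<in>quad_residues. real (p - n)) = (\<Sum>n\<in>?h ` quad_residues. real (p - n))" by (simp only: img)
    also have "\<dots> = (\<Sum>n\<in>quad_residues. real (p - ?h n))" by (subst sum.reindex[OF inj]) (simp add: o_def)
    also have "\<dots> = (\<Sum>n\<in>quad_residues. real (n * b mod p))"
      by (intro sum.cong refl) (use lt in \<open>simp add: less_imp_le\<close>)
    finally show ?thesis by simp
  qed
  also have "\<dots> = (\<Sum>n\<in>quad_residues. real p - real n)"
    by (intro sum.cong refl) (auto simp: quad_residues_def of_nat_diff)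
  also have "\<dots> = real p * real (card quad_residues) - (\<Sum>n\<in>quad_residues. real n)"
    by (simp add: sum_subtractf)
  finally have N: "(\<Sum>n\<in>quad_residues. real (n * b mod p)) = real p * real (card quad_residues) - (\<Sum>n\<in>quad_residues. real n)" .
  have "real (2 * card quad_residues) = real (p - 1)" by (simp only: card_quad_residues)
  hence c: "real (card quad_residues) = (real p - 1) / 2" using p_gt_3 by (simp add: of_nat_diff)
  have "(\<Sum>n\<in>quad_residues. (real b * real n - real (n * b mod p)) / real p) =
     (real b * (\<Sum>n\<in>quad_residues. real n) - (\<Sum>n\<in>quad_residues. real (n * b mod p))) / real p"
    by (simp add: sum_subtractf sum_distrib_left flip: sum_divide_distrib)
  thus ?thesis using p_gt_3 unfolding N c sum_residues X_def[symmetric] by (simp add: field_simps)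
qed

end

theorem theorem2:
  fixes p b d g :: nat and c :: "nat \<Rightarrow> nat" and a :: "nat \<Rightarrow> nat \<Rightarrow> nat" and S :: "nat \<Rightarrow> nat"
  assumes "prime p" and "p > 3" and "[p = 3] (mod 4)"
    and "b \<ge> 2" and "\<not> QuadRes (int p) (int b)"
    and "d = ord p b"
    and "residue_primroot p g"
    and "\<And>j. j < (p - 1) div d \<Longrightarrow> c j = g ^ (2 * j) mod p"
    and "\<And>j k. j < (p - 1) div d \<Longrightarrow> k \<ge> 1 \<Longrightarrow> a j k \<in> {0..b - 1}"
    and "\<And>j. j < (p - 1) div d \<Longrightarrow>
           (\<lambda>k. real (a j (Suc k)) / real b ^ Suc k) sums (real (c j) / real p)"
    and "\<And>j. j < (p - 1) div d \<Longrightarrow> S j = (\<Sum>k | k \<in> {1..d - 1} \<and> odd k. a j k)"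
  shows "even d \<and>
    (\<forall>j < (p - 1) div d. \<forall>k \<ge> 1. a j (k + d) = a j k) \<and>
    real (\<Sum>j < (p - 1) div d. S j) =
      (real b - 1) * (real p - 1) / 4 -
      (real b + 1) * relative_class_number (quadratic_field (- int p)) / 2"
proof -
  interpret prime_3_mod_4 p
    by unfold_locales (use assms(1-3) in \<open>auto simp: cong_def\<close>)
  let ?e = "(p - 1) div d"
  have p1: "p > 1" using assms(2) by simp
  have ndb: "\<not> p dvd b"
  proof
    assume "p dvd b"
    hence "[0\<^sup>2 = int b] (mod int p)" by (simp add: cong_iff_dvd_diff)
    thus False using assms(5) unfolding QuadRes_def by blast
  qed
  have chib: "chi b = - 1" using ndb assms(5) by (auto simp: chi_def Legendre_def cong_0_iff)
  have cop: "coprime b p" using ndb prime_p by (metis coprime_commute prime_imp_coprime)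
  have copg: "coprime g p" using assms(7) by (simp add: residue_primroot_def coprime_commute)
  have ordg: "ord p g = p - 1" using assms(7) prime_p by (simp add: residue_primroot_def totient_prime)
  have d0: "d > 0" using cop assms(6) by (simp add: coprime_commute)
  have bd: "[b ^ d = 1] (mod p)" unfolding assms(6) by (rule ord)
  have ev: "even d"
  proof (rule ccontr)
    assume "odd d"
    have "chi (b ^ d) = - 1" using \<open>odd d\<close> chib by (simp add: chi_power)
    moreover have "chi (b ^ d) = chi 1" using chi_mod[of "b ^ d"] chi_mod[of 1] bd by (simp add: cong_def)
    ultimately show False by (simp add: chi_1[simplified])
  qed
  have "d dvd p - 1"
    using order_divides_totient[of p b] cop prime_p assms(6) by (simp add: totient_prime coprime_commute)
  hence ed: "?e * d = p - 1" by simp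
  have c: "c j < p" "coprime (c j) p" if "j < ?e" for j
    using assms(8)[OF that] p1 copg by auto
  have digit: "real (a j (Suc k)) = (real b * real (c j * b ^ k mod p) - real (c j * b ^ Suc k mod p)) / real p"
    if "j < ?e" for j k
    by (rule digit_expansion[OF assms(4) p1 cop c(2)[OF that] c(1)[OF that] _ assms(10)[OF that]])
       (use assms(9)[OF that] in auto)
  have per: "a j (k + d) = a j k" if jk: "j < ?e" "k \<ge> 1" for j k
  proof -
    obtain i where k: "k = Suc i" using jk(2) by (cases k) auto
    have "c j * b ^ (i + d) mod p = c j * b ^ i mod p" for i
    proof -
      have "[c j * b ^ i * b ^ d = c j * b ^ i * 1] (mod p)" by (intro cong_mult cong_refl bd)
      thus ?thesis by (simp add: cong_def power_add mult.assoc)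
    qed
    from this[of i] this[of "Suc i"] have "real (a j (Suc (i + d))) = real (a j (Suc i))"
      unfolding digit[OF jk(1)] by simp
    thus ?thesis by (simp add: k)
  qed
  \<comment> \<open>A digit of odd index 2i + 1 in the j-th expansion is determined by c_j b^(2i),
    which is congruent to the square of g^j b^i.\<close>
  let ?h = "\<lambda>(j, i). c j * b ^ (2 * i) mod p"
  have sq: "?h (j, i) = (g ^ j * b ^ i)\<^sup>2 mod p" if "j < ?e" for j i
  proof -
    have "(g ^ j * b ^ i)\<^sup>2 = g ^ (2 * j) * b ^ (2 * i)" by (simp add: power_mult_distrib mult.commute flip: power_mult)
    thus ?thesis using assms(8)[OF that] by (simp only: prod.case mod_mult_left_eq)
  qed
  have "inj_on ?h ({..<?e} \<times> {..<d div 2})"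
  proof (rule inj_onI)
    fix x y assume xy: "x \<in> {..<?e} \<times> {..<d div 2}" "y \<in> {..<?e} \<times> {..<d div 2}" "?h x = ?h y"
    obtain j i j' i' where eq: "x = (j, i)" "y = (j', i')" by (metis surj_pair)
    have ji: "j < ?e" "j' < ?e" "i < d div 2" "i' < d div 2" using xy eq by auto
    have h: "[(g ^ j * b ^ i)\<^sup>2 = (g ^ j' * b ^ i')\<^sup>2] (mod p)"
      using xy(3) sq[OF ji(1)] sq[OF ji(2)] unfolding eq by (simp add: cong_def)
    have bpow: "[b ^ (d * m) = 1] (mod p)" for m
      using cong_pow[OF bd, of m] by (simp add: power_mult)
    have pw: "[((g ^ j * b ^ i)\<^sup>2) ^ d = g ^ (2 * j * d)] (mod p)" for j i
    proof -
      have "((g ^ j * b ^ i)\<^sup>2) ^ d = g ^ (2 * j * d) * b ^ (d * (2 * i))"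
        by (simp add: power_mult_distrib mult_ac flip: power_mult)
      thus ?thesis using cong_mult[OF cong_refl[of "g ^ (2 * j * d)"] bpow[of "2 * i"]] by simp
    qed
    \<comment> \<open>Raising to the power d eliminates b, whose order is d, and leaves powers of g,
      with exponents modulo p - 1 = \<open>?e * d\<close>.\<close>
    have "[g ^ (2 * j * d) = g ^ (2 * j' * d)] (mod p)"
      using cong_pow[OF h, of d] pw cong_trans cong_sym by meson
    hence "[2 * j * d = 2 * j' * d] (mod (p - 1))"
      using order_divides_expdiff[of p g "2 * j * d" "2 * j' * d"] copg ordg by (simp add: coprime_commute)
    hence "[2 * j * d = 2 * j' * d] (mod (?e * d))" unfolding ed .
    hence "[2 * j = 2 * j'] (mod ?e)" using d0 by (simp add: cong_def mod_mult_mult2)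
    \<comment> \<open>Since d is even and 4 does not divide p - 1, the cofactor is odd, so 2 can be
      cancelled in the congruence between 2j and 2j'.\<close>
    moreover have "odd ?e"
    proof
      assume "even ?e"
      hence "2 * 2 dvd ?e * d" using ev by (intro mult_dvd_mono)
      hence "4 dvd p - 1" unfolding ed by simp
      thus False using p_mod_4 p_gt_3 by presburger
    qed
    ultimately have "[j = j'] (mod ?e)" using cong_mult_lcancel_nat[of 2 ?e j j'] by simp
    hence j: "j = j'" using ji by (simp add: cong_def)
    have "[(g ^ j)\<^sup>2 * b ^ (2 * i) = (g ^ j)\<^sup>2 * b ^ (2 * i')] (mod p)"
      using h unfolding j by (simp add: power_mult_distrib mult.commute flip: power_mult)
    hence "[b ^ (2 * i) = b ^ (2 * i')] (mod p)"
      using cong_mult_lcancel_nat[of "(g ^ j)\<^sup>2" p] copg by simp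
    hence "[2 * i = 2 * i'] (mod d)"
      using order_divides_expdiff[of p b "2 * i" "2 * i'"] cop assms(6) by (simp add: coprime_commute)
    moreover have "2 * i < d" "2 * i' < d" using ji(3,4) ev by auto
    ultimately have "i = i'" by (simp add: cong_def)
    thus "x = y" by (simp add: eq j)
  qed
  note inj = this
  have img: "?h ` ({..<?e} \<times> {..<d div 2}) = quad_residues"
  proof (rule card_subset_eq)
    show "?h ` ({..<?e} \<times> {..<d div 2}) \<subseteq> quad_residues"
    proof
      fix x assume "x \<in> ?h ` ({..<?e} \<times> {..<d div 2})"
      then obtain j i where ji: "j < ?e" "x = ?h (j, i)" by auto
      have "coprime (g ^ j * b ^ i) p" using copg cop by simp
      hence "\<not> p dvd g ^ j * b ^ i" using p1 by (metis coprime_common_divisor_nat dvd_refl nat_neq_iff)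
      hence "chi x = 1" unfolding ji(2) sq[OF ji(1)] chi_mod by (rule chi_square)
      thus "x \<in> quad_residues" using ji p1 by (simp add: quad_residues_def)
    qed
    \<comment> \<open>There are (p - 1)/2 pairs, as many as residues, so injectivity already gives
      surjectivity.\<close>
    have "2 * (?e * (d div 2)) = ?e * d" using ev by simp
    hence "2 * (?e * (d div 2)) = 2 * card quad_residues" unfolding ed card_quad_residues .
    thus "card (?h ` ({..<?e} \<times> {..<d div 2})) = card quad_residues"
      unfolding card_image[OF inj] by simp
  qed simp
  have Sj: "real (S j) = (\<Sum>i<d div 2. (real b * real (?h (j, i)) - real (?h (j, i) * b mod p)) / real p)"
    if j: "j < ?e" for j
  proof -
    have "(\<Sum>k | k \<in> {1..d - 1} \<and> odd k. a j k) = (\<Sum>i<d div 2. a j (Suc (2 * i)))"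
      by (rule sum.reindex_bij_witness[of _ "\<lambda>i. Suc (2 * i)" "\<lambda>k. (k - 1) div 2"])
         (use ev d0 in \<open>auto elim!: evenE oddE\<close>)
    hence "real (S j) = (\<Sum>i<d div 2. real (a j (Suc (2 * i))))"
      using assms(11)[OF j] by simp
    also have "\<dots> = (\<Sum>i<d div 2. (real b * real (?h (j, i)) - real (?h (j, i) * b mod p)) / real p)"
    proof -
      have "c j * b ^ Suc (2 * i) mod p = ?h (j, i) * b mod p" for i
        by (simp only: prod.case mod_mult_left_eq power_Suc2 mult.assoc)
      thus ?thesis unfolding digit[OF j] by simp
    qed
    finally show ?thesis .
  qed
  have "real (\<Sum>j<?e. S j) = (\<Sum>j<?e. \<Sum>i<d div 2. (real b * real (?h (j, i)) - real (?h (j, i) * b mod p)) / real p)"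
    by (simp add: Sj)
  also have "\<dots> = (\<Sum>x\<in>{..<?e} \<times> {..<d div 2}. (real b * real (?h x) - real (?h x * b mod p)) / real p)"
    by (simp add: sum.cartesian_product case_prod_unfold)
  also have "\<dots> = (\<Sum>n\<in>quad_residues. (real b * real n - real (n * b mod p)) / real p)"
    unfolding img[symmetric] by (subst sum.reindex[OF inj]) (simp add: o_def)
  also have "\<dots> = (real b - 1) * (real p - 1) / 4 -
      (real b + 1) * relative_class_number (quadratic_field (- int p)) / 2"
    unfolding theta_sum[OF chib] relative_class_number_formula by simp
  finally show ?thesis using ev per by blast
qed

end
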